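(* Let $e$ be an idempotent in $A$, and let $B := A/AeA$. Then $$\operatorname{Irr}(B)\cap\operatorname{Irr}^{\tau}(A)=\operatorname{Irr}^{\tau}(B).$$
   Context: $K$ is an algebraically closed field and $A=KQ/I$, where $Q=(Q_0,Q_1,s,t)$ is a finite quiver with $Q_0=\{1,\dots,n\}$ (an arrow $a$ goes from $s(a)$ to $t(a)$) and $I$ is an admissible ideal of $KQ$. Modules are finite-dimensional left modules; dimension vectors in $\mathbb{N}^n$ record the Jordan-Hölder multiplicities of the simple modules $S(1),\dots,S(n)$. For $\mathbf d\in\mathbb{N}^n$ let $\operatorname{rep}(Q,\mathbf d)=\prod_{a\in Q_1}\operatorname{Hom}_K(K^{d_{s(a)}},K^{d_{t(a)}})$ and $\operatorname{mod}(A,\mathbf d)=\{M\in\operatorname{rep}(Q,\mathbf d)\mid IM=0\}$, with the conjugation action of $G_{\mathbf d}=\prod_i\operatorname{GL}_{d_i}(K)$; $\mathcal O_M$ is the orbit of $M$. Let $\operatorname{mod}(B,\mathbf d)=\{M\in\operatorname{mod}(A,\mathbf d)\mid (AeA)M=0\}$. For $C\in\{A,B\}$, $\operatorname{Irr}(C,\mathbf d)$ is the set of irreducible components of $\operatorname{mod}(C,\mathbf d)$, and $\operatorname{Irr}(C)=\bigcup_{\mathbf d}\operatorname{Irr}(C,\mathbf d)$. Here $\operatorname{mod}(B,\mathbf d)$ is nonempty only if $d_i=0$ whenever $eS(i)\neq 0$, and then $\operatorname{mod}(B,\mathbf d)=\operatorname{mod}(A,\mathbf d)$; thus $\operatorname{Irr}(B)=\{\mathcal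 Z\in\operatorname{Irr}(A)\mid (AeA)\mathcal Z=0\}\subseteq\operatorname{Irr}(A)$. For $M\in\operatorname{mod}(C,\mathbf d)$ let $\operatorname{mod}_M(C,\mathbf d)$ be the union of all irreducible components of $\operatorname{mod}(C,\mathbf d)$ containing $M$; put $c_C(M)=\dim\operatorname{mod}_M(C,\mathbf d)-\dim\mathcal O_M$ and $E_C(M)=\dim\operatorname{Hom}_C(M,\tau_C(M))$, where $\tau_C$ is the Auslander-Reiten translation for $C$. $M$ is $\tau_C$-regular if $c_C(M)=E_C(M)$. A component $\mathcal Z\in\operatorname{Irr}(C)$ is generically $\tau$-regular (for $C$) if it contains a dense open subset consisting of $\tau_C$-regular modules; $\operatorname{Irr}^{\tau}(C)$ is the set of these components. *)

theory Defs
  imports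
    "Graph_Theory.Arc_Walk"
    "Jordan_Normal_Form.Matrix"
    "HOL-Algebra.QuotRing"
    "HOL-Computational_Algebra.Polynomial"
    "HOL-Library.Function_Algebras"
    "HOL-Analysis.Abstract_Topology"
begin

section \<open>Path algebras, admissible ideals and quotient algebras\<close>

text \<open>
  A finite quiver is a \<^locale>\<open>fin_digraph\<close>; loops and parallel arcs are allowed, and
  \<open>s = tail Q\<close>, \<open>t = head Q\<close>. A path is a pair of its starting vertex and the list of its
  arcs in the order in which they are walked, so that \<open>(i, [])\<close> is the trivial path at \<open>i\<close>.
\<close>

definition quiver_paths :: "('v, 'a) pre_digraph \<Rightarrow> ('v \<times> 'a list) set" where
  "quiver_paths Q = {(u, p). \<exists>v. pre_digraph.awalk Q u p v}"

definition path_end :: "('v, 'a) pre_digraph \<Rightarrow> 'v \<Rightarrow> 'a list \<Rightarrow> 'v" where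
  "path_end Q u p = last (pre_digraph.awalk_verts Q u p)"

text \<open>
  A \<open>K\<close>-algebra, not necessarily commutative, is a record of type \<open>('k, 'c) module\<close>, whose field
  \<^const>\<open>module.smult\<close> is the scalar multiplication by elements of the type \<open>'k\<close>.
  Since modules are left modules, the product \<open>f g\<close> of paths walks \<open>g\<close> first and then \<open>f\<close>.
\<close>

definition path_algebra :: "('v, 'a) pre_digraph \<Rightarrow> ('k::field, 'v \<times> 'a list \<Rightarrow> 'k) module" where
  "path_algebra Q =
    \<lparr>carrier = {f. finite {w. f w \<noteq> 0} \<and> {w. f w \<noteq> 0} \<subseteq> quiver_paths Q},
     mult = (\<lambda>f g (u, p). \<Sum>k\<le>length p. f (path_end Q u (take k p), drop k p) * g (u, take k p)),
     one = (\<lambda>(u, p). if u \<in> verts Q \<and> p = [] then 1 else 0),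
     zero = (\<lambda>w. 0),
     add = (\<lambda>f g w. f w + g w),
     module.smult = (\<lambda>c f w. c * f w)\<rparr>"

text \<open>The \<open>m\<close>-th power of the arrow ideal: the span of the paths of length at least \<open>m\<close>.\<close>

definition arrow_ideal_power ::
    "('v, 'a) pre_digraph \<Rightarrow> nat \<Rightarrow> ('v \<times> 'a list \<Rightarrow> 'k::field) set" where
  "arrow_ideal_power Q m =
    {f \<in> carrier (path_algebra Q). \<forall>u p. f (u, p) \<noteq> 0 \<longrightarrow> m \<le> length p}"

definition admissible_ideal ::
    "('v, 'a) pre_digraph \<Rightarrow> ('v \<times> 'a list \<Rightarrow> 'k::field) set \<Rightarrow> bool" where
  "admissible_ideal Q I \<longleftrightarrow> ideal I (path_algebra Q) \<and>
    (\<exists>m\<ge>2. arrow_ideal_power Q m \<subseteq> I \<and> I \<subseteq> arrow_ideal_power Q 2)"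

text \<open>The quotient ring \<open>C Quot J\<close> together with the scalar multiplication induced from \<open>C\<close>.\<close>

definition quot_algebra :: "('k, 'c) module \<Rightarrow> 'c set \<Rightarrow> ('k, 'c set) module" where
  "quot_algebra C J =
    \<lparr>carrier = carrier (C Quot J), mult = mult (C Quot J), one = one (C Quot J),
     zero = zero (C Quot J), add = add (C Quot J),
     module.smult = (\<lambda>k X. \<Union>x\<in>X. J +>\<^bsub>C\<^esub> (k \<odot>\<^bsub>C\<^esub> x))\<rparr>"


section \<open>Finite-dimensional modules over an algebra\<close>

text \<open>
  The underlying vector spaces of all modules are subspaces of spaces \<open>'x \<Rightarrow> 'k\<close> of functions, with
  pointwise operations; every vector space is isomorphic to one of these. Linear maps between such
  subspaces are functions that vanish outside of their domain, and they form a vector space under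
  \<open>hom_scale\<close>.
\<close>

definition fun_scale :: "'k::field \<Rightarrow> ('x \<Rightarrow> 'k) \<Rightarrow> 'x \<Rightarrow> 'k" where
  "fun_scale c v = (\<lambda>x. c * v x)"

interpretation fun_vs: vector_space fun_scale
  by unfold_locales (auto simp: fun_scale_def fun_eq_iff algebra_simps)

definition hom_scale :: "'k::field \<Rightarrow> ('v \<Rightarrow> 'y \<Rightarrow> 'k) \<Rightarrow> 'v \<Rightarrow> 'y \<Rightarrow> 'k" where
  "hom_scale c h = (\<lambda>v. fun_scale c (h v))"

interpretation hom_vs: vector_space hom_scale
  by unfold_locales (auto simp: hom_scale_def fun_scale_def fun_eq_iff algebra_simps)

record ('c, 'v) lmod =
  underlying :: "'v set"
  action :: "'c \<Rightarrow> 'v \<Rightarrow> 'v"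

definition fd_module :: "('k::field, 'c) module \<Rightarrow> ('c, 'x \<Rightarrow> 'k) lmod \<Rightarrow> bool" where
  "fd_module C N \<longleftrightarrow>
     fun_vs.subspace (underlying N) \<and>
     (\<exists>S. finite S \<and> underlying N \<subseteq> fun_vs.span S) \<and>
     (\<forall>c\<in>carrier C. \<forall>v\<in>underlying N. action N c v \<in> underlying N) \<and>
     (\<forall>c\<in>carrier C. \<forall>v\<in>underlying N. \<forall>w\<in>underlying N.
        action N c (v + w) = action N c v + action N c w) \<and>
     (\<forall>c\<in>carrier C. \<forall>k. \<forall>v\<in>underlying N.
        action N c (fun_scale k v) = fun_scale k (action N c v)) \<and>
     (\<forall>b\<in>carrier C. \<forall>c\<in>carrier C. \<forall>v\<in>underlying N.
        action N (b \<oplus>\<^bsub>C\<^esub> c) v = action N b v + action N c v) \<and>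
     (\<forall>k. \<forall>c\<in>carrier C. \<forall>v\<in>underlying N.
        action N (k \<odot>\<^bsub>C\<^esub> c) v = fun_scale k (action N c v)) \<and>
     (\<forall>b\<in>carrier C. \<forall>c\<in>carrier C. \<forall>v\<in>underlying N.
        action N (b \<otimes>\<^bsub>C\<^esub> c) v = action N b (action N c v)) \<and>
     (\<forall>v\<in>underlying N. action N \<one>\<^bsub>C\<^esub> v = v)"

definition module_hom ::
    "('k::field, 'c) module \<Rightarrow> ('c, 'x \<Rightarrow> 'k) lmod \<Rightarrow> ('c, 'y \<Rightarrow> 'k) lmod
      \<Rightarrow> (('x \<Rightarrow> 'k) \<Rightarrow> 'y \<Rightarrow> 'k) set" where
  "module_hom C M N = {h.
     (\<forall>v\<in>underlying M. h v \<in> underlying N) \<and>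
     (\<forall>v. v \<notin> underlying M \<longrightarrow> h v = 0) \<and>
     (\<forall>v\<in>underlying M. \<forall>w\<in>underlying M. h (v + w) = h v + h w) \<and>
     (\<forall>k. \<forall>v\<in>underlying M. h (fun_scale k v) = fun_scale k (h v)) \<and>
     (\<forall>c\<in>carrier C. \<forall>v\<in>underlying M. h (action M c v) = action N c (h v))}"

definition submodule_of ::
    "('k::field, 'c) module \<Rightarrow> ('x \<Rightarrow> 'k) set \<Rightarrow> ('c, 'x \<Rightarrow> 'k) lmod \<Rightarrow> bool" where
  "submodule_of C U N \<longleftrightarrow> fun_vs.subspace U \<and> U \<subseteq> underlying N \<and>
     (\<forall>c\<in>carrier C. \<forall>u\<in>U. action N c u \<in> U)"

text \<open>The module over \<open>C/J\<close> given by a \<open>C\<close>-module \<open>N\<close> with \<open>J N = 0\<close>.\<close>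

definition quot_module :: "('c, 'v) lmod \<Rightarrow> ('c set, 'v) lmod" where
  "quot_module N = \<lparr>underlying = underlying N, action = (\<lambda>X. action N (SOME c. c \<in> X))\<rparr>"

definition annihilates :: "'c \<Rightarrow> ('c, 'v::zero) lmod \<Rightarrow> bool" where
  "annihilates c N \<longleftrightarrow> (\<forall>v\<in>underlying N. action N c v = 0)"


section \<open>Minimal projective presentations and the Auslander-Reiten translation\<close>

text \<open>
  Projectivity in the category of finite-dimensional modules. The test modules \<open>X\<close>, \<open>Y\<close> are taken
  inside of \<open>nat \<Rightarrow> 'k\<close>, where every finite-dimensional module has an isomorphic copy. For the
  same reason, minimal projective presentations are taken with modules of this type below.
\<close>

definition projective ::
    "('k::field, 'c) module \<Rightarrow> ('c, nat \<Rightarrow> 'k) lmod \<Rightarrow> bool" where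
  "projective C P \<longleftrightarrow> fd_module C P \<and>
     (\<forall>(X :: ('c, nat \<Rightarrow> 'k) lmod) (Y :: ('c, nat \<Rightarrow> 'k) lmod) g f.
        fd_module C X \<and> fd_module C Y \<and> g \<in> module_hom C X Y \<and>
        g ` underlying X = underlying Y \<and> f \<in> module_hom C P Y \<longrightarrow>
        (\<exists>h\<in>module_hom C P X. \<forall>v\<in>underlying P. g (h v) = f v))"

definition superfluous ::
    "('k::field, 'c) module \<Rightarrow> ('x \<Rightarrow> 'k) set \<Rightarrow> ('c, 'x \<Rightarrow> 'k) lmod \<Rightarrow> bool" where
  "superfluous C L N \<longleftrightarrow> submodule_of C L N \<and>
     (\<forall>U. submodule_of C U N \<and> {l + u |l u. l \<in> L \<and> u \<in> U} = underlying N \<longrightarrow> U = underlying N)"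

definition hom_kernel :: "('c, 'v) lmod \<Rightarrow> ('v \<Rightarrow> 'w::zero) \<Rightarrow> 'v set" where
  "hom_kernel M h = {v \<in> underlying M. h v = 0}"

definition projective_cover ::
    "('k::field, 'c) module \<Rightarrow> ('c, nat \<Rightarrow> 'k) lmod \<Rightarrow> ((nat \<Rightarrow> 'k) \<Rightarrow> 'x \<Rightarrow> 'k)
      \<Rightarrow> ('c, 'x \<Rightarrow> 'k) lmod \<Rightarrow> bool" where
  "projective_cover C P p N \<longleftrightarrow> projective C P \<and> p \<in> module_hom C P N \<and>
     p ` underlying P = underlying N \<and> superfluous C (hom_kernel P p) P"

definition minimal_projective_presentation ::
    "('k::field, 'c) module \<Rightarrow> ('c, nat \<Rightarrow> 'k) lmod \<Rightarrow> ((nat \<Rightarrow> 'k) \<Rightarrow> nat \<Rightarrow> 'k)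
      \<Rightarrow> ('c, nat \<Rightarrow> 'k) lmod \<Rightarrow> ((nat \<Rightarrow> 'k) \<Rightarrow> 'x \<Rightarrow> 'k) \<Rightarrow> ('c, 'x \<Rightarrow> 'k) lmod \<Rightarrow> bool" where
  "minimal_projective_presentation C P1 p1 P0 p0 N \<longleftrightarrow>
     projective_cover C P0 p0 N \<and>
     projective_cover C P1 p1 (P0\<lparr>underlying := hom_kernel P0 p0\<rparr>)"

text \<open>\<open>Hom\<^sub>C(P, C)\<close>, a right \<open>C\<close>-module by \<open>(f c)(v) = f(v) c\<close>.\<close>

definition hom_to_algebra ::
    "('k::field, 'c) module \<Rightarrow> ('c, 'x \<Rightarrow> 'k) lmod \<Rightarrow> (('x \<Rightarrow> 'k) \<Rightarrow> 'c) set" where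
  "hom_to_algebra C P = {f \<in> underlying P \<rightarrow>\<^sub>E carrier C.
     (\<forall>v\<in>underlying P. \<forall>w\<in>underlying P. f (v + w) = f v \<oplus>\<^bsub>C\<^esub> f w) \<and>
     (\<forall>k. \<forall>v\<in>underlying P. f (fun_scale k v) = k \<odot>\<^bsub>C\<^esub> f v) \<and>
     (\<forall>c\<in>carrier C. \<forall>v\<in>underlying P. f (action P c v) = c \<otimes>\<^bsub>C\<^esub> f v)}"

text \<open>
  The Nakayama functor \<open>\<nu> = D Hom\<^sub>C(-, C)\<close> with \<open>D = Hom\<^sub>K(-, K)\<close>; the functionals vanish outside
  of \<open>Hom\<^sub>C(P, C)\<close>.
\<close>

definition nakayama ::
    "('k::field, 'c) module \<Rightarrow> ('c, 'x \<Rightarrow> 'k) lmod \<Rightarrow> ('c, (('x \<Rightarrow> 'k) \<Rightarrow> 'c) \<Rightarrow> 'k) lmod" where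
  "nakayama C P =
    \<lparr>underlying = {\<xi>.
       (\<forall>f. f \<notin> hom_to_algebra C P \<longrightarrow> \<xi> f = 0) \<and>
       (\<forall>f\<in>hom_to_algebra C P. \<forall>g\<in>hom_to_algebra C P.
          \<xi> (\<lambda>v\<in>underlying P. f v \<oplus>\<^bsub>C\<^esub> g v) = \<xi> f + \<xi> g) \<and>
       (\<forall>k. \<forall>f\<in>hom_to_algebra C P. \<xi> (\<lambda>v\<in>underlying P. k \<odot>\<^bsub>C\<^esub> f v) = k * \<xi> f)},
     action = (\<lambda>c \<xi> f. if f \<in> hom_to_algebra C P
       then \<xi> (\<lambda>v\<in>underlying P. f v \<otimes>\<^bsub>C\<^esub> c) else 0)\<rparr>"

definition nakayama_map ::
    "('k::field, 'c) module \<Rightarrow> ('c, 'x \<Rightarrow> 'k) lmod \<Rightarrow> ('c, 'y \<Rightarrow> 'k) lmod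
      \<Rightarrow> (('x \<Rightarrow> 'k) \<Rightarrow> 'y \<Rightarrow> 'k) \<Rightarrow> ((('x \<Rightarrow> 'k) \<Rightarrow> 'c) \<Rightarrow> 'k) \<Rightarrow> (('y \<Rightarrow> 'k) \<Rightarrow> 'c) \<Rightarrow> 'k" where
  "nakayama_map C P P' p \<xi> =
     (\<lambda>f. if f \<in> hom_to_algebra C P' then \<xi> (\<lambda>v\<in>underlying P. f (p v)) else 0)"

text \<open>
  \<open>\<tau>\<^sub>C(N) = D Tr(N)\<close>, where \<open>Tr(N)\<close> is the cokernel of \<open>Hom\<^sub>C(p1, C)\<close> for a minimal projective
  presentation \<open>p1 : P1 \<rightarrow> P0\<close> of \<open>N\<close>. The dual of this cokernel is the kernel of
  \<open>\<nu>(p1) : \<nu>(P1) \<rightarrow> \<nu>(P0)\<close>, that is, it consists of the functionals on \<open>Hom\<^sub>C(P1, C)\<close> that vanish on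
  the image of \<open>Hom\<^sub>C(P0, C)\<close>. Up to isomorphism, it does not depend on the chosen presentation.
\<close>

definition ar_translate ::
    "('k::field, 'c) module \<Rightarrow> ('c, 'x \<Rightarrow> 'k) lmod
      \<Rightarrow> ('c, ((nat \<Rightarrow> 'k) \<Rightarrow> 'c) \<Rightarrow> 'k) lmod" where
  "ar_translate C N =
    (let (P1, p1, P0, p0) =
       (SOME (P1, p1, P0, p0). minimal_projective_presentation C P1 p1 P0 p0 N)
     in (nakayama C P1)\<lparr>underlying := hom_kernel (nakayama C P1) (nakayama_map C P1 P0 p1)\<rparr>)"

definition E_inv :: "('k::field, 'c) module \<Rightarrow> ('c, 'x \<Rightarrow> 'k) lmod \<Rightarrow> nat" where
  "E_inv C N = hom_vs.dim (module_hom C N (ar_translate C N))"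


section \<open>Irreducible components and dimension of topological spaces\<close>

definition irreducible_in :: "'p topology \<Rightarrow> 'p set \<Rightarrow> bool" where
  "irreducible_in T S \<longleftrightarrow> S \<noteq> {} \<and> S \<subseteq> topspace T \<and>
     (\<forall>F G. closedin T F \<and> closedin T G \<and> S \<subseteq> F \<union> G \<longrightarrow> S \<subseteq> F \<or> S \<subseteq> G)"

definition irreducible_components :: "'p topology \<Rightarrow> 'p set set" where
  "irreducible_components T =
     {Z. irreducible_in T Z \<and> (\<forall>Z'. irreducible_in T Z' \<and> Z \<subseteq> Z' \<longrightarrow> Z' = Z)}"

text \<open>
  The Krull dimension. The lengths of chains are bounded for the subspaces of affine spaces to which
  this is applied, so that \<^const>\<open>Sup\<close> on \<^typ>\<open>nat\<close> is a maximum.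
\<close>

definition krull_dim :: "'p topology \<Rightarrow> nat" where
  "krull_dim T = Sup {m. \<exists>Z :: nat \<Rightarrow> 'p set.
     (\<forall>i\<le>m. closedin T (Z i) \<and> irreducible_in T (Z i)) \<and> (\<forall>i<m. Z i \<subset> Z (Suc i))}"


section \<open>Module varieties\<close>

definition dim_vectors :: "('v, 'a) pre_digraph \<Rightarrow> ('v \<Rightarrow> nat) set" where
  "dim_vectors Q = {d. \<forall>i. i \<notin> verts Q \<longrightarrow> d i = 0}"

definition rep :: "('v, 'a) pre_digraph \<Rightarrow> ('v \<Rightarrow> nat) \<Rightarrow> ('a \<Rightarrow> 'k::field mat) set" where
  "rep Q d = (\<Pi>\<^sub>E a\<in>arcs Q. carrier_mat (d (head Q a)) (d (tail Q a)))"

primrec path_mat ::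
    "('v, 'a) pre_digraph \<Rightarrow> ('v \<Rightarrow> nat) \<Rightarrow> ('a \<Rightarrow> 'k::field mat) \<Rightarrow> 'v \<Rightarrow> 'a list \<Rightarrow> 'k mat" where
  "path_mat Q d M u [] = 1\<^sub>m (d u)"
| "path_mat Q d M u (a # p) = path_mat Q d M (head Q a) p * M a"

text \<open>
  The module over the path algebra given by a representation. Its underlying space is the direct sum
  of the \<open>K\<^bsup>d i\<^esup>\<close>; the value of \<open>v\<close> at \<open>(i, r)\<close> is the \<open>r\<close>-th coordinate of the \<open>i\<close>-th component.
\<close>

definition rep_module ::
    "('v, 'a) pre_digraph \<Rightarrow> ('v \<Rightarrow> nat) \<Rightarrow> ('a \<Rightarrow> 'k::field mat)
      \<Rightarrow> ('v \<times> 'a list \<Rightarrow> 'k, 'v \<times> nat \<Rightarrow> 'k) lmod" where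
  "rep_module Q d M =
    \<lparr>underlying = {v. \<forall>i r. v (i, r) \<noteq> 0 \<longrightarrow> i \<in> verts Q \<and> r < d i},
     action = (\<lambda>f v (i, r). if r < d i
       then \<Sum>(u, p)\<in>{(u, p). f (u, p) \<noteq> 0 \<and> path_end Q u p = i}.
              f (u, p) * (path_mat Q d M u p *\<^sub>v vec (d u) (\<lambda>j. v (u, j))) $ r
       else 0)\<rparr>"

definition mod_var ::
    "('v, 'a) pre_digraph \<Rightarrow> ('v \<times> 'a list \<Rightarrow> 'k::field) set \<Rightarrow> ('v \<Rightarrow> nat) \<Rightarrow> ('a \<Rightarrow> 'k mat) set" where
  "mod_var Q I d = {M \<in> rep Q d. \<forall>f\<in>I. annihilates f (rep_module Q d M)}"

text \<open>The modules over \<open>A = KQ/I\<close> and over \<open>A/J\<close>, where \<open>J\<close> is an ideal of \<open>A\<close>.\<close>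

definition A_module ::
    "('v, 'a) pre_digraph \<Rightarrow> ('v \<Rightarrow> nat) \<Rightarrow> ('a \<Rightarrow> 'k::field mat)
      \<Rightarrow> (('v \<times> 'a list \<Rightarrow> 'k) set, 'v \<times> nat \<Rightarrow> 'k) lmod" where
  "A_module Q d M = quot_module (rep_module Q d M)"

definition quot_mod_var ::
    "('v, 'a) pre_digraph \<Rightarrow> ('v \<times> 'a list \<Rightarrow> 'k::field) set \<Rightarrow> ('v \<times> 'a list \<Rightarrow> 'k) set set
      \<Rightarrow> ('v \<Rightarrow> nat) \<Rightarrow> ('a \<Rightarrow> 'k mat) set" where
  "quot_mod_var Q I J d = {M \<in> mod_var Q I d. \<forall>x\<in>J. annihilates x (A_module Q d M)}"

definition B_module ::
    "('v, 'a) pre_digraph \<Rightarrow> ('v \<Rightarrow> nat) \<Rightarrow> ('a \<Rightarrow> 'k::field mat)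
      \<Rightarrow> (('v \<times> 'a list \<Rightarrow> 'k) set set, 'v \<times> nat \<Rightarrow> 'k) lmod" where
  "B_module Q d M = quot_module (A_module Q d M)"

text \<open>The orbit under \<open>\<Prod>\<^sub>i GL\<^bsub>d i\<^esub>(K)\<close>; the matrix \<open>h i\<close> is the inverse of \<open>g i\<close>.\<close>

definition rep_orbit ::
    "('v, 'a) pre_digraph \<Rightarrow> ('v \<Rightarrow> nat) \<Rightarrow> ('a \<Rightarrow> 'k::field mat) \<Rightarrow> ('a \<Rightarrow> 'k mat) set" where
  "rep_orbit Q d M = {N \<in> rep Q d. \<exists>g h.
     (\<forall>i\<in>verts Q. g i \<in> carrier_mat (d i) (d i) \<and> h i \<in> carrier_mat (d i) (d i) \<and>
        inverts_mat (g i) (h i) \<and> inverts_mat (h i) (g i)) \<and>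
     (\<forall>a\<in>arcs Q. N a = g (head Q a) * M a * h (tail Q a))}"

inductive_set polynomial_functions ::
    "('v, 'a) pre_digraph \<Rightarrow> ('v \<Rightarrow> nat) \<Rightarrow> (('a \<Rightarrow> 'k::field mat) \<Rightarrow> 'k) set"
  for Q :: "('v, 'a) pre_digraph" and d :: "'v \<Rightarrow> nat" where
  const: "(\<lambda>M. c) \<in> polynomial_functions Q d"
| coordinate: "\<lbrakk>a \<in> arcs Q; i < d (head Q a); j < d (tail Q a)\<rbrakk>
    \<Longrightarrow> (\<lambda>M. M a $$ (i, j)) \<in> polynomial_functions Q d"
| sum: "\<lbrakk>f \<in> polynomial_functions Q d; g \<in> polynomial_functions Q d\<rbrakk>
    \<Longrightarrow> (\<lambda>M. f M + g M) \<in> polynomial_functions Q d"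
| product: "\<lbrakk>f \<in> polynomial_functions Q d; g \<in> polynomial_functions Q d\<rbrakk>
    \<Longrightarrow> (\<lambda>M. f M * g M) \<in> polynomial_functions Q d"

definition zariski :: "('v, 'a) pre_digraph \<Rightarrow> ('v \<Rightarrow> nat) \<Rightarrow> ('a \<Rightarrow> 'k::field mat) topology" where
  "zariski Q d = topology (\<lambda>U. \<exists>F\<subseteq>polynomial_functions Q d. U = {M \<in> rep Q d. \<exists>f\<in>F. f M \<noteq> 0})"

lemma openin_zariski:
  fixes U :: "('a \<Rightarrow> 'k::field mat) set"
  shows "openin (zariski Q d) U \<longleftrightarrow>
     (\<exists>F\<subseteq>polynomial_functions Q d. U = {M \<in> rep Q d. \<exists>f\<in>F. f M \<noteq> 0})"
proof -
  let ?P = "polynomial_functions Q d :: (('a \<Rightarrow> 'k mat) \<Rightarrow> 'k) set"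
  define D where "D F = {M \<in> rep Q d. \<exists>f\<in>F. f M \<noteq> 0}" for F :: "(('a \<Rightarrow> 'k mat) \<Rightarrow> 'k) set"
  have Int: "\<exists>H\<subseteq>?P. D F \<inter> D G = D H" if "F \<subseteq> ?P" "G \<subseteq> ?P" for F G
  proof (intro exI conjI)
    let ?H = "(\<lambda>(f, g) M. f M * g M) ` (F \<times> G)"
    show "?H \<subseteq> ?P"
      using that by (auto simp: subset_iff intro: polynomial_functions.product)
    show "D F \<inter> D G = D ?H"
      by (auto simp: D_def)
  qed
  have Un: "\<exists>H\<subseteq>?P. \<Union>K = D H" if K: "\<forall>S\<in>K. \<exists>F\<subseteq>?P. S = D F" for K
  proof (intro exI conjI)
    let ?H = "\<Union>{F. F \<subseteq> ?P \<and> D F \<in> K}"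
    show "?H \<subseteq> ?P" by auto
    show "\<Union>K = D ?H"
    proof (rule equalityI; rule subsetI)
      fix M assume "M \<in> \<Union>K"
      then obtain S where S: "S \<in> K" "M \<in> S" by (rule UnionE)
      from bspec[OF K S(1)] obtain F where F: "F \<subseteq> ?P" "S = D F" by blast
      with S have "F \<in> {F. F \<subseteq> ?P \<and> D F \<in> K}" and "M \<in> D F" by simp_all
      then show "M \<in> D ?H" unfolding D_def by (simp, elim conjE bexE) auto
    next
      fix M assume "M \<in> D ?H"
      then obtain f F where "M \<in> rep Q d" "f M \<noteq> 0" "f \<in> F" "D F \<in> K"
        unfolding D_def by auto
      then have "M \<in> D F" unfolding D_def by auto
      with \<open>D F \<in> K\<close> show "M \<in> \<Union>K" by (rule UnionI)
    qed
  qed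
  have "istopology (\<lambda>U. \<exists>F\<subseteq>?P. U = D F)"
    unfolding istopology_def
  proof (intro conjI allI impI)
    fix S T assume "\<exists>F\<subseteq>?P. S = D F" "\<exists>F\<subseteq>?P. T = D F"
    then show "\<exists>F\<subseteq>?P. S \<inter> T = D F" by (elim exE conjE) (simp add: Int)
  next
    fix K assume "\<forall>S\<in>K. \<exists>F\<subseteq>?P. S = D F"
    then show "\<exists>F\<subseteq>?P. \<Union>K = D F" by (rule Un)
  qed
  then show ?thesis unfolding zariski_def D_def by simp
qed


section \<open>Generically tau-regular components\<close>

text \<open>
  In the following, \<open>X d\<close> is the module variety \<open>mod(C, d)\<close>, and \<open>L d M\<close> is the \<open>C\<close>-module given by
  a point \<open>M\<close> of \<open>X d\<close>.
\<close>

definition variety_components ::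
    "('v, 'a) pre_digraph \<Rightarrow> (('v \<Rightarrow> nat) \<Rightarrow> ('a \<Rightarrow> 'k::field mat) set) \<Rightarrow> ('v \<Rightarrow> nat)
      \<Rightarrow> ('a \<Rightarrow> 'k mat) set set" where
  "variety_components Q X d = irreducible_components (subtopology (zariski Q d) (X d))"

definition c_inv ::
    "('v, 'a) pre_digraph \<Rightarrow> (('v \<Rightarrow> nat) \<Rightarrow> ('a \<Rightarrow> 'k::field mat) set) \<Rightarrow> ('v \<Rightarrow> nat)
      \<Rightarrow> ('a \<Rightarrow> 'k mat) \<Rightarrow> int" where
  "c_inv Q X d M =
     int (krull_dim (subtopology (zariski Q d) (\<Union>{Z \<in> variety_components Q X d. M \<in> Z})))
     - int (krull_dim (subtopology (zariski Q d) (rep_orbit Q d M)))"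

text \<open>
  The union over all \<open>d\<close> has to be a disjoint one: a component is recorded together with its
  dimension vector, because the points of \<^const>\<open>rep\<close> do not determine \<open>d\<close> at vertices without arcs.
\<close>

definition Irr ::
    "('v, 'a) pre_digraph \<Rightarrow> (('v \<Rightarrow> nat) \<Rightarrow> ('a \<Rightarrow> 'k::field mat) set)
      \<Rightarrow> (('v \<Rightarrow> nat) \<times> ('a \<Rightarrow> 'k mat) set) set" where
  "Irr Q X = (SIGMA d:dim_vectors Q. variety_components Q X d)"

definition Irr_tau ::
    "('v, 'a) pre_digraph \<Rightarrow> ('k::field, 'c) module \<Rightarrow> (('v \<Rightarrow> nat) \<Rightarrow> ('a \<Rightarrow> 'k mat) set)
      \<Rightarrow> (('v \<Rightarrow> nat) \<Rightarrow> ('a \<Rightarrow> 'k mat) \<Rightarrow> ('c, 'x \<Rightarrow> 'k) lmod)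
      \<Rightarrow> (('v \<Rightarrow> nat) \<times> ('a \<Rightarrow> 'k mat) set) set" where
  "Irr_tau Q C X L = {(d, Z) \<in> Irr Q X. \<exists>U.
     openin (subtopology (zariski Q d) Z) U \<and>
     Abstract_Topology.closure_of (subtopology (zariski Q d) Z) U = Z \<and>
     (\<forall>M\<in>U. c_inv Q X d M = int (E_inv C (L d M)))}"

end

theory Submission
  imports Defs
begin

text \<open>
  Let \<open>N\<close> be a finite-dimensional \<open>A\<close>-module with \<open>eN = 0\<close>, that is, a \<open>B\<close>-module. The theorem rests on two
  facts. The first one is that \<open>E\<^sub>A(N) = E\<^sub>B(N)\<close> (\<open>E_inv_quot_module\<close>). The second one is that
  \<open>mod(B, d)\<close> is either empty or all of \<open>mod(A, d)\<close> (\<open>idempotent_annihilates_by_dimension\<close>). If it is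
  not empty, then the irreducible components, their dimensions and the orbits over \<open>A\<close> and over \<open>B\<close> are
  literally the same, so \<open>c\<^sub>A = c\<^sub>B\<close>. Hence a component that consists of \<open>B\<close>-modules has the same
  regular points over \<open>A\<close> and over \<open>B\<close>; no dimension is ever computed.

  For the first fact, let \<open>P1 \<rightarrow> P0 \<rightarrow> N\<close> be a minimal projective presentation over \<open>A\<close>. Dividing out
  \<open>AeP1\<close> and \<open>AeP0\<close> gives a projective presentation over \<open>B\<close>. It is minimal because \<open>e\<close> is idempotent:
  the kernel \<open>X\<close> of \<open>P0 \<rightarrow> N\<close> contains \<open>AeP0\<close>, and \<open>AeP0 = AeX\<close> is the image of \<open>AeP1\<close>, so nothing
  is divided out of \<open>X\<close> that is not divided out of \<open>P1\<close> (\<open>cover_descends\<close>). Every homomorphism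
  \<open>P1/AeP1 \<rightarrow> B\<close> lifts to \<open>P1 \<rightarrow> A\<close>, and those \<open>P1 \<rightarrow> A\<close> that become zero have values in \<open>AeA\<close> and are
  sums of homomorphisms \<open>g eb\<close> with \<open>g : P1 \<rightarrow> A\<close> and \<open>b\<close> in \<open>A\<close> (\<open>hom_into_genideal\<close>). Dually, the
  functionals on \<open>Hom(P1/AeP1, B)\<close> are the functionals on \<open>Hom(P1, A)\<close> that are annihilated by \<open>eA\<close>
  (\<open>pull_onto\<close>). So the translation of \<open>N\<close> over \<open>B\<close> is the largest submodule of the translation over
  \<open>A\<close> that \<open>e\<close> annihilates, and all homomorphisms from \<open>N\<close> have their image in it. This needs minimal
  presentations to exist over both algebras, which is proved for every finite-dimensional algebra
  (\<open>minimal_projective_presentation_exists\<close>).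

  For the second fact, a representative of \<open>e\<close> in the path algebra is a combination \<open>c\<close> of trivial paths
  plus an element \<open>r\<close> of the arrow ideal. As \<open>I\<close> is admissible, \<open>r\<close> acts nilpotently. If \<open>e\<close> kills a
  module, then \<open>r\<close> acts on its part at the vertex \<open>i\<close> as minus the coefficient of \<open>c\<close> at \<open>i\<close>, which is
  therefore zero if that part is not zero. If conversely these coefficients are zero, then the
  idempotent \<open>e\<close> acts as the nilpotent \<open>r\<close>, hence as zero.
\<close>

section \<open>Projections along subspaces and finite dimension\<close>

text \<open>
  Quotients of subspaces of a function space are realised inside of the same space, as images of
  a linear idempotent whose kernel is the subspace that is divided out.
\<close>

definition projection_along :: "('x \<Rightarrow> 'k::field) set \<Rightarrow> (('x \<Rightarrow> 'k) \<Rightarrow> 'x \<Rightarrow> 'k) \<Rightarrow> bool" where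
  "projection_along R \<rho> \<longleftrightarrow> (\<forall>v w. \<rho> (v + w) = \<rho> v + \<rho> w) \<and>
     (\<forall>k v. \<rho> (fun_scale k v) = fun_scale k (\<rho> v)) \<and> (\<forall>v. v - \<rho> v \<in> R) \<and> (\<forall>v\<in>R. \<rho> v = 0)"

lemma projection_along_exists:
  fixes R :: "('x \<Rightarrow> 'k::field) set"
  assumes "fun_vs.subspace R"
  shows "\<exists>\<rho>. projection_along R \<rho>"
proof -
  interpret vector_space_pair "fun_scale :: 'k \<Rightarrow> ('x \<Rightarrow> 'k) \<Rightarrow> _" "fun_scale :: 'k \<Rightarrow> ('x \<Rightarrow> 'k) \<Rightarrow> _"
    by unfold_locales
  from linear_exists_left_inverse_on[OF fun_vs.linear_id assms]
  obtain g where g: "range g \<subseteq> R" "Vector_Spaces.linear fun_scale fun_scale g" "\<forall>v\<in>R. g v = v"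
    by (auto simp: id_def)
  interpret g: Vector_Spaces.linear fun_scale fun_scale g by fact
  have "projection_along R (\<lambda>v. v - g v)"
    using g by (auto simp: projection_along_def g.add g.scale fun_vs.scale_right_diff_distrib)
  then show ?thesis by blast
qed

lemma projection_along_diff:
  assumes "projection_along R \<rho>"
  shows "\<rho> (v - w) = \<rho> v - \<rho> w"
proof -
  have "\<rho> (v - w + w) = \<rho> (v - w) + \<rho> w"
    using assms unfolding projection_along_def by blast
  then show ?thesis by simp
qed

lemma projection_along_eq_iff:
  assumes "projection_along R \<rho>" "fun_vs.subspace R"
  shows "\<rho> v = \<rho> w \<longleftrightarrow> v - w \<in> R"
proof
  assume eq: "\<rho> v = \<rho> w"
  have "v - w = (v - \<rho> v) - (w - \<rho> w)" by (simp add: eq)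
  then show "v - w \<in> R"
    using assms(1) by (metis projection_along_def fun_vs.subspace_diff[OF assms(2)])
next
  assume "v - w \<in> R"
  then have "\<rho> (v - w) = 0" using assms by (simp add: projection_along_def)
  then show "\<rho> v = \<rho> w" by (simp add: projection_along_diff[OF assms(1)])
qed

lemma projection_along_idem:
  assumes "projection_along R \<rho>"
  shows "\<rho> (\<rho> v) = \<rho> v"
proof -
  have "\<rho> (v - \<rho> v) = 0" using assms by (simp add: projection_along_def)
  then show ?thesis by (simp add: projection_along_diff[OF assms])
qed

lemma dim_strict_mono:
  assumes "fun_vs.subspace U" "U \<subset> V" "V \<subseteq> fun_vs.span S" "finite S"
  shows "fun_vs.dim U < fun_vs.dim V"
proof -
  obtain B where B: "B \<subseteq> U" "fun_vs.independent B" "U \<subseteq> fun_vs.span B" "card B = fun_vs.dim U"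
    by (rule fun_vs.basis_exists)
  obtain v where v: "v \<in> V" "v \<notin> U" using assms(2) by blast
  have "fun_vs.span B \<subseteq> U" using B(1) assms(1) by (simp add: fun_vs.span_minimal)
  with v have nv: "v \<notin> fun_vs.span B" by blast
  then have ind: "fun_vs.independent (insert v B)" using B(2) by (simp add: fun_vs.independent_insertI)
  moreover have "insert v B \<subseteq> V" using B(1) v assms(2) by blast
  ultimately obtain C where C: "insert v B \<subseteq> C" "C \<subseteq> V" "fun_vs.independent C" "V \<subseteq> fun_vs.span C"
    by (metis fun_vs.maximal_independent_subset_extend)
  have fC: "finite C"
    using fun_vs.independent_span_bound[OF assms(4) C(3)] C(2) assms(3) by blast
  have "v \<notin> B" using nv fun_vs.span_base by blast
  then have "card B < card (insert v B)" using fC C(1) by (metis card_insert_disjoint finite_insert finite_subset lessI)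
  also have "\<dots> \<le> card C" using fC C(1) by (rule card_mono)
  also have "\<dots> = fun_vs.dim V" using C by (simp add: fun_vs.basis_card_eq_dim)
  finally show ?thesis by (simp add: B(4))
qed

lemma finite_spanning_subset:
  assumes "V \<subseteq> fun_vs.span S" "finite S"
  shows "\<exists>T. finite T \<and> T \<subseteq> V \<and> V \<subseteq> fun_vs.span T"
proof -
  obtain B where B: "B \<subseteq> V" "fun_vs.independent B" "V \<subseteq> fun_vs.span B"
    by (rule fun_vs.basis_exists)
  then have "finite B"
    using fun_vs.independent_span_bound[OF assms(2), of B] assms(1) by blast
  with B show ?thesis by blast
qed


section \<open>Algebras over a field\<close>

locale k_algebra = ring C for C :: "('k::field, 'c) module" (structure) +
  assumes smult_closed [intro, simp]: "c \<in> carrier C \<Longrightarrow> k \<odot> c \<in> carrier C"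
    and smult_l_distr: "c \<in> carrier C \<Longrightarrow> (k + l) \<odot> c = k \<odot> c \<oplus> l \<odot> c"
    and smult_r_distr: "b \<in> carrier C \<Longrightarrow> c \<in> carrier C \<Longrightarrow> k \<odot> (b \<oplus> c) = k \<odot> b \<oplus> k \<odot> c"
    and smult_assoc: "c \<in> carrier C \<Longrightarrow> (k * l) \<odot> c = k \<odot> (l \<odot> c)"
    and smult_one [simp]: "c \<in> carrier C \<Longrightarrow> 1 \<odot> c = c"
    and smult_mult_l: "b \<in> carrier C \<Longrightarrow> c \<in> carrier C \<Longrightarrow> (k \<odot> b) \<otimes> c = k \<odot> (b \<otimes> c)"
    and smult_mult_r: "b \<in> carrier C \<Longrightarrow> c \<in> carrier C \<Longrightarrow> b \<otimes> (k \<odot> c) = k \<odot> (b \<otimes> c)"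
begin

lemma smult_eq_mult: "c \<in> carrier C \<Longrightarrow> k \<odot> c = (k \<odot> \<one>) \<otimes> c"
  by (simp add: smult_mult_l)

lemma smult_zero_scalar [simp]: "c \<in> carrier C \<Longrightarrow> 0 \<odot> c = \<zero>"
  using smult_l_distr[of c 0 0] by (metis add.r_cancel_one' add_0 smult_closed)

lemma smult_zero_vector [simp]: "k \<odot> \<zero> = \<zero>"
  using smult_eq_mult[of \<zero> k] by simp

lemma smult_minus_one: "c \<in> carrier C \<Longrightarrow> (- 1) \<odot> c = \<ominus> c"
  using smult_l_distr[of c "-1" 1] by (simp add: minus_equality)

lemma ideal_smult_closed: "ideal J C \<Longrightarrow> c \<in> J \<Longrightarrow> k \<odot> c \<in> J"
  by (metis ideal.I_l_closed ideal.Icarr one_closed smult_closed smult_eq_mult)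

lemma genideal_induct [consumes 2, case_names gen add left right]:
  assumes "x \<in> Idl {e}" "e \<in> carrier C"
    and gen: "P e"
    and add: "\<And>x y. x \<in> carrier C \<Longrightarrow> y \<in> carrier C \<Longrightarrow> P x \<Longrightarrow> P y \<Longrightarrow> P (x \<oplus> y)"
    and left: "\<And>a x. a \<in> carrier C \<Longrightarrow> x \<in> carrier C \<Longrightarrow> P x \<Longrightarrow> P (a \<otimes> x)"
    and right: "\<And>a x. a \<in> carrier C \<Longrightarrow> x \<in> carrier C \<Longrightarrow> P x \<Longrightarrow> P (x \<otimes> a)"
  shows "P x"
proof -
  let ?I = "{x \<in> carrier C. P x}"
  have zero: "P \<zero>" using left[OF zero_closed assms(2) gen] assms(2) by simp
  have inv: "P (\<ominus> x)" if "x \<in> carrier C" "P x" for x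
    using left[of "\<ominus> \<one>" x] that by (simp add: l_minus)
  have "subgroup ?I (add_monoid C)"
    by (rule add.subgroupI) (use zero add inv in \<open>auto simp flip: a_inv_def\<close>)
  then have "ideal ?I C"
    by (intro idealI ring_axioms) (use left right in auto)
  then have "Idl {e} \<subseteq> ?I"
    using assms(2) gen by (intro genideal_minimal) auto
  then show ?thesis using assms(1) by auto
qed

end


section \<open>Finite-dimensional modules and their homomorphisms\<close>

lemma fd_moduleD:
  assumes "fd_module C N"
  shows fdm_subspace: "fun_vs.subspace (underlying N)"
    and fdm_span: "\<exists>S. finite S \<and> underlying N \<subseteq> fun_vs.span S"
    and fdm_closed: "\<And>c v. c \<in> carrier C \<Longrightarrow> v \<in> underlying N \<Longrightarrow> action N c v \<in> underlying N"
    and fdm_add: "\<And>c v w. c \<in> carrier C \<Longrightarrow> v \<in> underlying N \<Longrightarrow> w \<in> underlying N \<Longrightarrow>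
      action N c (v + w) = action N c v + action N c w"
    and fdm_scale: "\<And>c k v. c \<in> carrier C \<Longrightarrow> v \<in> underlying N \<Longrightarrow>
      action N c (fun_scale k v) = fun_scale k (action N c v)"
    and fdm_add_left: "\<And>b c v. b \<in> carrier C \<Longrightarrow> c \<in> carrier C \<Longrightarrow> v \<in> underlying N \<Longrightarrow>
      action N (b \<oplus>\<^bsub>C\<^esub> c) v = action N b v + action N c v"
    and fdm_smult: "\<And>c k v. c \<in> carrier C \<Longrightarrow> v \<in> underlying N \<Longrightarrow>
      action N (k \<odot>\<^bsub>C\<^esub> c) v = fun_scale k (action N c v)"
    and fdm_mult: "\<And>b c v. b \<in> carrier C \<Longrightarrow> c \<in> carrier C \<Longrightarrow> v \<in> underlying N \<Longrightarrow>
      action N (b \<otimes>\<^bsub>C\<^esub> c) v = action N b (action N c v)"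
    and fdm_one: "\<And>v. v \<in> underlying N \<Longrightarrow> action N \<one>\<^bsub>C\<^esub> v = v"
  using assms unfolding fd_module_def by blast+

lemma fdm_0: "fd_module C N \<Longrightarrow> 0 \<in> underlying N"
  using fdm_subspace fun_vs.subspace_0 by blast

lemma fdm_plus: "fd_module C N \<Longrightarrow> v \<in> underlying N \<Longrightarrow> w \<in> underlying N \<Longrightarrow> v + w \<in> underlying N"
  using fdm_subspace fun_vs.subspace_add by blast

lemma fdm_minus: "fd_module C N \<Longrightarrow> v \<in> underlying N \<Longrightarrow> w \<in> underlying N \<Longrightarrow> v - w \<in> underlying N"
  using fdm_subspace fun_vs.subspace_diff by blast

lemma fdm_fun_scale: "fd_module C N \<Longrightarrow> v \<in> underlying N \<Longrightarrow> fun_scale k v \<in> underlying N"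
  using fdm_subspace fun_vs.subspace_scale by blast

lemma fdm_sum: "fd_module C N \<Longrightarrow> (\<And>i. i \<in> S \<Longrightarrow> f i \<in> underlying N) \<Longrightarrow> sum f S \<in> underlying N"
  using fdm_subspace fun_vs.subspace_sum by blast

lemma fdm_act_0:
  assumes "fd_module C N" "c \<in> carrier C"
  shows "action N c 0 = 0"
  using fdm_scale[OF assms(1,2) fdm_0[OF assms(1)], of 0] by simp

lemma fdm_act_diff:
  assumes N: "fd_module C N" "c \<in> carrier C" "v \<in> underlying N" "w \<in> underlying N"
  shows "action N c (v - w) = action N c v - action N c w"
proof -
  have "action N c (v - w + w) = action N c (v - w) + action N c w"
    using N by (intro fdm_add[OF N(1)]) (auto intro: fdm_minus)
  then show ?thesis by simp
qed

lemma fdm_act_sum: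
  assumes N: "fd_module C N" "c \<in> carrier C" and "\<And>i. i \<in> S \<Longrightarrow> f i \<in> underlying N"
  shows "action N c (sum f S) = (\<Sum>i\<in>S. action N c (f i))"
  using assms(3)
proof (induction S rule: infinite_finite_induct)
  case (insert x F)
  then have "action N c (f x + sum f F) = action N c (f x) + action N c (sum f F)"
    using N by (intro fdm_add[OF N]) (auto intro: fdm_sum)
  with insert show ?case by (metis sum.insert insertCI)
qed (use N in \<open>simp_all add: fdm_act_0\<close>)

lemma module_homD:
  assumes "h \<in> module_hom C M N"
  shows mh_closed: "\<And>v. v \<in> underlying M \<Longrightarrow> h v \<in> underlying N"
    and mh_outside: "\<And>v. v \<notin> underlying M \<Longrightarrow> h v = 0"
    and mh_add: "\<And>v w. v \<in> underlying M \<Longrightarrow> w \<in> underlying M \<Longrightarrow> h (v + w) = h v + h w"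
    and mh_scale: "\<And>k v. v \<in> underlying M \<Longrightarrow> h (fun_scale k v) = fun_scale k (h v)"
    and mh_act: "\<And>c v. c \<in> carrier C \<Longrightarrow> v \<in> underlying M \<Longrightarrow> h (action M c v) = action N c (h v)"
  using assms unfolding module_hom_def by blast+

lemma mh_0: "fd_module C M \<Longrightarrow> h \<in> module_hom C M N \<Longrightarrow> h 0 = 0"
  using mh_scale[of h C M N 0 0] fdm_0[of C M] by simp

lemma mh_diff:
  assumes M: "fd_module C M" "h \<in> module_hom C M N" "v \<in> underlying M" "w \<in> underlying M"
  shows "h (v - w) = h v - h w"
proof -
  have "h (v - w + w) = h (v - w) + h w"
    using M by (intro mh_add[OF M(2)]) (auto intro: fdm_minus)
  then show ?thesis by simp
qed

lemma mh_sum: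
  assumes M: "fd_module C M" "h \<in> module_hom C M N" and "\<And>i. i \<in> S \<Longrightarrow> f i \<in> underlying M"
  shows "h (sum f S) = (\<Sum>i\<in>S. h (f i))"
  using assms(3)
proof (induction S rule: infinite_finite_induct)
  case (insert x F)
  then have "h (f x + sum f F) = h (f x) + h (sum f F)"
    using M by (intro mh_add[OF M(2)]) (auto intro: fdm_sum)
  with insert show ?case by (metis sum.insert insertCI)
qed (metis M mh_0 sum.infinite, metis M mh_0 sum.empty)

text \<open>Homomorphisms vanish outside of their domain, so a formula has to be cut off there.\<close>

definition cut_off :: "'v set \<Rightarrow> ('v \<Rightarrow> 'w::zero) \<Rightarrow> 'v \<Rightarrow> 'w" where
  "cut_off U f = (\<lambda>v. if v \<in> U then f v else 0)"

lemma cut_off_in [simp]: "v \<in> U \<Longrightarrow> cut_off U f v = f v"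
  by (simp add: cut_off_def)

lemma cut_off_module_hom:
  assumes M: "fd_module C M"
    and "\<And>v. v \<in> underlying M \<Longrightarrow> f v \<in> underlying N"
    and "\<And>v w. v \<in> underlying M \<Longrightarrow> w \<in> underlying M \<Longrightarrow> f (v + w) = f v + f w"
    and "\<And>k v. v \<in> underlying M \<Longrightarrow> f (fun_scale k v) = fun_scale k (f v)"
    and "\<And>c v. c \<in> carrier C \<Longrightarrow> v \<in> underlying M \<Longrightarrow> f (action M c v) = action N c (f v)"
  shows "cut_off (underlying M) f \<in> module_hom C M N"
  using assms fdm_plus[OF M] fdm_fun_scale[OF M] fdm_closed[OF M]
  by (auto simp: module_hom_def cut_off_def)

lemma submodule_fd_module:
  assumes "fd_module C N" "submodule_of C U N"
  shows "fd_module C (N\<lparr>underlying := U\<rparr>)"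
proof -
  have U: "U \<subseteq> underlying N" "fun_vs.subspace U" "\<And>c u. c \<in> carrier C \<Longrightarrow> u \<in> U \<Longrightarrow> action N c u \<in> U"
    using assms(2) by (auto simp: submodule_of_def)
  moreover obtain S where "finite S" "underlying N \<subseteq> fun_vs.span S" using fdm_span[OF assms(1)] by blast
  ultimately have "\<exists>S. finite S \<and> U \<subseteq> fun_vs.span S" by blast
  with U show ?thesis
    using fdm_add[OF assms(1)] fdm_scale[OF assms(1)] fdm_add_left[OF assms(1)] fdm_smult[OF assms(1)]
      fdm_mult[OF assms(1)] fdm_one[OF assms(1)]
    unfolding fd_module_def by (auto simp: subset_iff)
qed

lemma submodule_hom_kernel:
  assumes "fd_module C M" "fd_module C N" "h \<in> module_hom C M N"
  shows "submodule_of C (hom_kernel M h) M"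
  unfolding submodule_of_def hom_kernel_def fun_vs.subspace_def
  using assms by (auto simp: fdm_0 mh_0 mh_add mh_scale mh_act fdm_plus fdm_fun_scale fdm_closed fdm_act_0)

lemma submodule_image:
  assumes "fd_module C M" "fd_module C N" "h \<in> module_hom C M N" "submodule_of C U M"
  shows "submodule_of C (h ` U) N"
proof -
  have U: "U \<subseteq> underlying M" "fun_vs.subspace U" "\<And>c u. c \<in> carrier C \<Longrightarrow> u \<in> U \<Longrightarrow> action M c u \<in> U"
    using assms(4) by (auto simp: submodule_of_def)
  show ?thesis
    unfolding submodule_of_def fun_vs.subspace_def
  proof (intro conjI ballI allI)
    show "0 \<in> h ` U" using mh_0[OF assms(1,3)] fun_vs.subspace_0[OF U(2)] by (metis imageI)
    show "x + y \<in> h ` U" if "x \<in> h ` U" "y \<in> h ` U" for x y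
      using that U(1) fun_vs.subspace_add[OF U(2)] by (auto simp: subset_iff simp flip: mh_add[OF assms(3)])
    show "fun_scale c x \<in> h ` U" if "x \<in> h ` U" for x c
      using that U(1) fun_vs.subspace_scale[OF U(2)] by (auto simp: subset_iff simp flip: mh_scale[OF assms(3)])
    show "h ` U \<subseteq> underlying N" using U(1) mh_closed[OF assms(3)] by blast
    show "action N c u \<in> h ` U" if "c \<in> carrier C" "u \<in> h ` U" for c u
      using that U by (auto simp: subset_iff simp flip: mh_act[OF assms(3)])
  qed
qed

lemma submodule_all: "fd_module C N \<Longrightarrow> submodule_of C (underlying N) N"
  by (auto simp: submodule_of_def fdm_subspace fdm_closed)

lemma submodule_subspace: "submodule_of C U N \<Longrightarrow> fun_vs.subspace U"
  by (simp add: submodule_of_def)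

definition quot_by ::
    "(('x \<Rightarrow> 'k) \<Rightarrow> 'x \<Rightarrow> 'k) \<Rightarrow> ('c, 'x \<Rightarrow> 'k) lmod \<Rightarrow> ('c, 'x \<Rightarrow> 'k) lmod" where
  "quot_by \<rho> N = \<lparr>underlying = \<rho> ` underlying N, action = (\<lambda>c v. \<rho> (action N c v))\<rparr>"

context
  fixes C :: "('k::field, 'c) module" and N :: "('c, 'x \<Rightarrow> 'k) lmod" and R \<rho>
  assumes C: "k_algebra C" and N: "fd_module C N" and R: "submodule_of C R N" and \<rho>: "projection_along R \<rho>"
begin

lemma quot_by_mem: "v \<in> underlying N \<Longrightarrow> \<rho> v \<in> underlying N"
proof -
  assume v: "v \<in> underlying N"
  have "v - \<rho> v \<in> underlying N"
    using \<rho> R unfolding projection_along_def submodule_of_def by blast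
  from fdm_minus[OF N v this] show ?thesis by simp
qed

lemma quot_by_action:
  assumes "c \<in> carrier C" "v \<in> underlying N"
  shows "action (quot_by \<rho> N) c (\<rho> v) = \<rho> (action N c v)"
proof -
  have "action N c (v - \<rho> v) \<in> R"
    using \<rho> R assms unfolding projection_along_def submodule_of_def by blast
  then have "\<rho> (action N c v - action N c (\<rho> v)) = 0"
    using \<rho> assms quot_by_mem by (simp add: fdm_act_diff[OF N] projection_along_def)
  then show ?thesis
    by (simp add: projection_along_diff[OF \<rho>] quot_by_def)
qed

lemma quot_by_underlying: "underlying (quot_by \<rho> N) = \<rho> ` underlying N"
  by (simp add: quot_by_def)

lemma fd_module_quot_by: "fd_module C (quot_by \<rho> N)"
proof -
  interpret k_algebra C by (rule C)
  have \<rho>a: "\<rho> (v + w) = \<rho> v + \<rho> w" and \<rho>s: "\<rho> (fun_scale k v) = fun_scale k (\<rho> v)" for v w k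
    using \<rho> by (auto simp: projection_along_def)
  have \<rho>0: "\<rho> 0 = 0" using \<rho>s[of 0 0] by simp
  obtain S where "finite S" "underlying N \<subseteq> fun_vs.span S" using fdm_span[OF N] by blast
  then have "finite S \<and> \<rho> ` underlying N \<subseteq> fun_vs.span S" using quot_by_mem by blast
  then have fin: "\<exists>S. finite S \<and> \<rho> ` underlying N \<subseteq> fun_vs.span S" by blast
  have sub: "fun_vs.subspace (\<rho> ` underlying N)"
    unfolding fun_vs.subspace_def
    using imageI[OF fdm_0[OF N], of \<rho>] fdm_plus[OF N] fdm_fun_scale[OF N]
    by (auto simp: \<rho>0 simp flip: \<rho>a \<rho>s)
  show ?thesis
    unfolding fd_module_def quot_by_underlying
  proof (intro conjI ballI allI sub fin; (elim imageE)?; (simp only:)?)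
  qed (use N in \<open>simp_all add: quot_by_action fdm_closed fdm_plus fdm_fun_scale fdm_add fdm_scale
      fdm_add_left fdm_smult fdm_mult fdm_one flip: \<rho>a \<rho>s\<close>)
qed

end

lemma quot_by_surj:
  assumes "k_algebra C" "fd_module C N" "submodule_of C R N" "projection_along R \<rho>"
  shows "cut_off (underlying N) \<rho> \<in> module_hom C N (quot_by \<rho> N)"
    and "cut_off (underlying N) \<rho> ` underlying N = underlying (quot_by \<rho> N)"
proof -
  show "cut_off (underlying N) \<rho> \<in> module_hom C N (quot_by \<rho> N)"
    using assms(4)
    by (intro cut_off_module_hom[OF assms(2)])
      (auto simp: projection_along_def quot_by_underlying[OF assms] quot_by_action[OF assms])
  show "cut_off (underlying N) \<rho> ` underlying N = underlying (quot_by \<rho> N)"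
    by (auto simp: quot_by_underlying[OF assms])
qed


section \<open>Lifting along surjections out of projective modules\<close>

lemma projectiveD: "projective C P \<Longrightarrow> fd_module C P"
  by (simp add: projective_def)

text \<open>
  The form in which projectivity is used throughout: a map to \<open>X\<close> that is a homomorphism modulo a
  submodule \<open>R\<close> can be corrected by elements of \<open>R\<close> to a homomorphism. In this way, no module
  isomorphic to \<open>X/R\<close> has to be exhibited when a lift is wanted.
\<close>

lemma projective_lift_modulo:
  fixes F :: "(nat \<Rightarrow> 'k::field) \<Rightarrow> nat \<Rightarrow> 'k"
  assumes C: "k_algebra C" and P: "projective C P" and X: "fd_module C X" and R: "submodule_of C R X"
    and F: "\<And>v. v \<in> underlying P \<Longrightarrow> F v \<in> underlying X"
    and Fa: "\<And>v w. v \<in> underlying P \<Longrightarrow> w \<in> underlying P \<Longrightarrow> F (v + w) - (F v + F w) \<in> R"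
    and Fs: "\<And>k v. v \<in> underlying P \<Longrightarrow> F (fun_scale k v) - fun_scale k (F v) \<in> R"
    and Fc: "\<And>c v. c \<in> carrier C \<Longrightarrow> v \<in> underlying P \<Longrightarrow> F (action P c v) - action X c (F v) \<in> R"
  shows "\<exists>h\<in>module_hom C P X. \<forall>v\<in>underlying P. h v - F v \<in> R"
proof -
  obtain \<rho> where \<rho>: "projection_along R \<rho>"
    using projection_along_exists submodule_subspace[OF R] by blast
  note Q = C X R \<rho>
  note eq = projection_along_eq_iff[OF \<rho> submodule_subspace[OF R]]
  have \<rho>a: "\<rho> (v + w) = \<rho> v + \<rho> w" and \<rho>s: "\<rho> (fun_scale k v) = fun_scale k (\<rho> v)" for v w k
    using \<rho> by (auto simp: projection_along_def)
  let ?f = "cut_off (underlying P) (\<lambda>v. \<rho> (F v))"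
  have "?f \<in> module_hom C P (quot_by \<rho> X)"
    using F Fa Fs Fc
    by (intro cut_off_module_hom projectiveD[OF P])
      (auto simp: quot_by_underlying[OF Q] quot_by_action[OF Q] eq simp flip: \<rho>a \<rho>s)
  then obtain h where h: "h \<in> module_hom C P X"
      "\<forall>v\<in>underlying P. cut_off (underlying X) \<rho> (h v) = ?f v"
    using P X fd_module_quot_by[OF Q] quot_by_surj[OF Q] unfolding projective_def by blast
  then have "\<forall>v\<in>underlying P. h v - F v \<in> R"
    by (simp add: mh_closed flip: eq)
  with h(1) show ?thesis by blast
qed

lemma projective_lift:
  fixes X :: "('c, nat \<Rightarrow> 'k::field) lmod" and Y :: "('c, 'y \<Rightarrow> 'k) lmod"
  assumes C: "k_algebra C" and P: "projective C P" and X: "fd_module C X" and Y: "fd_module C Y"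
    and g: "g \<in> module_hom C X Y" and f: "f \<in> module_hom C P Y"
    and im: "f ` underlying P \<subseteq> g ` underlying X"
  shows "\<exists>h\<in>module_hom C P X. \<forall>v\<in>underlying P. g (h v) = f v"
proof -
  have P': "fd_module C P" using P by (rule projectiveD)
  define F where "F v = (SOME x. x \<in> underlying X \<and> g x = f v)" for v
  have F: "F v \<in> underlying X \<and> g (F v) = f v" if "v \<in> underlying P" for v
  proof -
    have "\<exists>x. x \<in> underlying X \<and> g x = f v" using im that by force
    then show ?thesis unfolding F_def by (rule someI_ex)
  qed
  have "\<exists>h\<in>module_hom C P X. \<forall>v\<in>underlying P. h v - F v \<in> hom_kernel X g"
    using F g f
    by (intro projective_lift_modulo C P X submodule_hom_kernel[OF X Y g])
      (auto simp: hom_kernel_def fdm_minus[OF X] fdm_plus[OF X] fdm_plus[OF P'] fdm_fun_scale[OF X]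
        fdm_fun_scale[OF P'] fdm_closed[OF X] fdm_closed[OF P'] mh_diff[OF X g] mh_add mh_scale mh_act)
  then obtain h where h: "h \<in> module_hom C P X" "\<forall>v\<in>underlying P. h v - F v \<in> hom_kernel X g"
    by blast
  have "g (h v) = f v" if v: "v \<in> underlying P" for v
    using h(2) v F[OF v] mh_diff[OF X g mh_closed[OF h(1) v], of "F v"] by (simp add: hom_kernel_def)
  with h(1) show ?thesis by blast
qed

lemma projective_retract:
  fixes C :: "('k::field, 'c) module"
  assumes C: "k_algebra C" and P: "projective C P" and V: "fd_module C V"
    and q: "q \<in> module_hom C P V" and i: "i \<in> module_hom C V P"
    and qi: "\<And>v. v \<in> underlying V \<Longrightarrow> q (i v) = v"
  shows "projective C V"
  unfolding projective_def
proof (intro conjI V allI impI; elim conjE)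
  fix X Y :: "('c, nat \<Rightarrow> 'k) lmod" and g f
  assume X: "fd_module C X" and Y: "fd_module C Y" and g: "g \<in> module_hom C X Y"
    and onto: "g ` underlying X = underlying Y" and f: "f \<in> module_hom C V Y"
  have P': "fd_module C P" using P by (rule projectiveD)
  have "cut_off (underlying P) (\<lambda>v. f (q v)) \<in> module_hom C P Y"
    using q f by (intro cut_off_module_hom P')
      (auto simp: mh_closed mh_add[OF q] mh_add[OF f] mh_scale mh_act)
  then obtain h where h: "h \<in> module_hom C P X"
      "\<forall>v\<in>underlying P. g (h v) = cut_off (underlying P) (\<lambda>v. f (q v)) v"
    using P X Y g onto unfolding projective_def by blast
  have "cut_off (underlying V) (\<lambda>v. h (i v)) \<in> module_hom C V X"
    using h(1) i by (intro cut_off_module_hom V)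
      (auto simp: mh_closed mh_add[OF h(1)] mh_add[OF i] mh_scale mh_act)
  moreover have "\<forall>v\<in>underlying V. g (cut_off (underlying V) (\<lambda>v. h (i v)) v) = f v"
    using h(2) i qi by (simp add: mh_closed)
  ultimately show "\<exists>h\<in>module_hom C V X. \<forall>v\<in>underlying V. g (h v) = f v" by blast
qed

section \<open>Finite-dimensional algebras and free modules\<close>

lemma sum_fun_apply: "(\<Sum>i\<in>A. f i) x = (\<Sum>i\<in>A. f i x)"
  by (induction A rule: infinite_finite_induct) simp_all

text \<open>
  The map \<open>\<iota>\<close> is an embedding of the algebra into a function space. It is what makes the algebra
  finite-dimensional, and it places the free modules inside of \<open>nat \<Rightarrow> 'k\<close>.
\<close>

locale fd_algebra = k_algebra C for C :: "('k::field, 'c) module" (structure) +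
  fixes \<iota> :: "'c \<Rightarrow> nat \<Rightarrow> 'k"
  assumes \<iota>_add: "b \<in> carrier C \<Longrightarrow> c \<in> carrier C \<Longrightarrow> \<iota> (b \<oplus> c) = \<iota> b + \<iota> c"
    and \<iota>_smult: "c \<in> carrier C \<Longrightarrow> \<iota> (k \<odot> c) = fun_scale k (\<iota> c)"
    and \<iota>_inj: "inj_on \<iota> (carrier C)"
    and \<iota>_span: "\<exists>S. finite S \<and> \<iota> ` carrier C \<subseteq> fun_vs.span S"
begin

lemma \<iota>_zero: "\<iota> \<zero> = 0"
  using \<iota>_smult[of \<zero> 0] by simp

lemma subspace_\<iota>:
  assumes "H \<subseteq> carrier C" "\<zero> \<in> H" "\<And>x y. x \<in> H \<Longrightarrow> y \<in> H \<Longrightarrow> x \<oplus> y \<in> H" "\<And>k x. x \<in> H \<Longrightarrow> k \<odot> x \<in> H"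
  shows "fun_vs.subspace (\<iota> ` H)"
  unfolding fun_vs.subspace_def
proof (intro conjI ballI allI)
  show "0 \<in> \<iota> ` H" using assms(2) \<iota>_zero by (metis imageI)
  show "x + y \<in> \<iota> ` H" if "x \<in> \<iota> ` H" "y \<in> \<iota> ` H" for x y
    using that assms by (auto simp: subset_iff simp flip: \<iota>_add)
  show "fun_scale k x \<in> \<iota> ` H" if "x \<in> \<iota> ` H" for k x
    using that assms by (auto simp: subset_iff simp flip: \<iota>_smult)
qed

text \<open>
  Linear generation is expressed by closed subsets, so that no linear combinations in \<open>C\<close> are needed.
  The finitely many generators are \<open>b i\<close> for \<open>i < m\<close>.
\<close>

lemma finite_linear_generators:
  "\<exists>(m :: nat) b. (\<forall>i. b i \<in> carrier C) \<and> (\<forall>H. H \<subseteq> carrier C \<and> \<zero> \<in> H \<and> (\<forall>x\<in>H. \<forall>y\<in>H. x \<oplus> y \<in> H) \<and>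
     (\<forall>k. \<forall>x\<in>H. k \<odot> x \<in> H) \<and> (\<forall>i<m. b i \<in> H) \<longrightarrow> H = carrier C)"
proof -
  obtain S where "finite S" "\<iota> ` carrier C \<subseteq> fun_vs.span S" using \<iota>_span by blast
  from finite_spanning_subset[OF this(2,1)]
  obtain T where T: "finite T" "T \<subseteq> \<iota> ` carrier C" "\<iota> ` carrier C \<subseteq> fun_vs.span T" by blast
  from finite_subset_image[OF T(1,2)]
  obtain B where B: "B \<subseteq> carrier C" "finite B" "T = \<iota> ` B" by blast
  obtain b where b: "bij_betw b {..<card B} B"
    using ex_bij_betw_nat_finite[OF B(2)] by (auto simp: atLeast0LessThan)
  let ?b = "\<lambda>i. if i < card B then b i else \<zero>"
  have bB: "b i \<in> B" if "i < card B" for i using b that by (auto simp: bij_betw_def)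
  have gen: "H = carrier C" if H: "H \<subseteq> carrier C" "\<zero> \<in> H" "\<forall>x\<in>H. \<forall>y\<in>H. x \<oplus> y \<in> H"
      "\<forall>k. \<forall>x\<in>H. k \<odot> x \<in> H" "\<forall>i<card B. ?b i \<in> H" for H
  proof -
    have "B \<subseteq> H"
    proof
      fix x assume "x \<in> B"
      then obtain i where "i < card B" "x = b i" using b by (auto simp: bij_betw_def)
      with H(5) show "x \<in> H" by auto
    qed
    then have "fun_vs.span T \<subseteq> \<iota> ` H"
      unfolding B(3) using H by (intro fun_vs.span_minimal subspace_\<iota>) auto
    with T(3) have sub: "\<iota> ` carrier C \<subseteq> \<iota> ` H" by blast
    have "carrier C \<subseteq> H"
    proof
      fix x assume x: "x \<in> carrier C"
      then obtain y where "y \<in> H" "\<iota> x = \<iota> y" using sub by blast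
      with x H(1) \<iota>_inj show "x \<in> H" by (metis inj_onD subsetD)
    qed
    with H(1) show ?thesis by blast
  qed
  have "?b i \<in> carrier C" for i using bB B(1) by auto
  show ?thesis
    by (intro exI[of _ "card B"] exI[of _ ?b] conjI allI impI) (fact, elim conjE, rule gen)
qed

text \<open>
  Elements of the free module of rank \<open>m\<close> are families of ring elements that vanish from the index
  \<open>m\<close> on; a family becomes a single function on \<^typ>\<open>nat\<close> by pairing its index with the index of
  the coordinates.
\<close>

definition tuple :: "(nat \<Rightarrow> 'c) \<Rightarrow> nat \<Rightarrow> 'k" where
  "tuple c = (\<lambda>n. case prod_decode n of (i, r) \<Rightarrow> \<iota> (c i) r)"

definition coord :: "nat \<Rightarrow> (nat \<Rightarrow> 'k) \<Rightarrow> 'c" where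
  "coord i v = the_inv_into (carrier C) \<iota> (\<lambda>r. v (prod_encode (i, r)))"

definition families :: "nat \<Rightarrow> (nat \<Rightarrow> 'c) set" where
  "families m = {c. (\<forall>i. c i \<in> carrier C) \<and> (\<forall>i\<ge>m. c i = \<zero>)}"

definition free :: "nat \<Rightarrow> ('c, nat \<Rightarrow> 'k) lmod" where
  "free m = \<lparr>underlying = tuple ` families m, action = (\<lambda>a v. tuple (\<lambda>i. a \<otimes> coord i v))\<rparr>"

lemma coord_tuple: "c i \<in> carrier C \<Longrightarrow> coord i (tuple c) = c i"
  using the_inv_into_f_f[OF \<iota>_inj] by (simp add: coord_def tuple_def)

lemma tuple_add:
  "(\<And>i. c i \<in> carrier C) \<Longrightarrow> (\<And>i. d i \<in> carrier C) \<Longrightarrow> tuple c + tuple d = tuple (\<lambda>i. c i \<oplus> d i)"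
  by (rule ext) (simp add: tuple_def \<iota>_add split: prod.split)

lemma tuple_smult:
  "(\<And>i. c i \<in> carrier C) \<Longrightarrow> fun_scale k (tuple c) = tuple (\<lambda>i. k \<odot> c i)"
  by (rule ext) (simp add: tuple_def \<iota>_smult fun_scale_def split: prod.split)

lemma tuple_zero: "tuple (\<lambda>i. \<zero>) = 0"
  by (rule ext) (simp add: tuple_def \<iota>_zero split: prod.split)

lemma free_action:
  "(\<And>i. c i \<in> carrier C) \<Longrightarrow> action (free m) a (tuple c) = tuple (\<lambda>i. a \<otimes> c i)"
  by (simp add: free_def coord_tuple)

lemma freeD:
  "v \<in> underlying (free m) \<Longrightarrow> \<exists>c. v = tuple c \<and> (\<forall>i. c i \<in> carrier C) \<and> (\<forall>i\<ge>m. c i = \<zero>)"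
  by (auto simp: free_def families_def)

lemma freeI:
  "(\<And>i. c i \<in> carrier C) \<Longrightarrow> (\<And>i. m \<le> i \<Longrightarrow> c i = \<zero>) \<Longrightarrow> tuple c \<in> underlying (free m)"
  by (auto simp: free_def families_def)

lemma free_span: "\<exists>S. finite S \<and> underlying (free m) \<subseteq> fun_vs.span S"
proof -
  obtain S where S: "finite S" "\<iota> ` carrier C \<subseteq> fun_vs.span S" using \<iota>_span by blast
  define E where "E i w = (\<lambda>n. case prod_decode n of (j, r) \<Rightarrow> if j = i then w r else 0)"
    for i :: nat and w :: "nat \<Rightarrow> 'k"
  have lin: "Vector_Spaces.linear fun_scale fun_scale (E i)" for i
    by unfold_locales (auto simp: E_def fun_scale_def fun_eq_iff algebra_simps split: prod.split)
  have E: "E i w \<in> fun_vs.span (E i ` S)" if "w \<in> fun_vs.span S" for i w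
  proof -
    interpret Vector_Spaces.linear fun_scale fun_scale "E i" by (rule lin)
    show ?thesis using that by (simp add: span_image)
  qed
  have "v \<in> fun_vs.span (\<Union>i<m. E i ` S)" if v: "v \<in> underlying (free m)" for v
  proof -
    obtain c where c: "v = tuple c" "\<And>i. c i \<in> carrier C" "\<And>i. m \<le> i \<Longrightarrow> c i = \<zero>"
      using freeD[OF v] by blast
    have "v = (\<Sum>i<m. E i (\<iota> (c i)))"
    proof
      fix n
      obtain j r where jr: "prod_decode n = (j, r)" by fastforce
      have "(\<Sum>i<m. E i (\<iota> (c i))) n = (\<Sum>i<m. if j = i then \<iota> (c i) r else 0)"
        by (simp add: sum_fun_apply E_def jr)
      also have "\<dots> = v n"
        using c(3)[of j] by (cases "j < m") (simp_all add: c(1) tuple_def jr \<iota>_zero)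
      finally show "v n = (\<Sum>i<m. E i (\<iota> (c i))) n" ..
    qed
    moreover have "E i (\<iota> (c i)) \<in> fun_vs.span (\<Union>i<m. E i ` S)" if "i < m" for i
      using E[of "\<iota> (c i)" i] S(2) c(2) fun_vs.span_mono[of "E i ` S" "\<Union>i<m. E i ` S"] that by blast
    ultimately show ?thesis by (auto intro!: fun_vs.span_sum)
  qed
  then show ?thesis using S(1) by (intro exI[of _ "\<Union>i<m. E i ` S"]) auto
qed

lemma fd_module_free: "fd_module C (free m)"
  unfolding fd_module_def
proof (intro conjI ballI allI free_span)
  show "fun_vs.subspace (underlying (free m))"
    unfolding fun_vs.subspace_def
  proof (intro conjI ballI allI)
    show "0 \<in> underlying (free m)" using freeI[of "\<lambda>i. \<zero>" m] by (simp add: tuple_zero)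
    show "v + w \<in> underlying (free m)" if "v \<in> underlying (free m)" "w \<in> underlying (free m)" for v w
      using freeD[OF that(1)] freeD[OF that(2)] by (auto simp: tuple_add intro!: freeI)
    show "fun_scale k v \<in> underlying (free m)" if "v \<in> underlying (free m)" for k v
      using freeD[OF that] by (auto simp: tuple_smult intro!: freeI)
  qed
next
  fix a b k v w
  assume v: "v \<in> underlying (free m)"
  obtain c where c: "v = tuple c" "\<And>i. c i \<in> carrier C" "\<And>i. m \<le> i \<Longrightarrow> c i = \<zero>"
    using freeD[OF v] by blast
  show "action (free m) \<one> v = v" by (simp add: c(1,2) free_action)
  assume a: "a \<in> carrier C"
  show "action (free m) a v \<in> underlying (free m)"
    unfolding c(1) free_action[OF c(2)] using a c(2,3) by (auto intro!: freeI)
  show "action (free m) a (fun_scale k v) = fun_scale k (action (free m) a v)"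
    and "action (free m) (k \<odot> a) v = fun_scale k (action (free m) a v)"
    using a by (simp_all add: c(1,2) free_action tuple_smult smult_mult_l smult_mult_r)
  show "action (free m) a (v + w) = action (free m) a v + action (free m) a w"
    if w: "w \<in> underlying (free m)"
  proof -
    obtain d where d: "w = tuple d" "\<And>i. d i \<in> carrier C" "\<And>i. m \<le> i \<Longrightarrow> d i = \<zero>"
      using freeD[OF w] by blast
    show ?thesis using a by (simp add: c(1,2) d(1,2) free_action tuple_add r_distr)
  qed
  assume b: "b \<in> carrier C"
  show "action (free m) (b \<oplus> a) v = action (free m) b v + action (free m) a v"
    using a b by (simp add: c(1,2) free_action tuple_add l_distr)
  show "action (free m) (b \<otimes> a) v = action (free m) b (action (free m) a v)"
    using a b by (simp add: c(1,2) free_action m_assoc)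
qed

lemma coord_closed: "v \<in> underlying (free m) \<Longrightarrow> coord i v \<in> carrier C"
  by (auto dest!: freeD simp add: coord_tuple)

lemma coord_add: "v \<in> underlying (free m) \<Longrightarrow> w \<in> underlying (free m) \<Longrightarrow> coord i (v + w) = coord i v \<oplus> coord i w"
  by (auto dest!: freeD simp add: coord_tuple tuple_add)

lemma coord_smult: "v \<in> underlying (free m) \<Longrightarrow> coord i (fun_scale k v) = k \<odot> coord i v"
  by (auto dest!: freeD simp add: coord_tuple tuple_smult)

lemma coord_action: "v \<in> underlying (free m) \<Longrightarrow> a \<in> carrier C \<Longrightarrow> coord i (action (free m) a v) = a \<otimes> coord i v"
  by (auto dest!: freeD simp add: coord_tuple free_action)

definition unit_tuple :: "nat \<Rightarrow> nat \<Rightarrow> 'k" where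
  "unit_tuple i = tuple (\<lambda>j. if j = i then \<one> else \<zero>)"

lemma unit_tuple_mem: "i < m \<Longrightarrow> unit_tuple i \<in> underlying (free m)"
  unfolding unit_tuple_def by (rule freeI) auto

lemma free_decomposition:
  assumes "v \<in> underlying (free m)"
  shows "v = (\<Sum>i<m. action (free m) (coord i v) (unit_tuple i))"
proof
  fix n
  obtain c where c: "v = tuple c" "\<And>i. c i \<in> carrier C" "\<And>i. m \<le> i \<Longrightarrow> c i = \<zero>"
    using freeD[OF assms] by blast
  obtain j r where jr: "prod_decode n = (j, r)" by fastforce
  have "(\<Sum>i<m. action (free m) (coord i v) (unit_tuple i)) n
      = (\<Sum>i<m. if j = i then \<iota> (c i) r else 0)"
    unfolding sum_fun_apply
  proof (rule sum.cong)
    fix i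
    have "action (free m) (coord i v) (unit_tuple i) = tuple (\<lambda>j. c i \<otimes> (if j = i then \<one> else \<zero>))"
      unfolding unit_tuple_def c(1) coord_tuple[of c, OF c(2)] by (rule free_action) simp
    then show "action (free m) (coord i v) (unit_tuple i) n = (if j = i then \<iota> (c i) r else 0)"
      using c(2) by (simp add: tuple_def jr \<iota>_zero)
  qed simp
  also have "\<dots> = v n"
    using c(3)[of j] by (cases "j < m") (simp_all add: c(1) tuple_def jr \<iota>_zero)
  finally show "v n = (\<Sum>i<m. action (free m) (coord i v) (unit_tuple i)) n" ..
qed

lemma free_hom_eq:
  assumes "f \<in> module_hom C (free m) Y" "v \<in> underlying (free m)"
  shows "f v = (\<Sum>i<m. action Y (coord i v) (f (unit_tuple i)))"
proof -
  have "f v = f (\<Sum>i<m. action (free m) (coord i v) (unit_tuple i))"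
    using free_decomposition[OF assms(2)] by simp
  also have "\<dots> = (\<Sum>i<m. f (action (free m) (coord i v) (unit_tuple i)))"
    by (rule mh_sum[OF fd_module_free assms(1)])
      (use assms(2) in \<open>auto intro!: fdm_closed[OF fd_module_free] unit_tuple_mem coord_closed\<close>)
  also have "\<dots> = (\<Sum>i<m. action Y (coord i v) (f (unit_tuple i)))"
    by (rule sum.cong) (use assms in \<open>auto intro!: mh_act[OF assms(1)] unit_tuple_mem coord_closed\<close>)
  finally show ?thesis .
qed

lemma free_hom:
  assumes Y: "fd_module C Y" and y: "\<And>i. i < m \<Longrightarrow> y i \<in> underlying Y"
  shows "cut_off (underlying (free m)) (\<lambda>v. \<Sum>i<m. action Y (coord i v) (y i)) \<in> module_hom C (free m) Y"
proof (rule cut_off_module_hom[OF fd_module_free])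
  fix v w k a assume v: "v \<in> underlying (free m)"
  have A: "action Y (coord i v) (y i) \<in> underlying Y" if "i \<in> {..<m}" for i
    using fdm_closed[OF Y coord_closed[OF v] y] that by simp
  show "(\<Sum>i<m. action Y (coord i v) (y i)) \<in> underlying Y"
    by (rule fdm_sum[OF Y A])
  show "(\<Sum>i<m. action Y (coord i (v + w)) (y i))
      = (\<Sum>i<m. action Y (coord i v) (y i)) + (\<Sum>i<m. action Y (coord i w) (y i))"
    if w: "w \<in> underlying (free m)"
    unfolding sum.distrib[symmetric]
    by (rule sum.cong) (use v w y in \<open>auto simp: coord_add coord_closed fdm_add_left[OF Y]\<close>)
  show "(\<Sum>i<m. action Y (coord i (fun_scale k v)) (y i))
      = fun_scale k (\<Sum>i<m. action Y (coord i v) (y i))"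
    unfolding fun_vs.scale_sum_right
    by (rule sum.cong) (use v y in \<open>auto simp: coord_smult coord_closed fdm_smult[OF Y]\<close>)
  show "(\<Sum>i<m. action Y (coord i (action (free m) a v)) (y i))
      = action Y a (\<Sum>i<m. action Y (coord i v) (y i))" if a: "a \<in> carrier C"
  proof -
    have "action Y a (\<Sum>i<m. action Y (coord i v) (y i)) = (\<Sum>i<m. action Y a (action Y (coord i v) (y i)))"
      by (rule fdm_act_sum[OF Y a A])
    then show ?thesis
      by (simp only:, intro sum.cong) (use v a y in \<open>auto simp: coord_action coord_closed[OF v] fdm_mult[OF Y]\<close>)
  qed
qed

lemma projective_free: "projective C (free m)"
  unfolding projective_def
proof (intro conjI fd_module_free allI impI; elim conjE)
  fix X Y :: "('c, nat \<Rightarrow> 'k) lmod" and g f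
  assume X: "fd_module C X" and Y: "fd_module C Y" and g: "g \<in> module_hom C X Y"
    and onto: "g ` underlying X = underlying Y" and f: "f \<in> module_hom C (free m) Y"
  have "\<exists>x. x \<in> underlying X \<and> g x = f (unit_tuple i)" if "i < m" for i
    using mh_closed[OF f unit_tuple_mem[OF that]] by (auto simp flip: onto)
  then obtain y where y: "\<And>i. i < m \<Longrightarrow> y i \<in> underlying X \<and> g (y i) = f (unit_tuple i)"
    by metis
  let ?h = "cut_off (underlying (free m)) (\<lambda>v. \<Sum>i<m. action X (coord i v) (y i))"
  have "g (?h v) = f v" if v: "v \<in> underlying (free m)" for v
  proof -
    have "g (?h v) = (\<Sum>i<m. g (action X (coord i v) (y i)))"
      using v y by (subst cut_off_in[OF v], intro mh_sum[OF X g]) (auto intro!: fdm_closed[OF X] coord_closed)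
    also have "\<dots> = (\<Sum>i<m. action Y (coord i v) (f (unit_tuple i)))"
      by (rule sum.cong) (use v y in \<open>auto simp: mh_act[OF g coord_closed[OF v]]\<close>)
    also have "\<dots> = f v" using free_hom_eq[OF f v] ..
    finally show ?thesis .
  qed
  moreover have "?h \<in> module_hom C (free m) X" using y by (intro free_hom X) auto
  ultimately show "\<exists>h\<in>module_hom C (free m) X. \<forall>v\<in>underlying (free m). g (h v) = f v" by blast
qed

lemma free_surjection_exists:
  assumes N: "fd_module C N"
  shows "\<exists>m. \<exists>p\<in>module_hom C (free m) N. p ` underlying (free m) = underlying N"
proof -
  obtain S where "finite S" "underlying N \<subseteq> fun_vs.span S" using fdm_span[OF N] by blast
  from finite_spanning_subset[OF this(2,1)]
  obtain T where T: "finite T" "T \<subseteq> underlying N" "underlying N \<subseteq> fun_vs.span T" by blast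
  obtain y where y: "bij_betw y {..<card T} T"
    using ex_bij_betw_nat_finite[OF T(1)] by (auto simp: atLeast0LessThan)
  let ?m = "card T"
  define p where "p = cut_off (underlying (free ?m)) (\<lambda>v. \<Sum>i<?m. action N (coord i v) (y i))"
  have yN: "y i \<in> underlying N" if "i < ?m" for i using y T(2) that by (auto simp: bij_betw_def)
  have p: "p \<in> module_hom C (free ?m) N" unfolding p_def by (rule free_hom[OF N yN])
  have "p (unit_tuple i) = y i" if i: "i < ?m" for i
  proof -
    have "p (unit_tuple i) = (\<Sum>j<?m. if j = i then y i else 0)"
      unfolding p_def cut_off_in[OF unit_tuple_mem[OF i]]
      by (rule sum.cong)
        (use yN smult_zero_scalar[OF one_closed] fdm_smult[OF N one_closed, of _ 0] in
          \<open>auto simp: unit_tuple_def coord_tuple fdm_one[OF N]\<close>)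
    then show ?thesis using i by simp
  qed
  then have "y i \<in> p ` underlying (free ?m)" if "i < ?m" for i
    using unit_tuple_mem[OF that] that by (metis imageI)
  then have "T \<subseteq> p ` underlying (free ?m)"
    using y by (fastforce simp: bij_betw_def)
  moreover have sub: "submodule_of C (p ` underlying (free ?m)) N"
    by (rule submodule_image[OF fd_module_free N p submodule_all[OF fd_module_free]])
  ultimately have "fun_vs.span T \<subseteq> p ` underlying (free ?m)"
    by (intro fun_vs.span_minimal submodule_subspace)
  with T(3) sub have "p ` underlying (free ?m) = underlying N"
    by (auto simp: submodule_of_def)
  with p show ?thesis by blast
qed

end

section \<open>Existence of minimal projective presentations\<close>

text \<open>
  A non-zero element of the kernel of \<open>h\<close> has preimages under every iterate, so the kernels of the
  iterates would form an infinite strictly increasing chain.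
\<close>

lemma surjective_endomorphism_injective:
  fixes h :: "('x \<Rightarrow> 'k::field) \<Rightarrow> 'x \<Rightarrow> 'k"
  assumes V: "fun_vs.subspace V" "V \<subseteq> fun_vs.span S" "finite S"
    and add: "\<And>v w. v \<in> V \<Longrightarrow> w \<in> V \<Longrightarrow> h (v + w) = h v + h w"
    and scale: "\<And>k v. v \<in> V \<Longrightarrow> h (fun_scale k v) = fun_scale k (h v)"
    and onto: "h ` V = V"
    and v: "v \<in> V" "h v = 0"
  shows "v = 0"
proof (rule ccontr)
  assume "v \<noteq> 0"
  define K where "K n = {w \<in> V. (h ^^ n) w = 0}" for n
  have clos: "(h ^^ n) w \<in> V" if "w \<in> V" for n w
    using that onto by (induction n) auto
  have h0: "h 0 = 0" using scale[OF fun_vs.subspace_0[OF V(1)], of 0] by simp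
  have hadd: "(h ^^ n) (w + u) = (h ^^ n) w + (h ^^ n) u" if "w \<in> V" "u \<in> V" for n w u
  proof (induction n)
    case (Suc n)
    then show ?case using add[OF clos[OF that(1), of n] clos[OF that(2), of n]] by (simp only: funpow.simps comp_apply)
  qed simp
  have hscale: "(h ^^ n) (fun_scale k w) = fun_scale k ((h ^^ n) w)" if "w \<in> V" for n k w
  proof (induction n)
    case (Suc n)
    then show ?case using scale[OF clos[OF that(1), of n]] by (simp only: funpow.simps comp_apply)
  qed simp
  have hn0: "(h ^^ n) 0 = 0" for n
    by (induction n) (simp_all only: h0 funpow.simps comp_apply id_apply)
  have K: "fun_vs.subspace (K n)" for n
    using fun_vs.subspace_0[OF V(1)] fun_vs.subspace_add[OF V(1)] fun_vs.subspace_scale[OF V(1)]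
    by (auto simp: fun_vs.subspace_def K_def hn0 hadd hscale)
  have surj: "\<exists>u\<in>V. (h ^^ n) u = v" for n
  proof (induction n)
    case (Suc n)
    then obtain u where u: "u \<in> V" "(h ^^ n) u = v" by blast
    from u(1) onto have "u \<in> h ` V" by simp
    then obtain u' where "u' \<in> V" "u = h u'" by blast
    with u show ?case by (metis funpow_Suc_right comp_apply)
  qed (use v in auto)
  have "K n \<subset> K (Suc n)" for n
  proof -
    obtain u where "u \<in> V" "(h ^^ n) u = v" using surj by blast
    with \<open>v \<noteq> 0\<close> v have "u \<in> K (Suc n) - K n" by (simp add: K_def)
    moreover have "K n \<subseteq> K (Suc n)" by (auto simp: K_def h0)
    ultimately show ?thesis by blast
  qed
  moreover have KS: "K n \<subseteq> fun_vs.span S" for n using V(2) by (auto simp: K_def)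
  ultimately have less: "fun_vs.dim (K n) < fun_vs.dim (K (Suc n))" for n
    using dim_strict_mono[OF K _ KS V(3)] by blast
  have "n \<le> fun_vs.dim (K n)" for n
  proof (induction n)
    case (Suc n)
    with less[of n] show ?case by linarith
  qed simp
  moreover have "fun_vs.dim (K n) \<le> card S" for n
    using fun_vs.dim_le_card[OF KS V(3)] .
  ultimately have "Suc (card S) \<le> card S" by (meson order_trans)
  then show False by simp
qed

text \<open>
  Among the projective modules that map onto \<open>N\<close>, one of least dimension is a projective cover.
  If \<open>U\<close> is a proper submodule of it that still maps onto \<open>N\<close>, then lifting through \<open>U\<close> gives a
  non-surjective endomorphism over \<open>N\<close>. An endomorphism over \<open>N\<close> whose image \<open>V\<close> has least dimension
  maps \<open>V\<close> bijectively to itself, so that \<open>V\<close> is a smaller projective module that maps onto \<open>N\<close>.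
\<close>

lemma (in fd_algebra) projective_cover_exists:
  fixes N :: "('c, 'x \<Rightarrow> 'k) lmod"
  assumes N: "fd_module C N"
  shows "\<exists>P p. projective_cover C P p N"
proof -
  define good where "good P p \<longleftrightarrow> projective C P \<and> p \<in> module_hom C P N \<and> p ` underlying P = underlying N"
    for P :: "('c, nat \<Rightarrow> 'k) lmod" and p
  obtain m p0 where "p0 \<in> module_hom C (free m) N" "p0 ` underlying (free m) = underlying N"
    using free_surjection_exists[OF N] by blast
  then have "good (free m) p0" by (simp add: good_def projective_free)
  then have ex: "(\<lambda>(P, p). good P p) (free m, p0)" by simp
  obtain z where z: "(\<lambda>(P, p). good P p) z"
      "\<And>y. (\<lambda>(P, p). good P p) y \<Longrightarrow> fun_vs.dim (underlying (fst z)) \<le> fun_vs.dim (underlying (fst y))"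
    using ex_has_least_nat[of "\<lambda>(P, p). good P p" "(free m, p0)" "\<lambda>z. fun_vs.dim (underlying (fst z))"] ex
    by blast
  obtain P p where Pp: "z = (P, p)" by (cases z)
  have gP: "good P p" and least: "\<And>P' p'. good P' p' \<Longrightarrow> fun_vs.dim (underlying P) \<le> fun_vs.dim (underlying P')"
    using z unfolding Pp by auto
  have P: "projective C P" and p: "p \<in> module_hom C P N" and onto: "p ` underlying P = underlying N"
    using gP by (auto simp: good_def)
  have P': "fd_module C P" using P by (rule projectiveD)
  obtain S where S: "finite S" "underlying P \<subseteq> fun_vs.span S" using fdm_span[OF P'] by blast
  have "U = underlying P" if U: "submodule_of C U P"
    and sum: "{l + u |l u. l \<in> hom_kernel P p \<and> u \<in> U} = underlying P" for U
  proof (rule ccontr)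
    assume ne: "U \<noteq> underlying P"
    have UP: "U \<subseteq> underlying P" using U by (simp add: submodule_of_def)
    let ?U = "P\<lparr>underlying := U\<rparr>"
    have fU: "fd_module C ?U" by (rule submodule_fd_module[OF P' U])
    have pU: "cut_off (underlying ?U) p \<in> module_hom C ?U N"
      by (intro cut_off_module_hom fU) (auto simp: subsetD[OF UP] mh_closed[OF p] mh_add[OF p] mh_scale[OF p] mh_act[OF p])
    have im: "p ` underlying P \<subseteq> cut_off (underlying ?U) p ` underlying ?U"
    proof (intro image_subsetI)
      fix v assume "v \<in> underlying P"
      then obtain l u where lu: "v = l + u" "l \<in> hom_kernel P p" "u \<in> U" using sum by blast
      then have "p v = p u" using UP by (auto simp: hom_kernel_def mh_add[OF p])
      with lu(3) show "p v \<in> cut_off (underlying ?U) p ` underlying ?U" by auto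
    qed
    obtain h where h: "h \<in> module_hom C P ?U"
        "\<forall>v\<in>underlying P. cut_off (underlying ?U) p (h v) = p v"
      using projective_lift[OF k_algebra_axioms P fU N pU p im] by blast
    define H where "H g \<longleftrightarrow> g \<in> module_hom C P P \<and> (\<forall>v\<in>underlying P. p (g v) = p v)" for g
    have hU: "h v \<in> U" if "v \<in> underlying P" for v using mh_closed[OF h(1) that] by simp
    have hPP: "h \<in> module_hom C P P"
      using h(1) UP unfolding module_hom_def by auto
    with h(2) hU have Hh: "H h" by (simp add: H_def subsetD[OF UP])
    obtain g where g: "H g" "\<And>g'. H g' \<Longrightarrow> fun_vs.dim (g ` underlying P) \<le> fun_vs.dim (g' ` underlying P)"
      using ex_has_least_nat[of H h "\<lambda>g. fun_vs.dim (g ` underlying P)"] Hh by blast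
    have gPP: "g \<in> module_hom C P P" and pg: "\<And>v. v \<in> underlying P \<Longrightarrow> p (g v) = p v"
      using g(1) by (auto simp: H_def)
    define V where "V = g ` underlying P"
    have V: "submodule_of C V P"
      unfolding V_def by (rule submodule_image[OF P' P' gPP submodule_all[OF P']])
    have VP: "V \<subseteq> underlying P" using V by (simp add: submodule_of_def)
    have "U \<subset> underlying P" using ne UP by (simp add: psubset_eq)
    then have "h ` underlying P \<subset> underlying P"
      using image_subsetI[of "underlying P" h U, OF hU] by (rule subset_psubset_trans[rotated])
    then have "fun_vs.dim (h ` underlying P) < fun_vs.dim (underlying P)"
      by (rule dim_strict_mono[OF submodule_subspace[OF submodule_image[OF P' P' hPP submodule_all[OF P']]] _ S(2,1)])
    with g(2)[OF Hh] have small: "fun_vs.dim V < fun_vs.dim (underlying P)"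
      by (simp add: V_def)
    have gV: "g ` V = V"
    proof (rule ccontr)
      assume "g ` V \<noteq> V"
      moreover have "g ` V \<subseteq> V" unfolding V_def using mh_closed[OF gPP] by blast
      ultimately have "fun_vs.dim (g ` V) < fun_vs.dim V"
        using submodule_image[OF P' P' gPP V] VP S
        by (intro dim_strict_mono[of _ _ S]) (auto simp: submodule_of_def)
      moreover have "H (\<lambda>v. g (g v))"
        using gPP pg mh_closed[OF gPP] mh_0[OF P' gPP]
        by (auto simp: H_def module_hom_def)
      then have "fun_vs.dim V \<le> fun_vs.dim (g ` V)"
        using g(2)[of "\<lambda>v. g (g v)"] by (simp add: V_def image_image)
      ultimately show False by simp
    qed
    have inj: "v = w" if "v \<in> V" "w \<in> V" "g v = g w" for v w
    proof -
      have "v \<in> underlying P" "w \<in> underlying P" using that VP by blast+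
      then have g0: "g (v - w) = 0" using that(3) by (simp add: mh_diff[OF P' gPP])
      have vw: "v - w \<in> V" using that fun_vs.subspace_diff[OF submodule_subspace[OF V]] by blast
      have VS: "V \<subseteq> fun_vs.span S" using VP S(2) by (rule subset_trans)
      have "v - w = 0"
        by (rule surjective_endomorphism_injective[OF submodule_subspace[OF V] VS S(1) _ _ gV vw g0])
          (use VP in \<open>blast intro: mh_add[OF gPP] mh_scale[OF gPP]\<close>)+
      then show ?thesis by simp
    qed
    let ?V = "P\<lparr>underlying := V\<rparr>"
    have fV: "fd_module C ?V" by (rule submodule_fd_module[OF P' V])
    have q: "g \<in> module_hom C P ?V" using gPP unfolding module_hom_def V_def by auto
    define r where "r = the_inv_into V g"
    have gi: "inj_on g V" using inj by (auto simp: inj_on_def)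
    have r: "r w \<in> V \<and> g (r w) = w" if "w \<in> V" for w
      using that gV by (metis f_the_inv_into_f gi r_def subset_refl the_inv_into_into)
    have r_eq: "r w = u" if "u \<in> V" "g u = w" for u w
      using that gi by (auto simp: r_def the_inv_into_f_f)
    note Vsub = submodule_subspace[OF V]
    have "cut_off (underlying ?V) r \<in> module_hom C ?V P"
    proof (rule cut_off_module_hom[OF fV])
      fix v w k c assume v: "v \<in> underlying ?V"
      then have vV: "v \<in> V" by simp
      show "r v \<in> underlying P" using r[OF vV] VP by blast
      show "r (v + w) = r v + r w" if "w \<in> underlying ?V"
        using r[OF vV] r[of w] that VP fun_vs.subspace_add[OF Vsub]
        by (intro r_eq) (auto simp: mh_add[OF gPP] subset_iff)
      show "r (fun_scale k v) = fun_scale k (r v)"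
        using r[OF vV] VP fun_vs.subspace_scale[OF Vsub]
        by (intro r_eq) (auto simp: mh_scale[OF gPP] subset_iff)
      show "r (action ?V c v) = action P c (r v)" if "c \<in> carrier C"
        using r[OF vV] VP V that
        by (intro r_eq) (auto simp: mh_act[OF gPP] subset_iff submodule_of_def)
    qed
    then have "projective C ?V"
      using r by (intro projective_retract[OF k_algebra_axioms P fV q]) auto
    moreover have "cut_off (underlying ?V) p \<in> module_hom C ?V N"
      by (intro cut_off_module_hom fV) (auto simp: subsetD[OF VP] mh_closed[OF p] mh_add[OF p] mh_scale[OF p] mh_act[OF p])
    moreover have "cut_off (underlying ?V) p ` underlying ?V = underlying N"
    proof -
      have "cut_off (underlying ?V) p ` underlying ?V = p ` V" by (auto simp: image_iff)
      also have "\<dots> = underlying N" unfolding V_def image_image onto[symmetric]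
        by (rule image_cong) (simp_all add: pg)
      finally show ?thesis .
    qed
    ultimately have "good ?V (cut_off (underlying ?V) p)" by (simp add: good_def)
    from least[OF this] small show False by simp
  qed
  then have "superfluous C (hom_kernel P p) P"
    using submodule_hom_kernel[OF P' N p] by (auto simp: superfluous_def)
  with P p onto show ?thesis by (auto simp: projective_cover_def)
qed

lemma (in fd_algebra) minimal_projective_presentation_exists:
  assumes N: "fd_module C N"
  shows "\<exists>P1 p1 P0 p0. minimal_projective_presentation C P1 p1 P0 p0 N"
proof -
  obtain P0 p0 where 0: "projective_cover C P0 p0 N" using projective_cover_exists[OF N] by blast
  then have "fd_module C (P0\<lparr>underlying := hom_kernel P0 p0\<rparr>)"
    by (intro submodule_fd_module submodule_hom_kernel[OF _ N]) (auto simp: projective_cover_def projectiveD)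
  from projective_cover_exists[OF this] 0 show ?thesis
    by (auto simp: minimal_projective_presentation_def)
qed

section \<open>Homomorphisms from projective modules to the algebra\<close>

lemma hom_to_algebraD:
  assumes "f \<in> hom_to_algebra C P"
  shows ha_closed: "\<And>v. v \<in> underlying P \<Longrightarrow> f v \<in> carrier C"
    and ha_add: "\<And>v w. v \<in> underlying P \<Longrightarrow> w \<in> underlying P \<Longrightarrow> f (v + w) = f v \<oplus>\<^bsub>C\<^esub> f w"
    and ha_scale: "\<And>k v. v \<in> underlying P \<Longrightarrow> f (fun_scale k v) = k \<odot>\<^bsub>C\<^esub> f v"
    and ha_act: "\<And>c v. c \<in> carrier C \<Longrightarrow> v \<in> underlying P \<Longrightarrow> f (action P c v) = c \<otimes>\<^bsub>C\<^esub> f v"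
  using assms by (auto simp: hom_to_algebra_def)

lemma hom_to_algebraI:
  assumes "fd_module C P"
    and "\<And>v. v \<in> underlying P \<Longrightarrow> f v \<in> carrier C"
    and "\<And>v w. v \<in> underlying P \<Longrightarrow> w \<in> underlying P \<Longrightarrow> f (v + w) = f v \<oplus>\<^bsub>C\<^esub> f w"
    and "\<And>k v. v \<in> underlying P \<Longrightarrow> f (fun_scale k v) = k \<odot>\<^bsub>C\<^esub> f v"
    and "\<And>c v. c \<in> carrier C \<Longrightarrow> v \<in> underlying P \<Longrightarrow> f (action P c v) = c \<otimes>\<^bsub>C\<^esub> f v"
  shows "(\<lambda>v\<in>underlying P. f v) \<in> hom_to_algebra C P"
  using assms by (auto simp: hom_to_algebra_def fdm_plus fdm_fun_scale fdm_closed)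

context fd_algebra
begin

lemma coord_hom:
  assumes "fd_module C P" and h: "h \<in> module_hom C P (free m)"
  shows "(\<lambda>v\<in>underlying P. coord i (h v)) \<in> hom_to_algebra C P"
  using mh_closed[OF h]
  by (intro hom_to_algebraI assms(1))
    (auto simp: mh_add[OF h] mh_scale[OF h] mh_act[OF h] coord_closed[where m = m] coord_add[where m = m]
      coord_smult[where m = m] coord_action[where m = m])

lemma projective_lift_to_algebra:
  assumes P: "projective C P" and J: "ideal J C"
    and F: "\<And>v. v \<in> underlying P \<Longrightarrow> F v \<in> carrier C"
    and Fa: "\<And>v w. v \<in> underlying P \<Longrightarrow> w \<in> underlying P \<Longrightarrow> F (v + w) \<ominus> (F v \<oplus> F w) \<in> J"
    and Fs: "\<And>k v. v \<in> underlying P \<Longrightarrow> F (fun_scale k v) \<ominus> k \<odot> F v \<in> J"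
    and Fc: "\<And>c v. c \<in> carrier C \<Longrightarrow> v \<in> underlying P \<Longrightarrow> F (action P c v) \<ominus> c \<otimes> F v \<in> J"
  shows "\<exists>f\<in>hom_to_algebra C P. \<forall>v\<in>underlying P. f v \<ominus> F v \<in> J"
proof -
  have P': "fd_module C P" using P by (rule projectiveD)
  interpret J: ideal J C by (rule J)
  let ?R = "{v \<in> underlying (free 1). coord 0 v \<in> J}"
  let ?t = "\<lambda>c. tuple (\<lambda>i. if i = 0 then c else \<zero>)"
  note X = fd_module_free[of 1]
  have t: "?t c \<in> underlying (free 1) \<and> coord 0 (?t c) = c" if "c \<in> carrier C" for c
    using that by (auto intro!: freeI simp: coord_tuple)
  have c0: "coord 0 0 = \<zero>" using coord_tuple[of "\<lambda>i. \<zero>" 0] by (simp add: tuple_zero)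
  have cd: "coord 0 (v - w) = coord 0 v \<ominus> coord 0 w"
    if "v \<in> underlying (free 1)" "w \<in> underlying (free 1)" for v w
  proof -
    have "coord 0 (v - w + w) = coord 0 (v - w) \<oplus> coord 0 w"
      using that by (intro coord_add[where m = 1] fdm_minus[OF X])
    then have "coord 0 v = coord 0 (v - w) \<oplus> coord 0 w" by simp
    then show ?thesis
      using coord_closed[OF that(1)] coord_closed[OF that(2)] coord_closed[OF fdm_minus[OF X that]]
      by (simp add: minus_eq add.inv_solve_right)
  qed
  have R: "submodule_of C ?R (free 1)"
    unfolding submodule_of_def fun_vs.subspace_def
    using fdm_0[OF X] J.zero_closed
    by (auto simp: c0 coord_add[where m = 1] coord_smult[where m = 1] coord_action[where m = 1] coord_closed[where m = 1] fdm_plus[OF X] fdm_fun_scale[OF X]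
        fdm_closed[OF X] J.a_closed J.I_l_closed ideal_smult_closed[OF J] simp del: One_nat_def)
  have "\<exists>h\<in>module_hom C P (free 1). \<forall>v\<in>underlying P. h v - ?t (F v) \<in> ?R"
  proof (rule projective_lift_modulo[OF k_algebra_axioms P X R])
    show "?t (F v) \<in> underlying (free 1)" if "v \<in> underlying P" for v
      using t F that by blast
    show "?t (F (v + w)) - (?t (F v) + ?t (F w)) \<in> ?R" if "v \<in> underlying P" "w \<in> underlying P" for v w
      using t[OF F[OF that(1)]] t[OF F[OF that(2)]] t[OF F[OF fdm_plus[OF P' that]]] Fa[OF that]
      by (simp add: fdm_minus[OF X] fdm_plus[OF X] cd coord_add[where m = 1] del: One_nat_def)
    show "?t (F (fun_scale k v)) - fun_scale k (?t (F v)) \<in> ?R" if "v \<in> underlying P" for k v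
      using t[OF F[OF that(1)]] t[OF F[OF fdm_fun_scale[OF P' that]]] Fs[OF that]
      by (simp add: fdm_minus[OF X] fdm_fun_scale[OF X] cd coord_smult[where m = 1] del: One_nat_def)
    show "?t (F (action P c v)) - action (free 1) c (?t (F v)) \<in> ?R"
      if "c \<in> carrier C" "v \<in> underlying P" for c v
      using t[OF F[OF that(2)]] t[OF F[OF fdm_closed[OF P' that]]] Fc[OF that] that
      by (simp add: fdm_minus[OF X] fdm_closed[OF X] cd coord_action[where m = 1] del: One_nat_def)
  qed
  then obtain h where h: "h \<in> module_hom C P (free 1)" "\<forall>v\<in>underlying P. h v - ?t (F v) \<in> ?R"
    by blast
  have "(\<lambda>v\<in>underlying P. coord 0 (h v)) v \<ominus> F v \<in> J" if v: "v \<in> underlying P" for v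
    using h(2) v t[OF F[OF v]] cd[OF mh_closed[OF h(1) v], of "?t (F v)"] by (auto simp del: One_nat_def)
  with coord_hom[OF P' h(1)] show ?thesis by blast
qed

end

context fd_algebra
begin

lemma minus_self: "a \<in> carrier C \<Longrightarrow> a \<ominus> a = \<zero>"
  by (simp add: minus_eq r_neg)

text \<open>
  The left ideal that is generated by the products \<open>eb\<close>, where \<open>b\<close> runs through a finite linear
  generating system, contains \<open>ec\<close> for all \<open>c\<close> by linearity. So it is closed under multiplication
  from the right, and it is all of \<open>CeC\<close>.
\<close>

lemma genideal_left_generators:
  assumes e: "e \<in> carrier C"
  shows "\<exists>(m :: nat) b. (\<forall>i. b i \<in> carrier C) \<and> (\<forall>x\<in>Idl {e}. \<exists>c. (\<forall>i. c i \<in> carrier C) \<and>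
    x = (\<Oplus>i\<in>{..<m}. c i \<otimes> (e \<otimes> b i)))"
proof -
  obtain m :: nat and b where b: "\<And>i. b i \<in> carrier C"
    and gen: "\<And>H. H \<subseteq> carrier C \<Longrightarrow> \<zero> \<in> H \<Longrightarrow> (\<And>x y. x \<in> H \<Longrightarrow> y \<in> H \<Longrightarrow> x \<oplus> y \<in> H) \<Longrightarrow>
      (\<And>k x. x \<in> H \<Longrightarrow> k \<odot> x \<in> H) \<Longrightarrow> (\<And>i. i < m \<Longrightarrow> b i \<in> H) \<Longrightarrow> H = carrier C"
    using finite_linear_generators by metis
  let ?s = "\<lambda>c. \<Oplus>i\<in>{..<m}. c i \<otimes> (e \<otimes> b i)"
  define L where "L = {x. \<exists>c. (\<forall>i. c i \<in> carrier C) \<and> x = ?s c}"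
  have LI: "?s c \<in> L" if "\<And>i. c i \<in> carrier C" for c
    using that unfolding L_def by blast
  have LC: "L \<subseteq> carrier C" unfolding L_def using e b by (auto intro!: finsum_closed)
  have Ladd: "x \<oplus> y \<in> L" if xy: "x \<in> L" "y \<in> L" for x y
  proof -
    obtain c d where c: "\<forall>i. c i \<in> carrier C" "x = ?s c" and d: "\<forall>i. d i \<in> carrier C" "y = ?s d"
      using xy unfolding L_def by blast
    have "x \<oplus> y = (\<Oplus>i\<in>{..<m}. c i \<otimes> (e \<otimes> b i) \<oplus> d i \<otimes> (e \<otimes> b i))"
      unfolding c(2) d(2) using e b c(1) d(1) by (intro finsum_addf[symmetric]) auto
    also have "\<dots> = ?s (\<lambda>i. c i \<oplus> d i)"
      using e b c(1) d(1) by (intro finsum_cong') (auto simp: l_distr)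
    finally show ?thesis using LI[of "\<lambda>i. c i \<oplus> d i"] c(1) d(1) by simp
  qed
  have Lmult: "a \<otimes> x \<in> L" if ax: "a \<in> carrier C" "x \<in> L" for a x
  proof -
    obtain c where c: "\<forall>i. c i \<in> carrier C" "x = ?s c" using ax(2) unfolding L_def by blast
    have "a \<otimes> x = (\<Oplus>i\<in>{..<m}. a \<otimes> (c i \<otimes> (e \<otimes> b i)))"
      unfolding c(2) using e b c(1) ax(1) by (intro finsum_rdistr) auto
    also have "\<dots> = ?s (\<lambda>i. a \<otimes> c i)"
      using e b c(1) ax(1) by (intro finsum_cong') (auto simp: m_assoc)
    finally show ?thesis using LI[of "\<lambda>i. a \<otimes> c i"] c(1) ax(1) by simp
  qed
  have L0: "\<zero> \<in> L" using LI[of "\<lambda>i. \<zero>"] e b by simp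
  have Lgen: "x \<otimes> (e \<otimes> b j) \<in> L" if x: "x \<in> carrier C" and j: "j < m" for x j
  proof -
    have "?s (\<lambda>i. if i = j then x else \<zero>) = (\<Oplus>i\<in>{..<m}. if i = j then x \<otimes> (e \<otimes> b j) else \<zero>)"
      using e b x by (intro finsum_cong') auto
    also have "\<dots> = x \<otimes> (e \<otimes> b j)"
      using finsum_singleton[of j "{..<m}" "\<lambda>i. x \<otimes> (e \<otimes> b j)"] e b x j
      by (simp add: eq_commute[of _ j])
    finally show ?thesis using LI[of "\<lambda>i. if i = j then x else \<zero>"] x by simp
  qed
  have "{y \<in> carrier C. \<forall>x\<in>carrier C. x \<otimes> (e \<otimes> y) \<in> L} = carrier C"
  proof (rule gen)
    show "k \<odot> y \<in> {y \<in> carrier C. \<forall>x\<in>carrier C. x \<otimes> (e \<otimes> y) \<in> L}"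
      if "y \<in> {y \<in> carrier C. \<forall>x\<in>carrier C. x \<otimes> (e \<otimes> y) \<in> L}" for k y
    proof -
      have "x \<otimes> (e \<otimes> (k \<odot> y)) = (k \<odot> x) \<otimes> (e \<otimes> y)" if "x \<in> carrier C" for x
        using that \<open>y \<in> _\<close> e by (simp add: smult_mult_l smult_mult_r)
      with that show ?thesis by auto
    qed
  qed (use e b L0 Ladd Lgen in \<open>auto simp: r_distr\<close>)
  then have Le: "x \<otimes> (e \<otimes> y) \<in> L" if "x \<in> carrier C" "y \<in> carrier C" for x y
    using that by blast
  have Lsum: "(\<Oplus>i\<in>S. f i) \<in> L" if "finite S" "\<And>i. i \<in> S \<Longrightarrow> f i \<in> L" for S :: "nat set" and f
    using that
  proof (induction S rule: finite_induct)
    case (insert x F)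
    then have "f \<in> F \<rightarrow> carrier C" "f x \<in> carrier C" using LC by auto
    with insert show ?case by (simp add: finsum_insert Ladd)
  qed (simp add: L0)
  have "x \<in> L" if "x \<in> Idl {e}" for x
    using that e
  proof (induction rule: genideal_induct)
    case gen
    then show ?case using Le[of \<one> \<one>] e by simp
  next
    case (right a x)
    then obtain c where c: "\<forall>i. c i \<in> carrier C" "x = ?s c" unfolding L_def by blast
    have "x \<otimes> a = (\<Oplus>i\<in>{..<m}. c i \<otimes> (e \<otimes> b i) \<otimes> a)"
      unfolding c(2) using e b c(1) right by (intro finsum_ldistr) auto
    also have "\<dots> = (\<Oplus>i\<in>{..<m}. c i \<otimes> (e \<otimes> (b i \<otimes> a)))"
      using e b c(1) right by (intro finsum_cong') (auto simp: m_assoc)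
    also have "\<dots> \<in> L" using b c(1) right by (intro Lsum Le) auto
    finally show ?case .
  qed (simp_all add: Ladd Lmult)
  then show ?thesis using b unfolding L_def by blast
qed

text \<open>
  Hence, for projective \<open>P\<close>, the homomorphisms from \<open>P\<close> to the ideal \<open>CeC\<close> form the right submodule
  \<open>Hom(P, C) eC\<close> of \<open>Hom(P, C)\<close>: a homomorphism to the ideal lifts to the free module on the
  generators.
\<close>

lemma hom_into_genideal:
  assumes P: "projective C P" and e: "e \<in> carrier C"
    and f: "f \<in> hom_to_algebra C P" and fe: "\<And>v. v \<in> underlying P \<Longrightarrow> f v \<in> Idl {e}"
  shows "\<exists>(m :: nat) b g. (\<forall>i. b i \<in> carrier C) \<and> (\<forall>i. g i \<in> hom_to_algebra C P) \<and>
    (\<forall>v\<in>underlying P. f v = (\<Oplus>i\<in>{..<m}. g i v \<otimes> (e \<otimes> b i)))"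
proof -
  have P': "fd_module C P" using P by (rule projectiveD)
  obtain m :: nat and b where b: "\<And>i. b i \<in> carrier C"
    and gen: "\<And>x. x \<in> Idl {e} \<Longrightarrow> \<exists>c. (\<forall>i. c i \<in> carrier C) \<and> x = (\<Oplus>i\<in>{..<m}. c i \<otimes> (e \<otimes> b i))"
    using genideal_left_generators[OF e] by metis
  let ?s = "\<lambda>u. \<Oplus>i\<in>{..<m}. coord i u \<otimes> (e \<otimes> b i)"
  note X = fd_module_free[of m]
  have sC: "?s u \<in> carrier C" if "u \<in> underlying (free m)" for u
    using that b e by (intro finsum_closed) (auto simp: coord_closed[where m = m])
  have sadd: "?s (u + w) = ?s u \<oplus> ?s w" if "u \<in> underlying (free m)" "w \<in> underlying (free m)" for u w
  proof -
    have "?s u \<oplus> ?s w = (\<Oplus>i\<in>{..<m}. coord i u \<otimes> (e \<otimes> b i) \<oplus> coord i w \<otimes> (e \<otimes> b i))"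
      using that b e by (intro finsum_addf[symmetric]) (auto simp: coord_closed[where m = m])
    also have "\<dots> = ?s (u + w)"
      using that b e
      by (intro finsum_cong') (auto simp: coord_closed[where m = m] coord_add[where m = m] l_distr)
    finally show ?thesis ..
  qed
  have sact: "?s (action (free m) a u) = a \<otimes> ?s u" if "a \<in> carrier C" "u \<in> underlying (free m)" for a u
  proof -
    have "a \<otimes> ?s u = (\<Oplus>i\<in>{..<m}. a \<otimes> (coord i u \<otimes> (e \<otimes> b i)))"
      using that b e by (intro finsum_rdistr) (auto simp: coord_closed[where m = m])
    also have "\<dots> = ?s (action (free m) a u)"
      using that b e
      by (intro finsum_cong') (auto simp: coord_closed[where m = m] coord_action[where m = m] m_assoc)
    finally show ?thesis ..
  qed
  have sscale: "?s (fun_scale k u) = k \<odot> ?s u" if u: "u \<in> underlying (free m)" for k u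
  proof -
    have "?s (fun_scale k u) = ?s (action (free m) (k \<odot> \<one>) u)"
      using fdm_smult[OF X one_closed u, of k] fdm_one[OF X u] by simp
    also have "\<dots> = k \<odot> ?s u" using sact[of "k \<odot> \<one>" u] u sC[OF u] by (simp flip: smult_eq_mult)
    finally show ?thesis .
  qed
  have sdiff: "?s (u - w) = ?s u \<ominus> ?s w" if "u \<in> underlying (free m)" "w \<in> underlying (free m)" for u w
  proof -
    have "?s (u - w + w) = ?s (u - w) \<oplus> ?s w" using that by (intro sadd fdm_minus[OF X])
    then have "?s u = ?s (u - w) \<oplus> ?s w" by simp
    then show ?thesis
      using sC[OF that(1)] sC[OF that(2)] sC[OF fdm_minus[OF X that]]
      by (simp add: minus_eq add.inv_solve_right)
  qed
  let ?R = "{u \<in> underlying (free m). ?s u = \<zero>}"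
  have s0: "?s 0 = \<zero>" using sscale[of 0 0] fdm_0[OF X] sC[OF fdm_0[OF X]] by simp
  have R: "submodule_of C ?R (free m)"
    unfolding submodule_of_def fun_vs.subspace_def
    using fdm_0[OF X] fdm_plus[OF X] fdm_fun_scale[OF X] fdm_closed[OF X]
    by (auto simp: s0 sadd sscale sact)
  have "\<exists>u. u \<in> underlying (free m) \<and> ?s u = f v" if v: "v \<in> underlying P" for v
  proof -
    obtain c where c: "\<And>i. c i \<in> carrier C" "f v = (\<Oplus>i\<in>{..<m}. c i \<otimes> (e \<otimes> b i))"
      using gen[OF fe[OF v]] by blast
    let ?c = "\<lambda>i. if i < m then c i else \<zero>"
    have "tuple ?c \<in> underlying (free m)" using c(1) by (intro freeI) auto
    moreover have "?s (tuple ?c) = f v"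
      unfolding c(2) using c(1) b e by (intro finsum_cong') (auto simp: coord_tuple)
    ultimately show ?thesis by blast
  qed
  then obtain F where F: "\<And>v. v \<in> underlying P \<Longrightarrow> F v \<in> underlying (free m) \<and> ?s (F v) = f v"
    by metis
  have "\<exists>h\<in>module_hom C P (free m). \<forall>v\<in>underlying P. h v - F v \<in> ?R"
  proof (rule projective_lift_modulo[OF k_algebra_axioms P X R])
    show "F v \<in> underlying (free m)" if "v \<in> underlying P" for v using F that by blast
    show "F (v + w) - (F v + F w) \<in> ?R" if "v \<in> underlying P" "w \<in> underlying P" for v w
      using F[OF that(1)] F[OF that(2)] F[OF fdm_plus[OF P' that]] that
      by (simp add: fdm_minus[OF X] fdm_plus[OF X] sdiff sadd ha_add[OF f] ha_closed[OF f] minus_self)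
    show "F (fun_scale k v) - fun_scale k (F v) \<in> ?R" if "v \<in> underlying P" for k v
      using F[OF that] F[OF fdm_fun_scale[OF P' that]] that
      by (simp add: fdm_minus[OF X] fdm_fun_scale[OF X] sdiff sscale ha_scale[OF f] ha_closed[OF f] minus_self)
    show "F (action P c v) - action (free m) c (F v) \<in> ?R" if "c \<in> carrier C" "v \<in> underlying P" for c v
      using F[OF that(2)] F[OF fdm_closed[OF P' that]] that
      by (simp add: fdm_minus[OF X] fdm_closed[OF X] sdiff sact ha_act[OF f] ha_closed[OF f] minus_self)
  qed
  then obtain h where h: "h \<in> module_hom C P (free m)" "\<forall>v\<in>underlying P. h v - F v \<in> ?R"
    by blast
  let ?g = "\<lambda>i. \<lambda>v\<in>underlying P. coord i (h v)"
  have "f v = (\<Oplus>i\<in>{..<m}. ?g i v \<otimes> (e \<otimes> b i))" if v: "v \<in> underlying P" for v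
  proof -
    have "h v = (h v - F v) + F v" by simp
    then have "?s (h v) = ?s (h v - F v) \<oplus> ?s (F v)"
      using sadd[of "h v - F v" "F v"] h(2) F v by auto
    then have "?s (h v) = f v" using h(2) F[OF v] v ha_closed[OF f v] by simp
    then show ?thesis using v by simp
  qed
  moreover have "?g i \<in> hom_to_algebra C P" for i by (rule coord_hom[OF P' h(1)])
  ultimately show ?thesis
    using b by (intro exI[of _ m] exI[of _ b] exI[of _ ?g]) blast
qed

end

section \<open>Quotient algebras and their modules\<close>

locale quotient_algebra = k_algebra C for C :: "('k::field, 'c) module" (structure) +
  fixes J :: "'c set" and B :: "('k, 'c set) module"
  assumes J: "ideal J C" and B: "B = quot_algebra C J"
begin

sublocale J: ideal J C by (rule J)

lemma quot_carrier: "carrier B = (\<lambda>c. J +> c) ` carrier C"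
  by (auto simp: B quot_algebra_def FactRing_def A_RCOSETS_def')

lemma quot_coset_mem: "c \<in> carrier C \<Longrightarrow> J +> c \<in> carrier B"
  by (simp add: quot_carrier)

lemma quot_carrierD: "x \<in> carrier B \<Longrightarrow> \<exists>c\<in>carrier C. x = J +> c"
  by (auto simp: quot_carrier)

lemma quot_coset_eq_iff:
  assumes "a \<in> carrier C" "b \<in> carrier C"
  shows "J +> a = J +> b \<longleftrightarrow> a \<ominus> b \<in> J"
  using quotient_eq_iff_same_a_r_cos[OF J assms] by simp

lemma quot_mult: "a \<in> carrier C \<Longrightarrow> b \<in> carrier C \<Longrightarrow> (J +> a) \<otimes>\<^bsub>B\<^esub> (J +> b) = J +> (a \<otimes> b)"
  by (simp add: B quot_algebra_def FactRing_def J.rcoset_mult_add)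

lemma quot_add: "a \<in> carrier C \<Longrightarrow> b \<in> carrier C \<Longrightarrow> (J +> a) \<oplus>\<^bsub>B\<^esub> (J +> b) = J +> (a \<oplus> b)"
  by (simp add: B quot_algebra_def FactRing_def J.a_rcos_sum)

lemma quot_one: "\<one>\<^bsub>B\<^esub> = J +> \<one>"
  by (simp add: B quot_algebra_def FactRing_def)

lemma quot_coset_of_mem: "c \<in> J \<Longrightarrow> J +> c = J"
  by (simp add: J.a_rcos_const)

lemma quot_zero: "\<zero>\<^bsub>B\<^esub> = J +> \<zero>"
  by (simp add: B quot_algebra_def FactRing_def quot_coset_of_mem J.zero_closed)

lemma quot_coset_some:
  assumes "c \<in> carrier C"
  shows "(SOME x. x \<in> J +> c) \<in> carrier C" and "(SOME x. x \<in> J +> c) \<ominus> c \<in> J"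
proof -
  have "(SOME x. x \<in> J +> c) \<in> J +> c"
    by (rule someI[of _ c]) (rule J.a_rcos_self[OF assms])
  then show mem: "(SOME x. x \<in> J +> c) \<in> carrier C"
    using a_r_coset_subset_G[OF J.a_subset assms] by blast
  show "(SOME x. x \<in> J +> c) \<ominus> c \<in> J"
    using \<open>(SOME x. x \<in> J +> c) \<in> J +> c\<close> mem assms J.a_rcos_module_minus[OF ring_axioms] by blast
qed

lemma quot_smult:
  assumes c: "c \<in> carrier C"
  shows "k \<odot>\<^bsub>B\<^esub> (J +> c) = J +> (k \<odot> c)"
proof -
  have same: "J +> (k \<odot> x) = J +> (k \<odot> c)" if x: "x \<in> J +> c" for x
  proof -
    have xC: "x \<in> carrier C" using a_r_coset_subset_G[OF J.a_subset c] x by blast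
    have xc: "x \<ominus> c \<in> J" using x xC c J.a_rcos_module_minus[OF ring_axioms] by blast
    have "k \<odot> (x \<ominus> c) = k \<odot> x \<ominus> k \<odot> c"
      using xC c smult_r_distr[of x "\<ominus> c" k] smult_mult_r[of "\<ominus> \<one>" c k]
      by (simp add: minus_eq l_minus)
    with ideal_smult_closed[OF J xc, of k] show ?thesis
      using xC c by (simp add: quot_coset_eq_iff)
  qed
  have "(\<Union>x\<in>J +> c. J +> (k \<odot> x)) = (\<Union>x\<in>J +> c. J +> (k \<odot> c))"
    by (rule SUP_cong[OF refl same])
  also have "\<dots> = J +> (k \<odot> c)" using J.a_rcos_self[OF c] by blast
  finally show ?thesis by (simp add: B quot_algebra_def)
qed

lemmas quot_ops = quot_mult quot_add quot_one quot_zero quot_smult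

lemma k_algebra_quot: "k_algebra B"
proof -
  interpret R: ring "C Quot J" by (rule J.quotient_is_ring)
  have eq: "carrier B = carrier (C Quot J)" "mult B = mult (C Quot J)" "one B = one (C Quot J)"
    "zero B = zero (C Quot J)" "add B = add (C Quot J)"
    by (simp_all add: B quot_algebra_def)
  have "abelian_group B"
    by (rule abelian_groupI) (auto simp: eq R.a_ac intro: R.add.l_inv_ex)
  then have "ring B"
    by (rule ringI[OF _ monoidI]) (simp_all add: eq R.m_assoc R.l_distr R.r_distr)
  then show ?thesis
  proof (intro k_algebra.intro k_algebra_axioms.intro)
    fix k l x assume "x \<in> carrier B"
    then obtain a where a: "a \<in> carrier C" "x = J +> a" using quot_carrierD by blast
    show "k \<odot>\<^bsub>B\<^esub> x \<in> carrier B" using a by (simp add: quot_smult quot_coset_mem)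
    show "(k + l) \<odot>\<^bsub>B\<^esub> x = k \<odot>\<^bsub>B\<^esub> x \<oplus>\<^bsub>B\<^esub> l \<odot>\<^bsub>B\<^esub> x"
      using a by (simp add: quot_smult quot_add smult_l_distr)
    show "(k * l) \<odot>\<^bsub>B\<^esub> x = k \<odot>\<^bsub>B\<^esub> (l \<odot>\<^bsub>B\<^esub> x)"
      using a by (simp add: quot_smult smult_assoc)
    show "1 \<odot>\<^bsub>B\<^esub> x = x" using a by (simp add: quot_smult)
    fix y assume "y \<in> carrier B"
    then obtain b where b: "b \<in> carrier C" "y = J +> b" using quot_carrierD by blast
    show "k \<odot>\<^bsub>B\<^esub> (y \<oplus>\<^bsub>B\<^esub> x) = k \<odot>\<^bsub>B\<^esub> y \<oplus>\<^bsub>B\<^esub> k \<odot>\<^bsub>B\<^esub> x"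
      using a b by (simp add: quot_smult quot_add smult_r_distr)
    show "(k \<odot>\<^bsub>B\<^esub> y) \<otimes>\<^bsub>B\<^esub> x = k \<odot>\<^bsub>B\<^esub> (y \<otimes>\<^bsub>B\<^esub> x)"
      using a b by (simp add: quot_smult quot_mult smult_mult_l)
    show "y \<otimes>\<^bsub>B\<^esub> (k \<odot>\<^bsub>B\<^esub> x) = k \<odot>\<^bsub>B\<^esub> (y \<otimes>\<^bsub>B\<^esub> x)"
      using a b by (simp add: quot_smult quot_mult smult_mult_r)
  qed
qed

text \<open>
  The embedding is \<open>l\<close> followed by a projection along the image of \<open>J\<close>. As the kernel of \<open>l\<close> only has to
  lie in \<open>J\<close>, this covers finite-dimensional quotients of algebras of infinite dimension.
\<close>

lemma fd_algebra_quot: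
  fixes l :: "'c \<Rightarrow> nat \<Rightarrow> 'k"
  assumes add: "\<And>b c. b \<in> carrier C \<Longrightarrow> c \<in> carrier C \<Longrightarrow> l (b \<oplus> c) = l b + l c"
    and smult: "\<And>k c. c \<in> carrier C \<Longrightarrow> l (k \<odot> c) = fun_scale k (l c)"
    and ker: "\<And>c. c \<in> carrier C \<Longrightarrow> l c = 0 \<Longrightarrow> c \<in> J"
    and span: "finite S" "l ` carrier C \<subseteq> fun_vs.span S"
  shows "\<exists>\<iota>. fd_algebra B \<iota>"
proof -
  have ld: "l (b \<ominus> c) = l b - l c" if "b \<in> carrier C" "c \<in> carrier C" for b c
  proof -
    have "l (b \<ominus> c \<oplus> c) = l (b \<ominus> c) + l c" using that by (intro add) auto
    moreover have "b \<ominus> c \<oplus> c = b" using that by (simp add: minus_eq a_assoc l_neg)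
    ultimately show ?thesis by simp
  qed
  have l0: "l \<zero> = 0" using smult[of \<zero> 0] by simp
  have sub: "fun_vs.subspace (l ` J)"
    unfolding fun_vs.subspace_def
  proof (intro conjI ballI allI)
    show "0 \<in> l ` J" using l0 J.zero_closed by (metis imageI)
    fix x assume "x \<in> l ` J"
    then obtain a where a: "x = l a" "a \<in> J" by (rule imageE)
    have "fun_scale k x = l (k \<odot> a)" for k using smult[OF J.Icarr[OF a(2)]] a(1) by simp
    then show "fun_scale k x \<in> l ` J" for k using ideal_smult_closed[OF J a(2), of k] by (metis imageI)
    fix y assume "y \<in> l ` J"
    then obtain b where b: "y = l b" "b \<in> J" by (rule imageE)
    have "x + y = l (a \<oplus> b)" using add[OF J.Icarr[OF a(2)] J.Icarr[OF b(2)]] a(1) b(1) by simp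
    then show "x + y \<in> l ` J" using J.a_closed[OF a(2) b(2)] by (metis imageI)
  qed
  then obtain \<rho> where \<rho>: "projection_along (l ` J) \<rho>" using projection_along_exists by blast
  note eq = projection_along_eq_iff[OF \<rho> sub]
  have \<rho>a: "\<rho> (v + w) = \<rho> v + \<rho> w" and \<rho>s: "\<rho> (fun_scale k v) = fun_scale k (\<rho> v)" for v w k
    using \<rho> by (auto simp: projection_along_def)
  define \<iota> where "\<iota> X = \<rho> (l (SOME x. x \<in> X))" for X
  have \<iota>: "\<iota> (J +> c) = \<rho> (l c)" if c: "c \<in> carrier C" for c
    unfolding \<iota>_def eq using quot_coset_some[OF c] c by (simp flip: ld)
  have "fd_algebra B \<iota>"
  proof (rule fd_algebra.intro[OF k_algebra_quot fd_algebra_axioms.intro])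
    show "\<iota> (b \<oplus>\<^bsub>B\<^esub> c) = \<iota> b + \<iota> c" if "b \<in> carrier B" "c \<in> carrier B" for b c
      using that by (auto dest!: quot_carrierD simp: quot_ops \<iota> add \<rho>a)
    show "\<iota> (k \<odot>\<^bsub>B\<^esub> c) = fun_scale k (\<iota> c)" if "c \<in> carrier B" for k c
      using that by (auto dest!: quot_carrierD simp: quot_ops \<iota> smult \<rho>s)
    show "inj_on \<iota> (carrier B)"
    proof (rule inj_onI)
      fix x y assume "x \<in> carrier B" "y \<in> carrier B" and xy: "\<iota> x = \<iota> y"
      then obtain a b where ab: "a \<in> carrier C" "b \<in> carrier C" "x = J +> a" "y = J +> b"
        by (auto dest!: quot_carrierD)
      with xy have "l a - l b \<in> l ` J" by (simp add: \<iota> eq)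
      then obtain j where j: "j \<in> J" "l (a \<ominus> b) = l j" using ab by (auto simp: ld)
      then have "l (a \<ominus> b \<ominus> j) = 0" using ab ld[of "a \<ominus> b" j] by (simp add: J.Icarr)
      then have "a \<ominus> b \<ominus> j \<in> J" using ab j by (intro ker) (auto simp: J.Icarr)
      then have "a \<ominus> b \<ominus> j \<oplus> j \<in> J" using j(1) by (rule J.a_closed)
      moreover have "a \<ominus> b \<ominus> j \<oplus> j = a \<ominus> b"
        using ab J.Icarr[OF j(1)] by (simp add: minus_eq a_assoc l_neg)
      ultimately show "x = y" using ab by (simp add: quot_coset_eq_iff)
    qed
    have sp: "\<rho> (l c) \<in> fun_vs.span S" if "c \<in> carrier C" for c
    proof -
      have "l c - \<rho> (l c) \<in> l ` J" using \<rho> by (simp add: projection_along_def)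
      then have "l c - \<rho> (l c) \<in> fun_vs.span S" using span(2) J.a_subset by blast
      moreover have "l c \<in> fun_vs.span S" using span(2) that by blast
      ultimately have "l c - (l c - \<rho> (l c)) \<in> fun_vs.span S" by (rule fun_vs.span_diff[rotated])
      then show ?thesis by simp
    qed
    have "\<iota> ` carrier B \<subseteq> fun_vs.span S"
      using sp by (auto dest!: quot_carrierD simp: \<iota>)
    with span(1) show "\<exists>S. finite S \<and> \<iota> ` carrier B \<subseteq> fun_vs.span S" by blast
  qed
  then show ?thesis by blast
qed

lemma quot_module_action:
  assumes N: "fd_module C N" and JN: "\<And>x. x \<in> J \<Longrightarrow> annihilates x N"
    and c: "c \<in> carrier C" and v: "v \<in> underlying N"
  shows "action (quot_module N) (J +> c) v = action N c v"
proof -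
  let ?x = "SOME x. x \<in> J +> c"
  have x: "?x \<in> carrier C" "?x \<ominus> c \<in> J" using quot_coset_some[OF c] by auto
  have "?x = (?x \<ominus> c) \<oplus> c" using x(1) c by (simp add: minus_eq a_assoc l_neg)
  then have "action N ?x v = action N (?x \<ominus> c) v + action N c v"
    using fdm_add_left[OF N _ c v, of "?x \<ominus> c"] x(1) c by (metis minus_closed)
  also have "action N (?x \<ominus> c) v = 0" using JN[OF x(2)] v by (simp add: annihilates_def)
  finally show ?thesis by (simp add: quot_module_def)
qed

lemma underlying_quot_module [simp]: "underlying (quot_module N) = underlying N"
  by (simp add: quot_module_def)

lemma fd_module_quot_module:
  assumes N: "fd_module C N" and JN: "\<And>x. x \<in> J \<Longrightarrow> annihilates x N"
  shows "fd_module B (quot_module N)"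
proof -
  note act = quot_module_action[OF N JN]
  show ?thesis
    unfolding fd_module_def underlying_quot_module
  proof (intro conjI ballI allI fdm_subspace[OF N] fdm_span[OF N])
    fix k v x assume v: "v \<in> underlying N"
    show "action (quot_module N) \<one>\<^bsub>B\<^esub> v = v" using v by (simp add: quot_one act fdm_one[OF N])
    assume "x \<in> carrier B"
    then obtain a where a: "a \<in> carrier C" "x = J +> a" using quot_carrierD by blast
    show "action (quot_module N) x v \<in> underlying N" using a v by (simp add: act fdm_closed[OF N])
    show "action (quot_module N) x (v + w) = action (quot_module N) x v + action (quot_module N) x w"
      if "w \<in> underlying N" for w
      using a v that by (simp add: act fdm_plus[OF N] fdm_add[OF N])
    show "action (quot_module N) x (fun_scale k v) = fun_scale k (action (quot_module N) x v)"
      using a v by (simp add: act fdm_fun_scale[OF N] fdm_scale[OF N])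
    show "action (quot_module N) (k \<odot>\<^bsub>B\<^esub> x) v = fun_scale k (action (quot_module N) x v)"
      using a v by (simp add: act quot_smult fdm_smult[OF N])
    fix y assume "y \<in> carrier B"
    then obtain b where b: "b \<in> carrier C" "y = J +> b" using quot_carrierD by blast
    show "action (quot_module N) (y \<oplus>\<^bsub>B\<^esub> x) v = action (quot_module N) y v + action (quot_module N) x v"
      using a b v by (simp add: act quot_add fdm_add_left[OF N])
    show "action (quot_module N) (y \<otimes>\<^bsub>B\<^esub> x) v = action (quot_module N) y (action (quot_module N) x v)"
      using a b v by (simp add: act quot_mult fdm_mult[OF N] fdm_closed[OF N])
  qed
qed

definition inflate :: "('c set, 'v) lmod \<Rightarrow> ('c, 'v) lmod" where
  "inflate R = \<lparr>underlying = underlying R, action = (\<lambda>c. action R (J +> c))\<rparr>"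

lemma underlying_inflate [simp]: "underlying (inflate R) = underlying R"
  by (simp add: inflate_def)

lemma action_inflate [simp]: "action (inflate R) c = action R (J +> c)"
  by (simp add: inflate_def)

lemma fd_module_inflate:
  assumes R: "fd_module B R"
  shows "fd_module C (inflate R)"
  unfolding fd_module_def underlying_inflate action_inflate
  using fdm_subspace[OF R] fdm_span[OF R]
  by (auto simp: quot_coset_mem fdm_closed[OF R] fdm_add[OF R] fdm_scale[OF R] fdm_add_left[OF R]
      fdm_smult[OF R] fdm_mult[OF R] fdm_one[OF R] simp flip: quot_ops)

lemma inflate_annihilated:
  assumes R: "fd_module B R" and x: "x \<in> J" and v: "v \<in> underlying R"
  shows "action R (J +> x) v = 0"
proof -
  have "J +> x = 0 \<odot>\<^bsub>B\<^esub> (J +> \<one>)"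
    using x by (simp add: quot_smult quot_coset_of_mem J.zero_closed)
  then show ?thesis using fdm_smult[OF R quot_coset_mem[OF one_closed] v, of 0] by simp
qed

lemma module_hom_inflate:
  "h \<in> module_hom B R R' \<longleftrightarrow> h \<in> module_hom C (inflate R) (inflate R')"
  by (auto simp: module_hom_def quot_carrier)

lemma submodule_inflate: "submodule_of B U R \<longleftrightarrow> submodule_of C U (inflate R)"
  by (auto simp: submodule_of_def quot_carrier)

lemma module_hom_inflate_quot_module:
  assumes N: "fd_module C N" and JN: "\<And>x. x \<in> J \<Longrightarrow> annihilates x N"
    and h: "h \<in> module_hom B R (quot_module N)"
  shows "h \<in> module_hom C (inflate R) N"
proof -
  have "action N c (h v) = h (action R (J +> c) v)" if "c \<in> carrier C" "v \<in> underlying R" for c v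
    using mh_act[OF h quot_coset_mem[OF that(1)] that(2)] mh_closed[OF h that(2)]
    by (simp add: quot_module_action[OF N JN that(1)])
  with h show ?thesis by (auto simp: module_hom_def)
qed

end

section \<open>Comparison of projective covers over an algebra and over its quotient by an idempotent ideal\<close>

\<comment> \<open>From here on, sums of vectors are not evaluated at points unless this is asked for.\<close>
declare plus_fun_apply [simp del] zero_fun_apply [simp del]

locale idempotent_quotient = fd_algebra C \<iota> + quotient_algebra C J B
  for C :: "('k::field, 'c) module" (structure) and \<iota> and J and B +
  fixes e :: 'c
  assumes e_closed: "e \<in> carrier C" and e_idem: "e \<otimes> e = e" and J_eq: "J = Idl {e}"
begin

lemma e_in_J: "e \<in> J"
  using genideal_self'[OF e_closed] by (simp add: J_eq)

lemma annihilated_by_J_iff: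
  assumes N: "fd_module C N"
  shows "(\<forall>x\<in>J. annihilates x N) \<longleftrightarrow> annihilates e N"
proof
  assume eN: "annihilates e N"
  have "annihilates x N" if "x \<in> Idl {e}" for x
    using that e_closed
  proof (induction rule: genideal_induct)
    case (add x y)
    then show ?case by (simp add: annihilates_def fdm_add_left[OF N])
  next
    case (left a x)
    then show ?case by (simp add: annihilates_def fdm_mult[OF N] fdm_act_0[OF N])
  next
    case (right a x)
    then show ?case by (simp add: annihilates_def fdm_mult[OF N] fdm_closed[OF N])
  qed (rule eN)
  then show "\<forall>x\<in>J. annihilates x N" by (simp add: J_eq)
qed (simp add: e_in_J)

text \<open>The submodule \<open>CeP = JP\<close> of a module \<open>P\<close>.\<close>

definition trace :: "('c, 'x \<Rightarrow> 'k) lmod \<Rightarrow> ('x \<Rightarrow> 'k) set" where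
  "trace P = fun_vs.span {action P b (action P e v) |b v. b \<in> carrier C \<and> v \<in> underlying P}"

lemma trace_base: "b \<in> carrier C \<Longrightarrow> v \<in> underlying P \<Longrightarrow> action P b (action P e v) \<in> trace P"
  unfolding trace_def by (rule fun_vs.span_base) blast

lemma trace_least:
  assumes "fun_vs.subspace U"
    and "\<And>b v. b \<in> carrier C \<Longrightarrow> v \<in> underlying P \<Longrightarrow> action P b (action P e v) \<in> U"
  shows "trace P \<subseteq> U"
  unfolding trace_def using assms by (intro fun_vs.span_minimal) auto

lemma submodule_trace:
  assumes P: "fd_module C P"
  shows "submodule_of C (trace P) P"
proof -
  have sub: "fun_vs.subspace (trace P)" unfolding trace_def by (rule fun_vs.subspace_span)
  have TP: "trace P \<subseteq> underlying P"
    by (rule trace_least[OF fdm_subspace[OF P]]) (simp add: fdm_closed[OF P] e_closed)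
  have "action P c u \<in> trace P" if c: "c \<in> carrier C" and u: "u \<in> trace P" for c u
  proof -
    let ?U = "{u \<in> underlying P. action P c u \<in> trace P}"
    have "fun_vs.subspace ?U"
      unfolding fun_vs.subspace_def
      using fdm_0[OF P] fdm_plus[OF P] fdm_fun_scale[OF P] fun_vs.subspace_0[OF sub]
        fun_vs.subspace_add[OF sub] fun_vs.subspace_scale[OF sub] c
      by (simp add: fdm_act_0[OF P] fdm_add[OF P] fdm_scale[OF P])
    then have "trace P \<subseteq> ?U"
    proof (rule trace_least)
      fix b v assume b: "b \<in> carrier C" and v: "v \<in> underlying P"
      have "action P c (action P b (action P e v)) = action P (c \<otimes> b) (action P e v)"
        using b v c by (simp add: fdm_mult[OF P] fdm_closed[OF P] e_closed)
      then show "action P b (action P e v) \<in> ?U"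
        using b c v trace_base[of "c \<otimes> b" v P] by (simp add: fdm_closed[OF P] e_closed)
    qed
    with u show ?thesis by blast
  qed
  with sub TP show ?thesis by (simp add: submodule_of_def)
qed

lemma J_action_in_trace:
  assumes P: "fd_module C P" and x: "x \<in> J" and v: "v \<in> underlying P"
  shows "action P x v \<in> trace P"
proof -
  note T = submodule_trace[OF P]
  have "\<forall>v\<in>underlying P. action P x v \<in> trace P" if "x \<in> Idl {e}" for x
    using that e_closed
  proof (induction rule: genideal_induct)
    case gen
    then show ?case using trace_base[OF one_closed, of _ P] by (simp add: fdm_one[OF P] fdm_closed[OF P] e_closed)
  next
    case (add x y)
    then show ?case by (simp add: fdm_add_left[OF P] fun_vs.subspace_add[OF submodule_subspace[OF T]])
  next
    case (left a x)
    then show ?case using T by (simp add: fdm_mult[OF P] submodule_of_def)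
  next
    case (right a x)
    then show ?case by (simp add: fdm_mult[OF P] fdm_closed[OF P])
  qed
  with x v show ?thesis by (simp add: J_eq)
qed

lemma hom_vanishes_on_trace:
  assumes P: "fd_module C P" and N: "fd_module C N" and h: "h \<in> module_hom C P N"
    and eN: "annihilates e N" and v: "v \<in> trace P"
  shows "h v = 0"
proof -
  have "trace P \<subseteq> hom_kernel P h"
  proof (rule trace_least[OF submodule_subspace[OF submodule_hom_kernel[OF P N h]]])
    fix b w assume b: "b \<in> carrier C" and w: "w \<in> underlying P"
    have "h (action P b (action P e w)) = action N b (action N e (h w))"
      using b w by (simp add: mh_act[OF h] fdm_closed[OF P] e_closed)
    also have "action N e (h w) = 0" using eN mh_closed[OF h w] by (simp add: annihilates_def)
    finally show "action P b (action P e w) \<in> hom_kernel P h"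
      using b w by (simp add: hom_kernel_def fdm_closed[OF P] e_closed fdm_act_0[OF N])
  qed
  with v show ?thesis by (auto simp: hom_kernel_def)
qed

lemma trace_onto:
  assumes P: "fd_module C P" and X: "fd_module C X" and p: "p \<in> module_hom C P X"
    and onto: "p ` underlying P = underlying X"
  shows "trace X \<subseteq> p ` trace P"
proof (rule trace_least[OF submodule_subspace[OF submodule_image[OF P X p submodule_trace[OF P]]]])
  fix b x assume b: "b \<in> carrier C" and "x \<in> underlying X"
  then have "x \<in> p ` underlying P" by (simp add: onto)
  then obtain v where v: "x = p v" "v \<in> underlying P" by (rule imageE)
  then have "action X b (action X e x) = p (action P b (action P e v))"
    using b by (simp add: mh_act[OF p] fdm_closed[OF P] e_closed)
  with trace_base[OF b v(2)] show "action X b (action X e x) \<in> p ` trace P" by (metis imageI)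
qed

text \<open>
  Let \<open>p : P \<rightarrow> X\<close> be a projective cover over \<open>C\<close>, let \<open>t : X \<rightarrow> W\<close> be a surjection to a
  \<open>C/J\<close>-module whose kernel lies in \<open>CeX\<close>, and let \<open>r : R \<rightarrow> W\<close> be a projective cover over \<open>C/J\<close>.
  Then \<open>R\<close> is \<open>P/CeP\<close>. A lift \<open>s : P \<rightarrow> R\<close> of \<open>t p\<close> is surjective because \<open>ker r\<close> is superfluous.
  It vanishes on \<open>CeP\<close>, and \<open>P/CeP \<rightarrow> R\<close> splits because \<open>R\<close> is projective over \<open>C/J\<close>. The preimage
  \<open>U\<close> in \<open>P\<close> of the image of the splitting satisfies \<open>U + ker s = P\<close>, and \<open>p\<close> maps \<open>ker s\<close> to
  \<open>CeX = p(CeP) \<subseteq> p(U)\<close>, so \<open>U + ker p = P\<close> and hence \<open>U = P\<close>. Thus the splitting is onto.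
\<close>

lemma cover_descends:
  fixes P :: "('c, nat \<Rightarrow> 'k) lmod" and R :: "('c set, nat \<Rightarrow> 'k) lmod"
    and X :: "('c, 'x \<Rightarrow> 'k) lmod" and W :: "('c, 'y \<Rightarrow> 'k) lmod"
  assumes P: "projective C P" and X: "fd_module C X" and p: "p \<in> module_hom C P X"
    and p_onto: "p ` underlying P = underlying X" and p_sup: "superfluous C (hom_kernel P p) P"
    and W: "fd_module C W" and t: "t \<in> module_hom C X W" and t_onto: "t ` underlying X = underlying W"
    and t_ker: "hom_kernel X t \<subseteq> trace X"
    and R: "projective B R" and r: "r \<in> module_hom C (inflate R) W"
    and r_onto: "r ` underlying R = underlying W" and r_sup: "superfluous B (hom_kernel R r) R"
  shows "\<exists>s\<in>module_hom C P (inflate R). s ` underlying P = underlying R \<and>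
    (\<forall>v\<in>underlying P. r (s v) = t (p v)) \<and> hom_kernel P s \<subseteq> trace P"
proof -
  have P': "fd_module C P" using P by (rule projectiveD)
  have R': "fd_module B R" using R by (rule projectiveD)
  have iR: "fd_module C (inflate R)" by (rule fd_module_inflate[OF R'])
  have tp: "cut_off (underlying P) (\<lambda>v. t (p v)) \<in> module_hom C P W"
    by (intro cut_off_module_hom P')
      (auto simp: mh_closed[OF t] mh_closed[OF p] mh_add[OF t] mh_add[OF p] mh_scale[OF t] mh_scale[OF p]
        mh_act[OF t] mh_act[OF p])
  have im: "cut_off (underlying P) (\<lambda>v. t (p v)) ` underlying P \<subseteq> r ` underlying (inflate R)"
    using mh_closed[OF t] mh_closed[OF p] by (auto simp: r_onto)
  obtain s where s: "s \<in> module_hom C P (inflate R)"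
      "\<forall>v\<in>underlying P. r (s v) = cut_off (underlying P) (\<lambda>v. t (p v)) v"
    using projective_lift[OF k_algebra_axioms P iR W r tp im] by blast
  have rs: "r (s v) = t (p v)" if "v \<in> underlying P" for v using s(2) that by simp
  have sR: "s v \<in> underlying R" if "v \<in> underlying P" for v using mh_closed[OF s(1) that] by simp

  have "submodule_of B (s ` underlying P) R"
    using submodule_image[OF P' iR s(1) submodule_all[OF P']] by (simp add: submodule_inflate)
  moreover have "{l + u |l u. l \<in> hom_kernel R r \<and> u \<in> s ` underlying P} = underlying R" (is "?L = _")
  proof
    show "?L \<subseteq> underlying R" using sR fdm_plus[OF R'] by (auto simp: hom_kernel_def)
    show "underlying R \<subseteq> ?L"
    proof
      fix w assume w: "w \<in> underlying R"
      have "r w \<in> t ` p ` underlying P" using w r_onto t_onto p_onto by blast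
      then obtain v where v: "v \<in> underlying P" "r w = t (p v)" by blast
      then have "r (w - s v) = 0" using w sR[OF v(1)] rs[OF v(1)] by (simp add: mh_diff[OF iR r])
      then have "w - s v \<in> hom_kernel R r"
        using fdm_minus[OF R' w sR[OF v(1)]] by (simp add: hom_kernel_def)
      moreover have "w = (w - s v) + s v" by simp
      ultimately show "w \<in> ?L" using v(1) by blast
    qed
  qed
  ultimately have s_onto: "s ` underlying P = underlying R"
    using r_sup unfolding superfluous_def by blast

  have eR: "annihilates e (inflate R)"
    using inflate_annihilated[OF R' e_in_J] by (simp add: annihilates_def)
  note T = submodule_trace[OF P']
  have sT: "s v = 0" if "v \<in> trace P" for v by (rule hom_vanishes_on_trace[OF P' iR s(1) eR that])
  obtain \<rho> where \<rho>: "projection_along (trace P) \<rho>"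
    using projection_along_exists submodule_subspace[OF T] by blast
  note Q = k_algebra_axioms P' T \<rho>
  have \<rho>a: "\<rho> (v + w) = \<rho> v + \<rho> w" and \<rho>s: "\<rho> (fun_scale k v) = fun_scale k (\<rho> v)"
    and \<rho>d: "v - \<rho> v \<in> trace P" and \<rho>0: "v \<in> trace P \<Longrightarrow> \<rho> v = 0" for v w k
    using \<rho> by (auto simp: projection_along_def)
  let ?Q = "quot_by \<rho> P"
  have fQ: "fd_module C ?Q" by (rule fd_module_quot_by[OF Q])
  have QP: "w \<in> underlying P" if "w \<in> underlying ?Q" for w
    using that quot_by_mem[OF Q] by (auto simp: quot_by_underlying[OF Q])
  have s\<rho>: "s (\<rho> v) = s v" if v: "v \<in> underlying P" for v
    using mh_diff[OF P' s(1) v quot_by_mem[OF Q v]] sT[OF \<rho>d[of v]] by simp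
  have "annihilates e ?Q"
    using J_action_in_trace[OF P' e_in_J]
    by (auto simp: annihilates_def quot_by_underlying[OF Q] quot_by_action[OF Q e_closed] \<rho>0)
  then have JQ: "annihilates x ?Q" if "x \<in> J" for x
    using annihilated_by_J_iff[OF fQ] that by blast
  have fBQ: "fd_module B (quot_module ?Q)" by (rule fd_module_quot_module[OF fQ JQ])
  let ?s = "cut_off (underlying ?Q) s"
  have s'C: "?s \<in> module_hom C ?Q (inflate R)"
  proof (rule cut_off_module_hom[OF fQ])
    fix v c assume v: "v \<in> underlying ?Q" and c: "c \<in> carrier C"
    obtain w where w: "w \<in> underlying P" "v = \<rho> w" using v by (auto simp: quot_by_underlying[OF Q])
    show "s (action ?Q c v) = action (inflate R) c (s v)"
      using w c by (simp add: quot_by_action[OF Q] s\<rho> fdm_closed[OF P'] mh_act[OF s(1)] del: action_inflate)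
  qed (use QP in \<open>simp_all add: sR mh_add[OF s(1)] mh_scale[OF s(1)]\<close>)
  have s'B: "?s \<in> module_hom B (quot_module ?Q) R"
  proof -
    have "?s (action (quot_module ?Q) (J +> c) v) = action R (J +> c) (?s v)"
      if "c \<in> carrier C" "v \<in> underlying ?Q" for c v
      using mh_act[OF s'C that] by (simp add: quot_module_action[OF fQ JQ that])
    with s'C show ?thesis by (auto simp: module_hom_def quot_carrier)
  qed
  have idR: "cut_off (underlying R) (\<lambda>v. v) \<in> module_hom B R R"
    by (rule cut_off_module_hom[OF R']) simp_all
  have "cut_off (underlying R) (\<lambda>v. v) ` underlying R \<subseteq> ?s ` underlying (quot_module ?Q)"
  proof
    fix w assume "w \<in> cut_off (underlying R) (\<lambda>v. v) ` underlying R"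
    then have "w \<in> s ` underlying P" using s_onto by auto
    then obtain v where v: "v \<in> underlying P" "w = s v" by blast
    then have "w = ?s (\<rho> v)" by (simp add: quot_by_underlying[OF Q] s\<rho>)
    with v(1) show "w \<in> ?s ` underlying (quot_module ?Q)" by (simp add: quot_by_underlying[OF Q])
  qed
  from projective_lift[OF k_algebra_quot R fBQ R' s'B idR this]
  obtain \<sigma> where \<sigma>: "\<sigma> \<in> module_hom B R (quot_module ?Q)"
      "\<forall>v\<in>underlying R. ?s (\<sigma> v) = cut_off (underlying R) (\<lambda>v. v) v"
    by blast
  have \<sigma>Q: "\<sigma> v \<in> underlying ?Q" if "v \<in> underlying R" for v
    using mh_closed[OF \<sigma>(1) that] by simp
  have s\<sigma>: "s (\<sigma> v) = v" if "v \<in> underlying R" for v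
    using \<sigma>(2) that cut_off_in[OF \<sigma>Q[OF that], of s] by auto
  have \<sigma>C: "\<sigma> \<in> module_hom C (inflate R) ?Q"
    by (rule module_hom_inflate_quot_module[OF fQ JQ \<sigma>(1)])

  define U where "U = {v \<in> underlying P. \<rho> v \<in> \<sigma> ` underlying R}"
  have I: "submodule_of C (\<sigma> ` underlying R) ?Q"
    using submodule_image[OF iR fQ \<sigma>C submodule_all[OF iR]] by simp
  have U: "submodule_of C U P"
    unfolding submodule_of_def
  proof (intro conjI ballI)
    note Is = submodule_subspace[OF I]
    have "\<rho> 0 = 0" using \<rho>s[of 0 0] by simp
    then show "fun_vs.subspace U"
      unfolding fun_vs.subspace_def U_def
      using fdm_0[OF P'] fdm_plus[OF P'] fdm_fun_scale[OF P'] fun_vs.subspace_0[OF Is]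
        fun_vs.subspace_add[OF Is] fun_vs.subspace_scale[OF Is]
      by (simp add: \<rho>a \<rho>s)
    show "action P c u \<in> U" if "c \<in> carrier C" "u \<in> U" for c u
    proof -
      have u: "u \<in> underlying P" "\<rho> u \<in> \<sigma> ` underlying R" using that(2) by (auto simp: U_def)
      have "\<rho> (action P c u) = action ?Q c (\<rho> u)" using quot_by_action[OF Q that(1) u(1)] ..
      also have "\<dots> \<in> \<sigma> ` underlying R" using I that(1) u(2) unfolding submodule_of_def by blast
      finally show ?thesis using that(1) u(1) by (simp add: U_def fdm_closed[OF P'])
    qed
  qed (simp add: U_def)
  have TU: "trace P \<subseteq> U"
    using T fun_vs.subspace_0[OF submodule_subspace[OF I]] by (auto simp: U_def \<rho>0 submodule_of_def)
  have split: "\<exists>u\<in>U. s (v - u) = 0" if v: "v \<in> underlying P" for v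
  proof -
    have "\<sigma> (s v) \<in> underlying ?Q" by (rule \<sigma>Q[OF sR[OF v]])
    moreover have "\<rho> (\<sigma> (s v)) = \<sigma> (s v)"
      using calculation projection_along_idem[OF \<rho>] by (auto simp: quot_by_underlying[OF Q])
    ultimately have "\<sigma> (s v) \<in> U" using QP sR[OF v] by (simp add: U_def)
    moreover have "s (v - \<sigma> (s v)) = 0"
      using v QP[OF \<sigma>Q[OF sR[OF v]]] by (simp add: mh_diff[OF P' s(1)] s\<sigma>[OF sR[OF v]])
    ultimately show ?thesis by blast
  qed
  have "{l + u |l u. l \<in> hom_kernel P p \<and> u \<in> U} = underlying P" (is "?L = _")
  proof
    have UP: "U \<subseteq> underlying P" by (auto simp: U_def)
    show "?L \<subseteq> underlying P" using UP fdm_plus[OF P'] by (auto simp: hom_kernel_def)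
    show "underlying P \<subseteq> ?L"
    proof
      fix v assume v: "v \<in> underlying P"
      obtain u where u: "u \<in> U" "s (v - u) = 0" using split[OF v] by blast
      have vu: "v - u \<in> underlying P" using v u(1) UP by (intro fdm_minus[OF P']) auto
      have "t (p (v - u)) = 0" using rs[OF vu] u(2) mh_0[OF iR r] by simp
      then have "p (v - u) \<in> trace X"
        using t_ker mh_closed[OF p vu] by (auto simp: hom_kernel_def)
      then have "p (v - u) \<in> p ` trace P" using trace_onto[OF P' X p p_onto] by blast
      then obtain w where w: "w \<in> trace P" "p (v - u) = p w" by blast
      then have wU: "w \<in> U" "w \<in> underlying P" using TU UP by auto
      have "u + w \<in> U" by (rule fun_vs.subspace_add[OF submodule_subspace[OF U] u(1) wU(1)])
      moreover have "v - u - w \<in> hom_kernel P p"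
        using w(2) vu wU(2) fdm_minus[OF P' vu wU(2)] by (simp add: hom_kernel_def mh_diff[OF P' p])
      moreover have "v = (v - u - w) + (u + w)" by simp
      ultimately show "v \<in> ?L" by blast
    qed
  qed
  with U p_sup have UP: "U = underlying P" unfolding superfluous_def by blast
  have "hom_kernel P s \<subseteq> trace P"
  proof
    fix v assume "v \<in> hom_kernel P s"
    then have v: "v \<in> underlying P" "s v = 0" by (auto simp: hom_kernel_def)
    then have "\<rho> v \<in> \<sigma> ` underlying R" using UP by (auto simp: U_def)
    then obtain w where w: "w \<in> underlying R" "\<rho> v = \<sigma> w" by blast
    have "w = 0" using s\<sigma>[OF w(1)] w(2) s\<rho>[OF v(1)] v(2) by simp
    then have "\<rho> v = 0" using w(2) mh_0[OF iR \<sigma>C] by simp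
    with \<rho>d[of v] show "v \<in> trace P" by simp
  qed
  with s(1) s_onto rs show ?thesis by blast
qed

end

section \<open>Comparison of the Auslander-Reiten translations\<close>

lemma nakayama_iff:
  "\<xi> \<in> underlying (nakayama C P) \<longleftrightarrow> (\<forall>f. f \<notin> hom_to_algebra C P \<longrightarrow> \<xi> f = 0) \<and>
     (\<forall>f\<in>hom_to_algebra C P. \<forall>g\<in>hom_to_algebra C P.
        \<xi> (\<lambda>v\<in>underlying P. f v \<oplus>\<^bsub>C\<^esub> g v) = \<xi> f + \<xi> g) \<and>
     (\<forall>k. \<forall>f\<in>hom_to_algebra C P. \<xi> (\<lambda>v\<in>underlying P. k \<odot>\<^bsub>C\<^esub> f v) = k * \<xi> f)"
  by (simp only: nakayama_def lmod.simps mem_Collect_eq)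

lemma nakayamaD:
  assumes "\<xi> \<in> underlying (nakayama C P)"
  shows nak_outside: "f \<notin> hom_to_algebra C P \<Longrightarrow> \<xi> f = 0"
    and nak_add: "f \<in> hom_to_algebra C P \<Longrightarrow> g \<in> hom_to_algebra C P \<Longrightarrow>
      \<xi> (\<lambda>v\<in>underlying P. f v \<oplus>\<^bsub>C\<^esub> g v) = \<xi> f + \<xi> g"
    and nak_scale: "f \<in> hom_to_algebra C P \<Longrightarrow> \<xi> (\<lambda>v\<in>underlying P. k \<odot>\<^bsub>C\<^esub> f v) = k * \<xi> f"
proof -
  note D = nakayama_iff[THEN iffD1, OF assms]
  show "f \<notin> hom_to_algebra C P \<Longrightarrow> \<xi> f = 0"
    by (rule D[THEN conjunct1, rule_format])
  show "f \<in> hom_to_algebra C P \<Longrightarrow> g \<in> hom_to_algebra C P \<Longrightarrow>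
      \<xi> (\<lambda>v\<in>underlying P. f v \<oplus>\<^bsub>C\<^esub> g v) = \<xi> f + \<xi> g"
    by (rule D[THEN conjunct2, THEN conjunct1, rule_format])
  show "f \<in> hom_to_algebra C P \<Longrightarrow> \<xi> (\<lambda>v\<in>underlying P. k \<odot>\<^bsub>C\<^esub> f v) = k * \<xi> f"
    by (rule D[THEN conjunct2, THEN conjunct2, rule_format])
qed

text \<open>
  With \<open>R = P/CeP\<close>, a homomorphism \<open>P \<rightarrow> C\<close> induces a homomorphism \<open>R \<rightarrow> C/J\<close>.
\<close>

locale projective_descent = idempotent_quotient C \<iota> J B e
  for C :: "('k::field, 'c) module" (structure) and \<iota> and J and B and e +
  fixes P :: "('c, nat \<Rightarrow> 'k) lmod" and R :: "('c set, nat \<Rightarrow> 'k) lmod" and s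
  assumes P: "projective C P" and R: "fd_module B R" and s: "s \<in> module_hom C P (inflate R)"
    and s_onto: "s ` underlying P = underlying R" and s_ker: "hom_kernel P s \<subseteq> trace P"
begin

lemma P': "fd_module C P" using P by (rule projectiveD)

lemma s_mem: "v \<in> underlying P \<Longrightarrow> s v \<in> underlying R"
  using mh_closed[OF s] by simp

lemma s_cases: "w \<in> underlying R \<Longrightarrow> \<exists>v\<in>underlying P. w = s v"
  using s_onto by (metis imageE)

definition descend :: "((nat \<Rightarrow> 'k) \<Rightarrow> 'c) \<Rightarrow> (nat \<Rightarrow> 'k) \<Rightarrow> 'c set" where
  "descend f = (\<lambda>w\<in>underlying R. J +> f (SOME v. v \<in> underlying P \<and> s v = w))"

lemma hom_maps_trace_to_J:
  assumes f: "f \<in> hom_to_algebra C P" and v: "v \<in> trace P"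
  shows "f v \<in> J"
proof -
  let ?U = "{v \<in> underlying P. f v \<in> J}"
  have "f 0 = \<zero>" using ha_scale[OF f fdm_0[OF P'], of 0] ha_closed[OF f fdm_0[OF P']] by simp
  then have "fun_vs.subspace ?U"
    unfolding fun_vs.subspace_def
    by (simp add: fdm_0[OF P'] fdm_plus[OF P'] fdm_fun_scale[OF P'] ha_add[OF f] ha_scale[OF f]
        J.zero_closed J.a_closed ideal_smult_closed[OF J])
  then have "trace P \<subseteq> ?U"
  proof (rule trace_least)
    fix b w assume b: "b \<in> carrier C" and w: "w \<in> underlying P"
    have "e \<otimes> f w \<in> J" using e_in_J ha_closed[OF f w] by (rule J.I_r_closed)
    then have "b \<otimes> (e \<otimes> f w) \<in> J" using b by (rule J.I_l_closed)
    then show "action P b (action P e w) \<in> ?U"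
      using b w e_closed by (simp add: ha_act[OF f] fdm_closed[OF P'])
  qed
  with v show ?thesis by blast
qed

lemma descend_apply:
  assumes f: "f \<in> hom_to_algebra C P" and v: "v \<in> underlying P"
  shows "descend f (s v) = J +> f v"
proof -
  let ?u = "SOME u. u \<in> underlying P \<and> s u = s v"
  have u: "?u \<in> underlying P \<and> s ?u = s v" by (rule someI[of _ v]) (simp add: v)
  have "s (?u - v) = 0" using u v by (simp add: mh_diff[OF P' s])
  then have "?u - v \<in> trace P"
    using s_ker u v fdm_minus[OF P'] by (auto simp: hom_kernel_def)
  then have "f (?u - v) \<in> J" by (rule hom_maps_trace_to_J[OF f])
  moreover have "f (?u - v) = f ?u \<ominus> f v"
  proof -
    have uv: "?u - v \<in> underlying P" using u v by (intro fdm_minus[OF P']) auto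
    have "f (?u - v + v) = f (?u - v) \<oplus> f v" by (rule ha_add[OF f uv v])
    then show ?thesis
      using ha_closed[OF f uv] ha_closed[OF f v] by (simp add: minus_eq a_assoc r_neg)
  qed
  ultimately have "J +> f ?u = J +> f v"
    using u ha_closed[OF f] v by (simp add: quot_coset_eq_iff)
  then show ?thesis using s_mem[OF v] by (simp add: descend_def)
qed

lemma hom_B_eqI:
  assumes "g \<in> hom_to_algebra B R" "g' \<in> hom_to_algebra B R"
    and "\<And>v. v \<in> underlying P \<Longrightarrow> g (s v) = g' (s v)"
  shows "g = g'"
proof (rule extensionalityI[of _ "underlying R"])
  show "g \<in> extensional (underlying R)" "g' \<in> extensional (underlying R)"
    using assms(1,2) by (auto simp: hom_to_algebra_def PiE_def)
  show "g w = g' w" if "w \<in> underlying R" for w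
    using s_cases[OF that] assms(3) by blast
qed

lemma descend_mem:
  assumes f: "f \<in> hom_to_algebra C P"
  shows "descend f \<in> hom_to_algebra B R"
proof -
  have "(\<lambda>w\<in>underlying R. descend f w) \<in> hom_to_algebra B R"
  proof (rule hom_to_algebraI[OF R])
    fix w assume "w \<in> underlying R"
    then obtain v where v: "v \<in> underlying P" "w = s v" using s_cases by blast
    show "descend f w \<in> carrier B"
      using v by (simp add: descend_apply[OF f] quot_coset_mem ha_closed[OF f])
    show "descend f (fun_scale k w) = k \<odot>\<^bsub>B\<^esub> descend f w" for k
      using v descend_apply[OF f fdm_fun_scale[OF P' v(1)], of k] mh_scale[OF s v(1)]
      by (simp add: descend_apply[OF f] ha_scale[OF f] quot_smult ha_closed[OF f])
    show "descend f (action R x w) = x \<otimes>\<^bsub>B\<^esub> descend f w" if x: "x \<in> carrier B" for x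
    proof -
      obtain c where c: "c \<in> carrier C" "x = J +> c" using quot_carrierD[OF x] by blast
      have "action R x w = s (action P c v)" using mh_act[OF s c(1) v(1)] v c by simp
      then show ?thesis
        using v c by (simp add: descend_apply[OF f] fdm_closed[OF P'] ha_act[OF f] quot_mult ha_closed[OF f])
    qed
    fix w' assume "w' \<in> underlying R"
    then obtain v' where v': "v' \<in> underlying P" "w' = s v'" using s_cases by blast
    have "descend f (s (v + v')) = J +> f (v + v')"
      using v v' by (intro descend_apply[OF f] fdm_plus[OF P'])
    then show "descend f (w + w') = descend f w \<oplus>\<^bsub>B\<^esub> descend f w'"
      using v v' by (simp add: mh_add[OF s] descend_apply[OF f] ha_add[OF f] quot_add ha_closed[OF f])
  qed
  moreover have "(\<lambda>w\<in>underlying R. descend f w) = descend f" by (auto simp: descend_def fun_eq_iff)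
  ultimately show ?thesis by simp
qed

lemma descend_onto:
  assumes g: "g \<in> hom_to_algebra B R"
  shows "\<exists>f\<in>hom_to_algebra C P. descend f = g"
proof -
  have "\<exists>c. c \<in> carrier C \<and> J +> c = g (s v)" if "v \<in> underlying P" for v
    using quot_carrierD[OF ha_closed[OF g s_mem[OF that]]] by blast
  then obtain F where FC: "\<And>v. v \<in> underlying P \<Longrightarrow> F v \<in> carrier C"
    and Fg: "\<And>v. v \<in> underlying P \<Longrightarrow> J +> F v = g (s v)"
    by metis
  have "\<exists>f\<in>hom_to_algebra C P. \<forall>v\<in>underlying P. f v \<ominus> F v \<in> J"
  proof (rule projective_lift_to_algebra[OF P J])
    fix v assume v: "v \<in> underlying P"
    show "F v \<in> carrier C" by (rule FC[OF v])
    show "F (fun_scale k v) \<ominus> k \<odot> F v \<in> J" for k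
    proof -
      have kv: "fun_scale k v \<in> underlying P" by (rule fdm_fun_scale[OF P' v])
      have "J +> F (fun_scale k v) = J +> (k \<odot> F v)"
        using ha_scale[OF g s_mem[OF v], of k]
        by (simp add: Fg[OF kv] Fg[OF v] mh_scale[OF s v] quot_smult[OF FC[OF v], symmetric])
      then show ?thesis using FC[OF kv] FC[OF v] by (simp add: quot_coset_eq_iff)
    qed
    show "F (action P c v) \<ominus> c \<otimes> F v \<in> J" if c: "c \<in> carrier C" for c
    proof -
      have cv: "action P c v \<in> underlying P" by (rule fdm_closed[OF P' c v])
      have "J +> F (action P c v) = J +> (c \<otimes> F v)"
        using ha_act[OF g quot_coset_mem[OF c] s_mem[OF v]]
        by (simp add: Fg[OF cv] Fg[OF v] mh_act[OF s c v] quot_mult[OF c FC[OF v], symmetric])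
      then show ?thesis using FC[OF cv] FC[OF v] c by (simp add: quot_coset_eq_iff)
    qed
    fix w assume w: "w \<in> underlying P"
    have vw: "v + w \<in> underlying P" by (rule fdm_plus[OF P' v w])
    have "J +> F (v + w) = J +> (F v \<oplus> F w)"
      using ha_add[OF g s_mem[OF v] s_mem[OF w]]
      by (simp add: Fg[OF vw] Fg[OF v] Fg[OF w] mh_add[OF s v w] quot_add[OF FC[OF v] FC[OF w], symmetric])
    then show "F (v + w) \<ominus> (F v \<oplus> F w) \<in> J"
      using FC[OF vw] FC[OF v] FC[OF w] by (simp add: quot_coset_eq_iff)
  qed
  then obtain f where f: "f \<in> hom_to_algebra C P" "\<forall>v\<in>underlying P. f v \<ominus> F v \<in> J" by blast
  have "descend f (s v) = g (s v)" if v: "v \<in> underlying P" for v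
    using f(2) v FC[OF v] ha_closed[OF f(1) v] by (simp add: descend_apply[OF f(1)] quot_coset_eq_iff flip: Fg)
  then have "descend f = g" by (rule hom_B_eqI[OF descend_mem[OF f(1)] g])
  with f(1) show ?thesis by blast
qed

abbreviation "plus_C f g \<equiv> \<lambda>v\<in>underlying P. f v \<oplus> g v"
abbreviation "scale_C k f \<equiv> \<lambda>v\<in>underlying P. k \<odot> f v"
abbreviation "mult_C f c \<equiv> \<lambda>v\<in>underlying P. f v \<otimes> c"
abbreviation "plus_B f g \<equiv> \<lambda>w\<in>underlying R. f w \<oplus>\<^bsub>B\<^esub> g w"
abbreviation "scale_B k f \<equiv> \<lambda>w\<in>underlying R. k \<odot>\<^bsub>B\<^esub> f w"
abbreviation "mult_B f c \<equiv> \<lambda>w\<in>underlying R. f w \<otimes>\<^bsub>B\<^esub> c"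

lemma smult_commute: "c \<in> carrier C \<Longrightarrow> k \<odot> (l \<odot> c) = l \<odot> (k \<odot> c)"
  by (simp add: mult.commute flip: smult_assoc)

lemma hom_C_closed:
  assumes f: "f \<in> hom_to_algebra C P"
  shows "g \<in> hom_to_algebra C P \<Longrightarrow> plus_C f g \<in> hom_to_algebra C P"
    and "scale_C k f \<in> hom_to_algebra C P"
    and "c \<in> carrier C \<Longrightarrow> mult_C f c \<in> hom_to_algebra C P"
proof -
  note F = ha_closed[OF f] ha_add[OF f] ha_scale[OF f] ha_act[OF f]
  show "plus_C f g \<in> hom_to_algebra C P" if g: "g \<in> hom_to_algebra C P"
    by (rule hom_to_algebraI[OF P'])
      (simp_all add: F ha_closed[OF g] ha_add[OF g] ha_scale[OF g] ha_act[OF g] a_ac r_distr smult_r_distr)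
  show "scale_C k f \<in> hom_to_algebra C P"
    by (rule hom_to_algebraI[OF P'])
      (simp_all add: F smult_r_distr smult_mult_r smult_commute[of _ k])
  show "mult_C f c \<in> hom_to_algebra C P" if "c \<in> carrier C"
    by (rule hom_to_algebraI[OF P']) (simp_all add: F that l_distr smult_mult_l m_assoc)
qed

lemma descend_ops:
  assumes f: "f \<in> hom_to_algebra C P"
  shows "g \<in> hom_to_algebra C P \<Longrightarrow> descend (plus_C f g) = plus_B (descend f) (descend g)"
    and "descend (scale_C k f) = scale_B k (descend f)"
    and "c \<in> carrier C \<Longrightarrow> descend (mult_C f c) = mult_B (descend f) (J +> c)"
proof -
  have eq: "descend h = (\<lambda>w\<in>underlying R. H w)"
    if h: "h \<in> hom_to_algebra C P" and H: "\<And>v. v \<in> underlying P \<Longrightarrow> J +> h v = H (s v)" for h H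
  proof (rule extensionalityI[of _ "underlying R"])
    show "descend h \<in> extensional (underlying R)" by (simp add: descend_def)
    fix w assume w: "w \<in> underlying R"
    obtain v where v: "v \<in> underlying P" "w = s v" using s_cases[OF w] by blast
    have "descend h w = H w" unfolding v(2) descend_apply[OF h v(1)] by (rule H[OF v(1)])
    with w show "descend h w = (\<lambda>w\<in>underlying R. H w) w" by simp
  qed simp
  show "descend (plus_C f g) = plus_B (descend f) (descend g)" if g: "g \<in> hom_to_algebra C P"
    by (rule eq[OF hom_C_closed(1)[OF f g]])
      (simp add: descend_apply[OF f] descend_apply[OF g] quot_add ha_closed[OF f] ha_closed[OF g])
  show "descend (scale_C k f) = scale_B k (descend f)"
    by (rule eq[OF hom_C_closed(2)[OF f]]) (simp add: descend_apply[OF f] quot_smult ha_closed[OF f])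
  show "descend (mult_C f c) = mult_B (descend f) (J +> c)" if c: "c \<in> carrier C"
    by (rule eq[OF hom_C_closed(3)[OF f c]]) (simp add: descend_apply[OF f] quot_mult ha_closed[OF f] c)
qed

text \<open>
  A functional on \<open>Hom(P, C)\<close> that is annihilated by \<open>eC\<close> vanishes on the homomorphisms to \<open>J\<close>,
  because these are sums of homomorphisms \<open>g eb\<close>.
\<close>

lemma functional_vanishes_on_J:
  assumes \<xi>: "\<xi> \<in> underlying (nakayama C P)"
    and ann: "\<And>b f. b \<in> carrier C \<Longrightarrow> f \<in> hom_to_algebra C P \<Longrightarrow> \<xi> (mult_C f (e \<otimes> b)) = 0"
    and f: "f \<in> hom_to_algebra C P" and fJ: "\<And>v. v \<in> underlying P \<Longrightarrow> f v \<in> J"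
  shows "\<xi> f = 0"
proof -
  have "\<And>v. v \<in> underlying P \<Longrightarrow> f v \<in> Idl {e}" using fJ by (simp add: J_eq)
  from hom_into_genideal[OF P e_closed f this]
  obtain m :: nat and b g where b: "\<And>i. b i \<in> carrier C" and g: "\<And>i. g i \<in> hom_to_algebra C P"
    and fg: "\<And>v. v \<in> underlying P \<Longrightarrow> f v = (\<Oplus>i\<in>{..<m}. g i v \<otimes> (e \<otimes> b i))"
    by blast
  let ?s = "\<lambda>l. \<lambda>v\<in>underlying P. \<Oplus>i\<in>{..<l}. g i v \<otimes> (e \<otimes> b i)"
  have eb: "e \<otimes> b i \<in> carrier C" for i using b e_closed by simp
  have S: "?s l \<in> hom_to_algebra C P \<and> \<xi> (?s l) = 0" for l :: nat
  proof (induction l)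
    case 0
    have "?s 0 = scale_C 0 f" by (rule restrict_ext) (simp add: ha_closed[OF f])
    then show ?case using hom_C_closed(2)[OF f, of 0] nak_scale[OF \<xi> f, of 0] by (simp only: mult_zero_left simp_thms)
  next
    case (Suc l)
    let ?g = "mult_C (g l) (e \<otimes> b l)"
    have g': "?g \<in> hom_to_algebra C P" by (rule hom_C_closed(3)[OF g eb])
    have "?s (Suc l) = plus_C ?g (?s l)"
      using ha_closed[OF g] eb by (intro restrict_ext) (simp add: lessThan_Suc finsum_insert)
    moreover have "?s l \<in> hom_to_algebra C P" "\<xi> (?s l) = 0" using Suc by blast+
    ultimately show ?case
      using hom_C_closed(1)[OF g', of "?s l"] nak_add[OF \<xi> g', of "?s l"] ann[OF b g, of l l]
      by (simp only: add_0 simp_thms)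
  qed
  have "f = ?s m"
  proof (rule extensionalityI[of _ "underlying P"])
    show "f \<in> extensional (underlying P)" using f by (auto simp: hom_to_algebra_def PiE_def)
  qed (simp_all add: fg)
  then have "\<xi> f = \<xi> (?s m)" by (rule arg_cong)
  also have "\<dots> = 0" by (rule conjunct2[OF S])
  finally show ?thesis .
qed

lemma functional_determined:
  assumes \<xi>: "\<xi> \<in> underlying (nakayama C P)"
    and ann: "\<And>b f. b \<in> carrier C \<Longrightarrow> f \<in> hom_to_algebra C P \<Longrightarrow> \<xi> (mult_C f (e \<otimes> b)) = 0"
    and f: "f \<in> hom_to_algebra C P" and g: "g \<in> hom_to_algebra C P" and eq: "descend f = descend g"
  shows "\<xi> f = \<xi> g"
proof -
  let ?d = "plus_C f (scale_C (- 1) g)"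
  have sg: "scale_C (- 1) g \<in> hom_to_algebra C P" by (rule hom_C_closed(2)[OF g])
  have d: "?d \<in> hom_to_algebra C P" by (rule hom_C_closed(1)[OF f sg])
  have dJ: "?d v \<in> J" if v: "v \<in> underlying P" for v
  proof -
    have "J +> f v = J +> g v"
      using descend_apply[OF f v] descend_apply[OF g v] eq by simp
    then have "f v \<ominus> g v \<in> J" using ha_closed[OF f v] ha_closed[OF g v] by (simp add: quot_coset_eq_iff)
    then show ?thesis using v ha_closed[OF g v] by (simp add: smult_minus_one minus_eq)
  qed
  have "\<xi> ?d = 0" by (rule functional_vanishes_on_J[OF \<xi> _ d]) (erule (1) ann, erule dJ)
  moreover have "\<xi> ?d = \<xi> f + (- 1) * \<xi> g"
    using nak_add[OF \<xi> f sg] nak_scale[OF \<xi> g, of "- 1"] by (simp only:)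
  ultimately show ?thesis by simp
qed

end

context projective_descent
begin

text \<open>The embedding \<open>D Hom(R, C/J) \<rightarrow> D Hom(P, C)\<close> dual to \<^const>\<open>descend\<close>.\<close>

definition pull :: "(((nat \<Rightarrow> 'k) \<Rightarrow> 'c set) \<Rightarrow> 'k) \<Rightarrow> ((nat \<Rightarrow> 'k) \<Rightarrow> 'c) \<Rightarrow> 'k" where
  "pull \<xi> = (\<lambda>f. if f \<in> hom_to_algebra C P then \<xi> (descend f) else 0)"

lemma pull_add: "pull (\<xi> + \<zeta>) = pull \<xi> + pull \<zeta>"
  by (rule ext) (simp add: pull_def plus_fun_apply)

lemma pull_scale: "pull (fun_scale k \<xi>) = fun_scale k (pull \<xi>)"
  by (rule ext) (simp add: pull_def fun_scale_def)

lemma pull_mem: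
  assumes "\<xi> \<in> underlying (nakayama B R)"
  shows "pull \<xi> \<in> underlying (nakayama C P)"
  unfolding nakayama_iff
proof (intro conjI allI ballI impI)
  show "pull \<xi> f = 0" if "f \<notin> hom_to_algebra C P" for f using that by (simp add: pull_def)
  fix f assume f: "f \<in> hom_to_algebra C P"
  show "pull \<xi> (scale_C k f) = k * pull \<xi> f" for k
    using f hom_C_closed(2)[OF f, of k] nak_scale[OF assms descend_mem[OF f], of k]
    by (simp only: pull_def if_True descend_ops(2)[OF f])
  fix g assume g: "g \<in> hom_to_algebra C P"
  show "pull \<xi> (plus_C f g) = pull \<xi> f + pull \<xi> g"
    using f g hom_C_closed(1)[OF f g] nak_add[OF assms descend_mem[OF f] descend_mem[OF g]]
    by (simp only: pull_def if_True descend_ops(1)[OF f g])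
qed

lemma pull_action:
  assumes "c \<in> carrier C"
  shows "pull (action (nakayama B R) (J +> c) \<xi>) = action (nakayama C P) c (pull \<xi>)"
proof
  fix f
  show "pull (action (nakayama B R) (J +> c) \<xi>) f = action (nakayama C P) c (pull \<xi>) f"
  proof (cases "f \<in> hom_to_algebra C P")
    case True
    then show ?thesis
      using descend_mem[OF True] hom_C_closed(3)[OF True assms] descend_ops(3)[OF True assms]
      by (simp only: nakayama_def lmod.simps pull_def if_True)
  next
    case False
    then show ?thesis by (simp only: nakayama_def lmod.simps pull_def if_False)
  qed
qed

lemma pull_inject:
  assumes "\<And>g. g \<notin> hom_to_algebra B R \<Longrightarrow> \<xi> g = 0" "\<And>g. g \<notin> hom_to_algebra B R \<Longrightarrow> \<zeta> g = 0"
    and eq: "pull \<xi> = pull \<zeta>"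
  shows "\<xi> = \<zeta>"
proof
  fix g
  show "\<xi> g = \<zeta> g"
  proof (cases "g \<in> hom_to_algebra B R")
    case True
    then obtain f where "f \<in> hom_to_algebra C P" "descend f = g" using descend_onto by blast
    with fun_cong[OF eq, of f] show ?thesis by (simp add: pull_def)
  qed (simp add: assms(1,2))
qed

text \<open>
  A functional that \<open>eC\<close> annihilates has the same value at homomorphisms that descend to the same one,
  and every homomorphism \<open>R \<rightarrow> C/J\<close> is a descent. So the functional can be evaluated on \<open>Hom(R, C/J)\<close>.
\<close>

lemma pull_onto:
  assumes \<xi>: "\<xi> \<in> underlying (nakayama C P)"
    and ann: "\<And>b f. b \<in> carrier C \<Longrightarrow> f \<in> hom_to_algebra C P \<Longrightarrow> \<xi> (mult_C f (e \<otimes> b)) = 0"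
  shows "\<exists>\<zeta>\<in>underlying (nakayama B R). pull \<zeta> = \<xi>"
proof -
  define \<zeta> where "\<zeta> g = (if g \<in> hom_to_algebra B R
    then \<xi> (SOME f. f \<in> hom_to_algebra C P \<and> descend f = g) else 0)" for g
  have \<zeta>: "\<zeta> (descend f) = \<xi> f" if f: "f \<in> hom_to_algebra C P" for f
  proof -
    let ?f = "SOME f'. f' \<in> hom_to_algebra C P \<and> descend f' = descend f"
    have "?f \<in> hom_to_algebra C P \<and> descend ?f = descend f" by (rule someI[of _ f]) (simp add: f)
    then have "\<xi> ?f = \<xi> f" using functional_determined[OF \<xi> ann _ f] by blast
    then show ?thesis by (simp add: \<zeta>_def descend_mem[OF f])
  qed
  have "\<zeta> \<in> underlying (nakayama B R)"
    unfolding nakayama_iff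
  proof (intro conjI allI impI ballI)
    show "\<zeta> g = 0" if "g \<notin> hom_to_algebra B R" for g using that by (simp add: \<zeta>_def)
    fix g assume "g \<in> hom_to_algebra B R"
    then obtain g' where g: "g' \<in> hom_to_algebra C P" "descend g' = g" using descend_onto by blast
    show "\<zeta> (scale_B k g) = k * \<zeta> g" for k
      using \<zeta>[OF hom_C_closed(2)[OF g(1), of k]] \<zeta>[OF g(1)] nak_scale[OF \<xi> g(1), of k]
      unfolding descend_ops(2)[OF g(1)] g(2) by (simp only:)
    fix h assume "h \<in> hom_to_algebra B R"
    then obtain h' where h: "h' \<in> hom_to_algebra C P" "descend h' = h" using descend_onto by blast
    show "\<zeta> (plus_B g h) = \<zeta> g + \<zeta> h"
      using \<zeta>[OF hom_C_closed(1)[OF g(1) h(1)]] \<zeta>[OF g(1)] \<zeta>[OF h(1)] nak_add[OF \<xi> g(1) h(1)]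
      unfolding descend_ops(1)[OF g(1) h(1)] g(2) h(2) by (simp only:)
  qed
  moreover have "pull \<zeta> = \<xi>"
    by (rule ext) (simp add: pull_def \<zeta> nak_outside[OF \<xi>])
  ultimately show ?thesis by blast
qed

end

lemma mem_kernel_nakayama_map:
  "\<xi> \<in> hom_kernel (nakayama C P1) (nakayama_map C P1 P0 p1) \<longleftrightarrow> \<xi> \<in> underlying (nakayama C P1) \<and>
    (\<forall>f\<in>hom_to_algebra C P0. \<xi> (\<lambda>v\<in>underlying P1. f (p1 v)) = 0)"
  by (auto simp: hom_kernel_def nakayama_map_def fun_eq_iff zero_fun_apply split: if_splits)

text \<open>
  Dimensions of Hom spaces are compared by this. Injectivity is needed on the span of \<open>S\<close>, which lies
  in \<open>W\<close>.
\<close>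

lemma dim_image_linear_injective:
  fixes \<Phi> :: "('v \<Rightarrow> 'y \<Rightarrow> 'k::field) \<Rightarrow> 'w \<Rightarrow> 'z \<Rightarrow> 'k"
  assumes lin: "Vector_Spaces.linear hom_scale hom_scale \<Phi>"
    and W: "hom_vs.subspace W" "S \<subseteq> W" and inj: "inj_on \<Phi> W"
  shows "hom_vs.dim (\<Phi> ` S) = hom_vs.dim S"
proof -
  interpret Vector_Spaces.linear hom_scale hom_scale \<Phi> by (rule lin)
  obtain T where T: "T \<subseteq> S" "hom_vs.independent T" "S \<subseteq> hom_vs.span T" "card T = hom_vs.dim S"
    by (rule hom_vs.basis_exists)
  have "hom_vs.span T \<subseteq> W" using T(1) W by (intro hom_vs.span_minimal) auto
  then have injT: "inj_on \<Phi> (hom_vs.span T)" using inj inj_on_subset by blast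
  have "hom_vs.independent (\<Phi> ` T)" by (rule independent_injective_image[OF T(2) injT])
  moreover have "\<Phi> ` S \<subseteq> hom_vs.span (\<Phi> ` T)" using T(3) by (auto simp: span_image)
  moreover have "\<Phi> ` T \<subseteq> \<Phi> ` S" using T(1) by blast
  moreover have "card (\<Phi> ` T) = card T"
    using inj_on_subset[OF injT hom_vs.span_superset] by (rule card_image)
  ultimately show ?thesis using T(4) hom_vs.dim_unique by metis
qed

lemma (in fd_algebra) ar_translate_cases:
  assumes N: "fd_module C N"
  shows "\<exists>P1 p1 P0 p0. minimal_projective_presentation C P1 p1 P0 p0 N \<and> ar_translate C N =
    (nakayama C P1)\<lparr>underlying := hom_kernel (nakayama C P1) (nakayama_map C P1 P0 p1)\<rparr>"
proof -
  let ?M = "\<lambda>(P1, p1, P0, p0). minimal_projective_presentation C P1 p1 P0 p0 N"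
  obtain P1 p1 P0 p0 where z: "(SOME z. ?M z) = (P1, p1, P0, p0)" by (metis prod_cases4)
  have "\<exists>z. ?M z" using minimal_projective_presentation_exists[OF N] by auto
  then have "?M (SOME z. ?M z)" by (rule someI_ex)
  with z show ?thesis unfolding ar_translate_def by auto
qed

text \<open>
  The covers of \<open>N\<close> are compared first, and then the covers of their kernels: the induced map between
  the kernels has kernel \<open>CeP0\<close>, and \<open>CeP0\<close> is generated by elements of the kernel of \<open>P0 \<rightarrow> N\<close>.
\<close>

lemma (in idempotent_quotient) minimal_presentation_descends:
  fixes N :: "('c, 'x \<Rightarrow> 'k) lmod"
  assumes N: "fd_module C N" and eN: "annihilates e N"
    and mP: "minimal_projective_presentation C P1 p1 P0 p0 N"
    and mR: "minimal_projective_presentation B R1 r1 R0 r0 (quot_module N)"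
  shows "\<exists>s0 s1. projective_descent C \<iota> J B e P0 R0 s0 \<and> projective_descent C \<iota> J B e P1 R1 s1 \<and>
    (\<forall>v\<in>underlying P1. r1 (s1 v) = s0 (p1 v))"
proof -
  have JN: "annihilates x N" if "x \<in> J" for x using annihilated_by_J_iff[OF N] eN that by blast
  let ?X = "P0\<lparr>underlying := hom_kernel P0 p0\<rparr>" and ?Y = "R0\<lparr>underlying := hom_kernel R0 r0\<rparr>"
  have P0: "projective C P0" and p0: "p0 \<in> module_hom C P0 N" and p0_onto: "p0 ` underlying P0 = underlying N"
    and p0_sup: "superfluous C (hom_kernel P0 p0) P0"
    and P1: "projective C P1" and p1: "p1 \<in> module_hom C P1 ?X" and p1_onto: "p1 ` underlying P1 = underlying ?X"
    and p1_sup: "superfluous C (hom_kernel P1 p1) P1"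
    using mP by (auto simp: minimal_projective_presentation_def projective_cover_def)
  have R0: "projective B R0" and r0: "r0 \<in> module_hom B R0 (quot_module N)"
    and r0_onto: "r0 ` underlying R0 = underlying N"
    and r0_sup: "superfluous B (hom_kernel R0 r0) R0"
    and R1: "projective B R1" and r1: "r1 \<in> module_hom B R1 ?Y" and r1_onto: "r1 ` underlying R1 = underlying ?Y"
    and r1_sup: "superfluous B (hom_kernel R1 r1) R1"
    using mR by (auto simp: minimal_projective_presentation_def projective_cover_def)
  have P0': "fd_module C P0" and P1': "fd_module C P1" and R0': "fd_module B R0" and R1': "fd_module B R1"
    using P0 P1 R0 R1 by (simp_all add: projectiveD)

  have id: "cut_off (underlying N) (\<lambda>v. v) \<in> module_hom C N N"
    by (rule cut_off_module_hom[OF N]) simp_all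
  have id_onto: "cut_off (underlying N) (\<lambda>v. v) ` underlying N = underlying N" by (auto simp: image_iff)
  have id_ker: "hom_kernel N (cut_off (underlying N) (\<lambda>v. v)) \<subseteq> trace N"
    using fun_vs.subspace_0[OF submodule_subspace[OF submodule_trace[OF N]]] by (auto simp: hom_kernel_def)
  have r0C: "r0 \<in> module_hom C (inflate R0) N"
    by (rule module_hom_inflate_quot_module[OF N JN r0])
  obtain s0 where s0: "s0 \<in> module_hom C P0 (inflate R0)" "s0 ` underlying P0 = underlying R0"
      "\<forall>v\<in>underlying P0. r0 (s0 v) = cut_off (underlying N) (\<lambda>v. v) (p0 v)" "hom_kernel P0 s0 \<subseteq> trace P0"
    using cover_descends[OF P0 N p0 p0_onto p0_sup N id id_onto id_ker R0 r0C r0_onto r0_sup] by blast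
  have rs0: "r0 (s0 v) = p0 v" if "v \<in> underlying P0" for v
    using s0(3) that mh_closed[OF p0 that] by simp

  have X: "fd_module C ?X"
    by (rule submodule_fd_module[OF P0' submodule_hom_kernel[OF P0' N p0]])
  have K: "hom_kernel (inflate R0) r0 = hom_kernel R0 r0" by (simp add: hom_kernel_def)
  have inflY: "inflate ?Y = (inflate R0)\<lparr>underlying := hom_kernel R0 r0\<rparr>" by (simp add: inflate_def)
  have W: "fd_module C (inflate ?Y)"
    using submodule_fd_module[OF fd_module_inflate[OF R0'] submodule_hom_kernel[OF fd_module_inflate[OF R0'] N r0C]]
    by (simp only: inflY K)
  have r1C: "r1 \<in> module_hom C (inflate R1) (inflate ?Y)" using r1 by (simp add: module_hom_inflate)
  have XP0: "v \<in> underlying P0" if "v \<in> underlying ?X" for v using that by (simp add: hom_kernel_def)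
  let ?t = "cut_off (underlying ?X) s0"
  have t: "?t \<in> module_hom C ?X (inflate ?Y)"
  proof (rule cut_off_module_hom[OF X])
    show "s0 v \<in> underlying (inflate ?Y)" if "v \<in> underlying ?X" for v
      using that mh_closed[OF s0(1), of v] rs0[of v] by (simp add: hom_kernel_def)
  qed (use XP0 in \<open>simp_all add: inflY mh_add[OF s0(1)] mh_scale[OF s0(1)] mh_act[OF s0(1)] inflate_def\<close>)
  have t_onto: "?t ` underlying ?X = underlying (inflate ?Y)"
  proof
    show "?t ` underlying ?X \<subseteq> underlying (inflate ?Y)" using mh_closed[OF t] by blast
    show "underlying (inflate ?Y) \<subseteq> ?t ` underlying ?X"
    proof
      fix w assume "w \<in> underlying (inflate ?Y)"
      then have w: "w \<in> underlying R0" "r0 w = 0" by (simp_all add: hom_kernel_def)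
      then have "w \<in> s0 ` underlying P0" using s0(2) by simp
      then obtain v where v: "w = s0 v" "v \<in> underlying P0" by (rule imageE)
      then have "v \<in> underlying ?X" using rs0 w(2) by (simp add: hom_kernel_def)
      then show "w \<in> ?t ` underlying ?X" using v(1) by (intro image_eqI[of _ _ v]) simp_all
    qed
  qed
  have t_ker: "hom_kernel ?X ?t \<subseteq> trace ?X"
  proof -
    have "trace P0 \<subseteq> trace ?X"
    proof (rule trace_least[OF submodule_subspace[OF submodule_trace[OF X]]])
      fix b v assume b: "b \<in> carrier C" and v: "v \<in> underlying P0"
      let ?w = "action P0 e v"
      have w: "?w \<in> underlying P0" using v e_closed by (simp add: fdm_closed[OF P0'])
      have "p0 ?w = action N e (p0 v)" by (rule mh_act[OF p0 e_closed v])
      also have "\<dots> = 0" using eN mh_closed[OF p0 v] by (simp add: annihilates_def)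
      finally have "?w \<in> underlying ?X" using w by (simp add: hom_kernel_def)
      \<comment> \<open>Here idempotency enters: \<open>ev = e(ev)\<close> lies in \<open>eX\<close>, although \<open>v\<close> need not lie in \<open>X\<close>.\<close>
      moreover have "action P0 e ?w = ?w"
        using fdm_mult[OF P0' e_closed e_closed v] by (simp add: e_idem)
      ultimately show "action P0 b ?w \<in> trace ?X" using trace_base[OF b, of ?w ?X] by simp
    qed
    moreover have "hom_kernel ?X ?t \<subseteq> hom_kernel P0 s0" using XP0 by (auto simp: hom_kernel_def)
    ultimately show ?thesis using s0(4) by blast
  qed
  have Y_eq: "underlying ?Y = underlying (inflate ?Y)" by simp
  obtain s1 where s1: "s1 \<in> module_hom C P1 (inflate R1)" "s1 ` underlying P1 = underlying R1"
      "\<forall>v\<in>underlying P1. r1 (s1 v) = ?t (p1 v)" "hom_kernel P1 s1 \<subseteq> trace P1"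
    using cover_descends[OF P1 X p1 p1_onto p1_sup W t t_onto t_ker R1 r1C r1_onto[unfolded Y_eq] r1_sup] by blast
  have "r1 (s1 v) = s0 (p1 v)" if "v \<in> underlying P1" for v
    using s1(3) that mh_closed[OF p1 that] by simp
  moreover have "projective_descent C \<iota> J B e P0 R0 s0" "projective_descent C \<iota> J B e P1 R1 s1"
    by unfold_locales (use P0 R0' s0 P1 R1' s1 in auto)
  ultimately show ?thesis by blast
qed

text \<open>
  The two translations are computed from minimal presentations \<open>P1 \<rightarrow> P0 \<rightarrow> N\<close> over \<open>C\<close> and
  \<open>R1 \<rightarrow> R0 \<rightarrow> N\<close> over \<open>C/J\<close>. The second one is obtained from the first one by dividing out the
  submodules \<open>CePi\<close>, so that the translation of \<open>N\<close> over \<open>C/J\<close> is the largest submodule of the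
  translation over \<open>C\<close> that \<open>J\<close> annihilates. Every homomorphism from \<open>N\<close> has its image there.
\<close>

theorem (in idempotent_quotient) E_inv_quot_module:
  fixes N :: "('c, 'x \<Rightarrow> 'k) lmod"
  assumes N: "fd_module C N" and eN: "annihilates e N"
  shows "E_inv C N = E_inv B (quot_module N)"
proof -
  have JN: "annihilates x N" if "x \<in> J" for x using annihilated_by_J_iff[OF N] eN that by blast
  have BN: "fd_module B (quot_module N)" by (rule fd_module_quot_module[OF N JN])
  obtain S where S: "finite S" "\<iota> ` carrier C \<subseteq> fun_vs.span S" using \<iota>_span by blast
  have ker: "c \<in> J" if "c \<in> carrier C" "\<iota> c = 0" for c
  proof -
    have "\<iota> c = \<iota> \<zero>" using that(2) \<iota>_zero by simp
    then have "c = \<zero>" using that(1) \<iota>_inj by (simp add: inj_on_eq_iff)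
    then show ?thesis by simp
  qed
  obtain \<kappa> where "fd_algebra B \<kappa>" using fd_algebra_quot[OF \<iota>_add \<iota>_smult ker S] by blast
  then interpret B: fd_algebra B \<kappa> .

  obtain P1 p1 P0 p0 where mP: "minimal_projective_presentation C P1 p1 P0 p0 N"
    and \<tau>C: "ar_translate C N = (nakayama C P1)\<lparr>underlying := hom_kernel (nakayama C P1) (nakayama_map C P1 P0 p1)\<rparr>"
    using ar_translate_cases[OF N] by blast
  obtain R1 r1 R0 r0 where mR: "minimal_projective_presentation B R1 r1 R0 r0 (quot_module N)"
    and \<tau>B: "ar_translate B (quot_module N)
      = (nakayama B R1)\<lparr>underlying := hom_kernel (nakayama B R1) (nakayama_map B R1 R0 r1)\<rparr>"
    using B.ar_translate_cases[OF BN] by blast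

  obtain s0 s1 where D: "projective_descent C \<iota> J B e P0 R0 s0" "projective_descent C \<iota> J B e P1 R1 s1"
    and rs1: "\<And>v. v \<in> underlying P1 \<Longrightarrow> r1 (s1 v) = s0 (p1 v)"
    using minimal_presentation_descends[OF N eN mP mR] by blast
  interpret D0: projective_descent C \<iota> J B e P0 R0 s0 by (rule D(1))
  interpret D1: projective_descent C \<iota> J B e P1 R1 s1 by (rule D(2))
  have p1: "p1 \<in> module_hom C P1 (P0\<lparr>underlying := hom_kernel P0 p0\<rparr>)"
    and r1: "r1 \<in> module_hom B R1 (R0\<lparr>underlying := hom_kernel R0 r0\<rparr>)"
    using mP mR by (auto simp: minimal_projective_presentation_def projective_cover_def)
  have p1P0: "p1 v \<in> underlying P0" if "v \<in> underlying P1" for v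
    using mh_closed[OF p1 that] by (simp add: hom_kernel_def)
  note P1' = D1.P' and R1' = D1.R

  let ?p = "\<lambda>f. \<lambda>v\<in>underlying P1. f (p1 v)" and ?r = "\<lambda>g. \<lambda>w\<in>underlying R1. g (r1 w)"
  have pf: "?p f \<in> hom_to_algebra C P1" if f: "f \<in> hom_to_algebra C P0" for f
  proof (rule hom_to_algebraI[OF P1'])
    fix v c assume v: "v \<in> underlying P1" and c: "c \<in> carrier C"
    show "f (p1 (action P1 c v)) = c \<otimes> f (p1 v)"
      using mh_act[OF p1 c v] ha_act[OF f c p1P0[OF v]] by simp
  qed (simp_all add: mh_add[OF p1] mh_scale[OF p1] p1P0 ha_closed[OF f] ha_add[OF f] ha_scale[OF f])
  have R1R0: "r1 w \<in> underlying R0" if "w \<in> underlying R1" for w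
    using mh_closed[OF r1 that] by (simp add: hom_kernel_def)
  have rg: "?r g \<in> hom_to_algebra B R1" if g: "g \<in> hom_to_algebra B R0" for g
  proof (rule hom_to_algebraI[OF R1'])
    fix v c assume v: "v \<in> underlying R1" and c: "c \<in> carrier B"
    show "g (r1 (action R1 c v)) = c \<otimes>\<^bsub>B\<^esub> g (r1 v)"
      using mh_act[OF r1 c v] ha_act[OF g c R1R0[OF v]] by simp
  qed (simp_all add: mh_add[OF r1] mh_scale[OF r1] R1R0 ha_closed[OF g] ha_add[OF g] ha_scale[OF g])
  have compat: "D1.descend (?p f) = ?r (D0.descend f)" if f: "f \<in> hom_to_algebra C P0" for f
  proof (rule D1.hom_B_eqI[OF D1.descend_mem[OF pf[OF f]] rg[OF D0.descend_mem[OF f]]])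
    fix v assume v: "v \<in> underlying P1"
    show "D1.descend (?p f) (s1 v) = ?r (D0.descend f) (s1 v)"
      using v D1.s_mem[OF v] by (simp add: D1.descend_apply[OF pf[OF f] v] rs1 D0.descend_apply[OF f p1P0])
  qed

  let ?TC = "ar_translate C N" and ?TB = "ar_translate B (quot_module N)"
  have TC: "\<xi> \<in> underlying ?TC \<longleftrightarrow> \<xi> \<in> underlying (nakayama C P1) \<and> (\<forall>f\<in>hom_to_algebra C P0. \<xi> (?p f) = 0)" for \<xi>
    unfolding \<tau>C by (simp add: mem_kernel_nakayama_map)
  have TB: "\<xi> \<in> underlying ?TB \<longleftrightarrow> \<xi> \<in> underlying (nakayama B R1) \<and> (\<forall>g\<in>hom_to_algebra B R0. \<xi> (?r g) = 0)" for \<xi>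
    unfolding \<tau>B by (simp add: mem_kernel_nakayama_map)
  have aC: "action ?TC = action (nakayama C P1)" and aB: "action ?TB = action (nakayama B R1)"
    unfolding \<tau>C \<tau>B by simp_all
  have pull_TB: "\<xi> \<in> underlying ?TB \<longleftrightarrow> D1.pull \<xi> \<in> underlying ?TC" if \<xi>: "\<xi> \<in> underlying (nakayama B R1)" for \<xi>
  proof -
    have "D1.pull \<xi> (?p f) = \<xi> (?r (D0.descend f))" if "f \<in> hom_to_algebra C P0" for f
      using pf[OF that] compat[OF that] by (simp add: D1.pull_def)
    moreover have "(\<forall>g\<in>hom_to_algebra B R0. \<xi> (?r g) = 0) \<longleftrightarrow> (\<forall>f\<in>hom_to_algebra C P0. \<xi> (?r (D0.descend f)) = 0)"
      using D0.descend_onto D0.descend_mem by metis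
    ultimately show ?thesis using \<xi> D1.pull_mem[OF \<xi>] by (simp add: TC TB)
  qed
  have out: "\<xi> g = 0" if "\<xi> \<in> underlying ?TB" "g \<notin> hom_to_algebra B R1" for \<xi> g
    by (rule nak_outside[OF conjunct1[OF TB[THEN iffD1, OF that(1)]] that(2)])

  \<comment> \<open>\<open>\<Phi>\<close> is composition with the embedding of the translation over \<open>C/J\<close> into the one over \<open>C\<close>.\<close>
  define \<Phi> where "\<Phi> h = (\<lambda>v. D1.pull (h v))" for h :: "('x \<Rightarrow> 'k) \<Rightarrow> ((nat \<Rightarrow> 'k) \<Rightarrow> 'c set) \<Rightarrow> 'k"
  have lin: "Vector_Spaces.linear hom_scale hom_scale \<Phi>"
    by unfold_locales (rule ext, simp add: \<Phi>_def hom_scale_def plus_fun_apply D1.pull_add D1.pull_scale)+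
  let ?W = "{h :: ('x \<Rightarrow> 'k) \<Rightarrow> ((nat \<Rightarrow> 'k) \<Rightarrow> 'c set) \<Rightarrow> 'k. \<forall>v g. g \<notin> hom_to_algebra B R1 \<longrightarrow> h v g = 0}"
  have W_sub: "hom_vs.subspace ?W"
    unfolding hom_vs.subspace_def by (simp add: hom_scale_def fun_scale_def plus_fun_apply zero_fun_apply)
  have inj: "inj_on \<Phi> ?W"
  proof (rule inj_onI, rule ext)
    fix h h' v assume "h \<in> ?W" "h' \<in> ?W" and eq: "\<Phi> h = \<Phi> h'"
    then have "D1.pull (h v) = D1.pull (h' v)" by (metis \<Phi>_def)
    then show "h v = h' v" using \<open>h \<in> ?W\<close> \<open>h' \<in> ?W\<close> by (intro D1.pull_inject) auto
  qed
  have "module_hom B (quot_module N) ?TB \<subseteq> ?W"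
  proof (rule subsetI, simp, intro allI impI)
    fix h v g assume h: "h \<in> module_hom B (quot_module N) ?TB" and g: "g \<notin> hom_to_algebra B R1"
    show "h v g = 0"
    proof (cases "v \<in> underlying N")
      case True
      then show ?thesis using mh_closed[OF h, of v] g by (simp add: out)
    next
      case False
      then show ?thesis using mh_outside[OF h, of v] by (simp add: zero_fun_apply)
    qed
  qed
  note dim = dim_image_linear_injective[OF lin W_sub this inj]

  have pull0: "D1.pull 0 = 0" by (rule ext) (simp add: D1.pull_def zero_fun_apply)
  have "\<Phi> ` module_hom B (quot_module N) ?TB = module_hom C N ?TC"
  proof (intro equalityI subsetI)
    fix k assume "k \<in> \<Phi> ` module_hom B (quot_module N) ?TB"
    then obtain h where h: "h \<in> module_hom B (quot_module N) ?TB" and k: "k = \<Phi> h" by blast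
    have "\<Phi> h \<in> module_hom C N ?TC"
      unfolding module_hom_def
    proof (intro CollectI conjI ballI allI impI)
      fix v assume v: "v \<in> underlying N"
      have hv: "h v \<in> underlying ?TB" using mh_closed[OF h] v by simp
      then show "\<Phi> h v \<in> underlying ?TC" using pull_TB[of "h v"] by (simp add: \<Phi>_def TB)
      show "\<Phi> h (v + w) = \<Phi> h v + \<Phi> h w" if "w \<in> underlying N" for w
        using v that by (simp add: \<Phi>_def mh_add[OF h] D1.pull_add)
      show "\<Phi> h (fun_scale c v) = fun_scale c (\<Phi> h v)" for c
        using v by (simp add: \<Phi>_def mh_scale[OF h] D1.pull_scale)
    next
      fix v assume "v \<notin> underlying N"
      then show "\<Phi> h v = 0" using mh_outside[OF h, of v] by (simp add: \<Phi>_def pull0)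
    next
      fix c v assume c: "c \<in> carrier C" and v: "v \<in> underlying N"
      have "h (action N c v) = action ?TB (J +> c) (h v)"
        using mh_act[OF h quot_coset_mem[OF c], of v] v by (simp add: quot_module_action[OF N JN c v])
      then show "\<Phi> h (action N c v) = action ?TC c (\<Phi> h v)"
        by (simp add: \<Phi>_def aB aC D1.pull_action[OF c])
    qed
    then show "k \<in> module_hom C N ?TC" by (simp add: k)
  next
    fix k assume k: "k \<in> module_hom C N ?TC"
    have k0: "k 0 = 0" by (rule mh_0[OF N k])
    have "\<exists>\<zeta>\<in>underlying ?TB. D1.pull \<zeta> = k v" if v: "v \<in> underlying N" for v
    proof -
      have kv: "k v \<in> underlying ?TC" by (rule mh_closed[OF k v])
      \<comment> \<open>\<open>e\<close> annihilates \<open>k v\<close> because it annihilates \<open>v\<close>, so \<open>k v\<close> comes from a functional on \<open>Hom(R1, C/J)\<close>.\<close>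
      have ann: "k v (\<lambda>u\<in>underlying P1. f u \<otimes> (e \<otimes> b)) = 0"
        if b: "b \<in> carrier C" and f: "f \<in> hom_to_algebra C P1" for b f
      proof -
        have bv: "action N b v \<in> underlying N" using b v by (simp add: fdm_closed[OF N])
        have "action N (e \<otimes> b) v = 0"
          using eN bv by (simp add: fdm_mult[OF N e_closed b v] annihilates_def)
        then have z: "action (nakayama C P1) (e \<otimes> b) (k v) = 0"
          using mh_act[OF k _ v, of "e \<otimes> b"] b e_closed k0 by (simp add: aC)
        have "k v (\<lambda>u\<in>underlying P1. f u \<otimes> (e \<otimes> b)) = action (nakayama C P1) (e \<otimes> b) (k v) f"
          using f by (simp only: nakayama_def lmod.simps if_True)
        also have "\<dots> = 0" unfolding z by (rule zero_fun_apply)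
        finally show ?thesis .
      qed
      have "\<exists>\<zeta>\<in>underlying (nakayama B R1). D1.pull \<zeta> = k v"
        by (rule D1.pull_onto[OF conjunct1[OF TC[THEN iffD1, OF kv]]]) (erule (1) ann)
      then obtain \<zeta> where \<zeta>: "\<zeta> \<in> underlying (nakayama B R1)" "D1.pull \<zeta> = k v" by blast
      have "\<zeta> \<in> underlying ?TB" by (rule pull_TB[OF \<zeta>(1), THEN iffD2]) (simp only: \<zeta>(2) kv)
      with \<zeta>(2) show ?thesis by blast
    qed
    then obtain q where q: "\<And>v. v \<in> underlying N \<Longrightarrow> q v \<in> underlying ?TB \<and> D1.pull (q v) = k v" by metis
    let ?h = "cut_off (underlying N) q"
    have \<Phi>h: "\<Phi> ?h = k"
    proof
      fix v
      show "\<Phi> ?h v = k v"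
        using q[of v] mh_outside[OF k, of v] by (cases "v \<in> underlying N") (simp_all add: \<Phi>_def cut_off_def pull0)
    qed
    have outq: "q v g = 0" if "v \<in> underlying N" "g \<notin> hom_to_algebra B R1" for v g
      using out q that by blast
    have "cut_off (underlying (quot_module N)) q \<in> module_hom B (quot_module N) ?TB"
    proof (rule cut_off_module_hom[OF BN])
      fix v assume "v \<in> underlying (quot_module N)"
      then have v: "v \<in> underlying N" by simp
      show "q v \<in> underlying ?TB" using q v by blast
      show "q (fun_scale c v) = fun_scale c (q v)" for c
      proof (rule D1.pull_inject)
        have cv: "fun_scale c v \<in> underlying N" by (rule fdm_fun_scale[OF N v])
        show "q (fun_scale c v) g = 0" "fun_scale c (q v) g = 0" if "g \<notin> hom_to_algebra B R1" for g
          using outq[OF cv that] outq[OF v that] by (simp_all add: fun_scale_def)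
        show "D1.pull (q (fun_scale c v)) = D1.pull (fun_scale c (q v))"
          using q[OF v] q[OF cv] mh_scale[OF k v, of c] by (simp add: D1.pull_scale)
      qed
      show "q (action (quot_module N) x v) = action ?TB x (q v)" if x: "x \<in> carrier B" for x
      proof -
        obtain c where c: "c \<in> carrier C" "x = J +> c" using quot_carrierD[OF x] by blast
        have cv: "action N c v \<in> underlying N" using c v by (simp add: fdm_closed[OF N])
        have "q (action N c v) = action (nakayama B R1) (J +> c) (q v)"
        proof (rule D1.pull_inject)
          show "q (action N c v) g = 0" if "g \<notin> hom_to_algebra B R1" for g using outq cv that by blast
          show "action (nakayama B R1) (J +> c) (q v) g = 0" if "g \<notin> hom_to_algebra B R1" for g
            using that by (simp add: nakayama_def)
          show "D1.pull (q (action N c v)) = D1.pull (action (nakayama B R1) (J +> c) (q v))"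
            using q[OF cv] q[OF v] mh_act[OF k c(1) v] by (simp add: D1.pull_action[OF c(1)] aC)
        qed
        then show ?thesis by (simp add: c(2) quot_module_action[OF N JN c(1) v] aB)
      qed
      fix w assume "w \<in> underlying (quot_module N)"
      then have w: "w \<in> underlying N" by simp
      have vw: "v + w \<in> underlying N" by (rule fdm_plus[OF N v w])
      show "q (v + w) = q v + q w"
      proof (rule D1.pull_inject)
        show "q (v + w) g = 0" "(q v + q w) g = 0" if "g \<notin> hom_to_algebra B R1" for g
          using outq[OF vw that] outq[OF v that] outq[OF w that] by (simp_all add: plus_fun_apply)
        show "D1.pull (q (v + w)) = D1.pull (q v + q w)"
          using q[OF v] q[OF w] q[OF vw] mh_add[OF k v w] by (simp add: D1.pull_add)
      qed
    qed
    then have "?h \<in> module_hom B (quot_module N) ?TB" by simp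
    with \<Phi>h show "k \<in> \<Phi> ` module_hom B (quot_module N) ?TB" by blast
  qed
  with dim show ?thesis by (simp add: E_inv_def)
qed

section \<open>The path algebra and its modules\<close>

locale path_algebra_quiver = fin_digraph Q for Q :: "('v, 'a) pre_digraph"
begin

lemma path_iff: "(u, p) \<in> quiver_paths Q \<longleftrightarrow> awalk u p (path_end Q u p)"
  unfolding quiver_paths_def path_end_def by (auto simp del: awlast_of_awalk)

lemma path_end_append: "path_end Q u (p @ q) = path_end Q (path_end Q u p) q"
  by (simp add: path_end_def awlast_append)

lemma path_append_iff:
  "(u, p @ q) \<in> quiver_paths Q \<longleftrightarrow> (u, p) \<in> quiver_paths Q \<and> (path_end Q u p, q) \<in> quiver_paths Q"
  unfolding path_iff path_end_append by (simp add: path_end_def)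

lemma path_ends_in_verts: "(u, p) \<in> quiver_paths Q \<Longrightarrow> u \<in> verts Q \<and> path_end Q u p \<in> verts Q"
  by (auto simp: path_iff)

lemma trivial_path: "(u, []) \<in> quiver_paths Q \<longleftrightarrow> u \<in> verts Q" "path_end Q u [] = u"
  by (auto simp: path_iff path_end_def awalk_Nil_iff)

lemma finite_short_paths: "finite {(u, p). (u, p) \<in> quiver_paths Q \<and> length p < m}"
proof (rule finite_subset)
  show "{(u, p). (u, p) \<in> quiver_paths Q \<and> length p < m}
      \<subseteq> verts Q \<times> {p. set p \<subseteq> arcs Q \<and> length p \<le> m}"
    by (auto simp: quiver_paths_def)
  show "finite (verts Q \<times> {p. set p \<subseteq> arcs Q \<and> length p \<le> m})"
    using finite_lists_length_le[of "arcs Q" m] by simp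
qed

text \<open>
  The ring laws are an assumption here because they come with every ideal of the path algebra.
\<close>

lemma k_algebra_path_algebra:
  assumes "ring (path_algebra Q :: ('k::field, 'v \<times> 'a list \<Rightarrow> 'k) module)"
  shows "k_algebra (path_algebra Q :: ('k, 'v \<times> 'a list \<Rightarrow> 'k) module)"
proof -
  have fin: "finite {w. k * f w \<noteq> 0}" if "finite {w. f w \<noteq> 0}" for f :: "'v \<times> 'a list \<Rightarrow> 'k" and k
    by (rule finite_subset[OF _ that]) auto
  show ?thesis
    by (intro k_algebra.intro assms k_algebra_axioms.intro)
      (auto simp: path_algebra_def fun_eq_iff algebra_simps sum_distrib_left fin
        intro: finite_subset)
qed

definition supp :: "('v \<times> 'a list \<Rightarrow> 'k::field) \<Rightarrow> ('v \<times> 'a list) set" where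
  "supp f = {w. f w \<noteq> 0}"

lemma path_algebra_simps:
  "f \<in> carrier (path_algebra Q) \<longleftrightarrow> finite (supp f) \<and> supp f \<subseteq> quiver_paths Q"
  "(f \<otimes>\<^bsub>path_algebra Q\<^esub> g) (u, p) =
    (\<Sum>k\<le>length p. f (path_end Q u (take k p), drop k p) * g (u, take k p))"
  "\<one>\<^bsub>path_algebra Q\<^esub> (u, p) = (if u \<in> verts Q \<and> p = [] then 1 else 0)"
  "(f \<oplus>\<^bsub>path_algebra Q\<^esub> g) w = f w + g w"
  "(k \<odot>\<^bsub>path_algebra Q\<^esub> f) w = k * f w"
  by (simp_all add: path_algebra_def supp_def)

context
  fixes d :: "'v \<Rightarrow> nat" and M :: "'a \<Rightarrow> 'k::field mat"
  assumes M: "M \<in> rep Q d"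
begin

lemma path_mat_carrier:
  "(u, p) \<in> quiver_paths Q \<Longrightarrow> path_mat Q d M u p \<in> carrier_mat (d (path_end Q u p)) (d u)"
proof (induction p arbitrary: u)
  case Nil
  then show ?case by (simp add: trivial_path)
next
  case (Cons a p)
  then have a: "a \<in> arcs Q" "tail Q a = u" and p: "(head Q a, p) \<in> quiver_paths Q"
    by (auto simp: quiver_paths_def awalk_Cons_iff)
  have "M a \<in> carrier_mat (d (head Q a)) (d u)" using M a by (auto simp: rep_def)
  moreover have "path_end Q u (a # p) = path_end Q (head Q a) p" by (simp add: path_end_def)
  ultimately show ?case using Cons.IH[OF p] by simp
qed

lemma path_mat_append:
  "(u, p @ q) \<in> quiver_paths Q \<Longrightarrow>
    path_mat Q d M u (p @ q) = path_mat Q d M (path_end Q u p) q * path_mat Q d M u p"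
proof (induction p arbitrary: u)
  case Nil
  then have "path_mat Q d M u q \<in> carrier_mat (d (path_end Q u q)) (d u)" by (simp add: path_mat_carrier)
  then show ?case by (simp add: trivial_path)
next
  case (Cons a p)
  then have a: "a \<in> arcs Q" "tail Q a = u" and pq: "(head Q a, p @ q) \<in> quiver_paths Q"
    by (auto simp: quiver_paths_def awalk_Cons_iff)
  have Ma: "M a \<in> carrier_mat (d (head Q a)) (d u)" using M a by (auto simp: rep_def)
  have e: "path_end Q u (a # p) = path_end Q (head Q a) p" by (simp add: path_end_def)
  have p: "(head Q a, p) \<in> quiver_paths Q" and q: "(path_end Q (head Q a) p, q) \<in> quiver_paths Q"
    using pq by (simp_all add: path_append_iff)
  show ?case
    using Cons.IH[OF pq] assoc_mult_mat[OF path_mat_carrier[OF q] path_mat_carrier[OF p] Ma] by (simp add: e)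
qed

definition comp_vec :: "('v \<times> nat \<Rightarrow> 'k) \<Rightarrow> 'v \<Rightarrow> 'k vec" where
  "comp_vec v u = vec (d u) (\<lambda>j. v (u, j))"

definition path_act :: "'v \<times> 'a list \<Rightarrow> ('v \<times> nat \<Rightarrow> 'k) \<Rightarrow> nat \<Rightarrow> 'k" where
  "path_act = (\<lambda>(u, p) v r. (path_mat Q d M u p *\<^sub>v comp_vec v u) $ r)"

abbreviation pend :: "'v \<times> 'a list \<Rightarrow> 'v" where
  "pend w \<equiv> path_end Q (fst w) (snd w)"

lemma path_act_sum:
  assumes w: "w \<in> quiver_paths Q" and r: "r < d (pend w)"
  shows "path_act w v r = (\<Sum>j<d (fst w). path_mat Q d M (fst w) (snd w) $$ (r, j) * v (fst w, j))"
  using path_mat_carrier[of "fst w" "snd w"] w r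
  by (auto simp: path_act_def comp_vec_def scalar_prod_def atLeast0LessThan split: prod.split intro!: sum.cong)

lemma path_act_add:
  "w \<in> quiver_paths Q \<Longrightarrow> r < d (pend w) \<Longrightarrow> path_act w (v + v') r = path_act w v r + path_act w v' r"
  by (simp add: path_act_sum plus_fun_apply algebra_simps sum.distrib)

lemma path_act_scale:
  "w \<in> quiver_paths Q \<Longrightarrow> r < d (pend w) \<Longrightarrow> path_act w (fun_scale k v) r = k * path_act w v r"
  by (simp add: path_act_sum fun_scale_def sum_distrib_left algebra_simps)

lemma rep_action:
  assumes W: "finite W" "supp f \<subseteq> W"
  shows "action (rep_module Q d M) f v (i, r) =
    (if r < d i then \<Sum>w\<in>W. if pend w = i then f w * path_act w v r else 0 else 0)"
proof (cases "r < d i")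
  case True
  have "action (rep_module Q d M) f v (i, r) = (\<Sum>w\<in>{w. f w \<noteq> 0 \<and> pend w = i}. f w * path_act w v r)"
    using True by (simp add: rep_module_def path_act_def comp_vec_def case_prod_unfold)
  also have "\<dots> = (\<Sum>w\<in>{w. f w \<noteq> 0 \<and> pend w = i}. if pend w = i then f w * path_act w v r else 0)"
    by (rule sum.cong) auto
  also have "\<dots> = (\<Sum>w\<in>W. if pend w = i then f w * path_act w v r else 0)"
    using W by (intro sum.mono_neutral_left) (auto simp: supp_def)
  finally show ?thesis using True by simp
qed (simp add: rep_module_def)

lemma underlying_rep: "v \<in> underlying (rep_module Q d M) \<longleftrightarrow> (\<forall>i r. v (i, r) \<noteq> 0 \<longrightarrow> i \<in> verts Q \<and> r < d i)"
  by (simp add: rep_module_def)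

lemma rep_module_mult:
  assumes f: "f \<in> carrier (path_algebra Q)" and g: "g \<in> carrier (path_algebra Q)"
  shows "action (rep_module Q d M) (f \<otimes>\<^bsub>path_algebra Q\<^esub> g) v
    = action (rep_module Q d M) f (action (rep_module Q d M) g v)"
proof (rule ext, clarify)
  fix i r
  let ?F = "supp f" and ?G = "supp g" and ?fg = "f \<otimes>\<^bsub>path_algebra Q\<^esub> g"
  let ?a = "action (rep_module Q d M)"
  have F: "finite ?F" "?F \<subseteq> quiver_paths Q" and G: "finite ?G" "?G \<subseteq> quiver_paths Q"
    using f g by (simp_all add: path_algebra_simps)
  define W where "W = (\<lambda>((w, q), (u, p)). (u, p @ q)) ` (?F \<times> ?G)"
  have W: "finite W" unfolding W_def using F G by simp
  have term_W: "(u, p @ q) \<in> W" if "f (w, q) \<noteq> 0" "g (u, p) \<noteq> 0" for u p w q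
    unfolding W_def using that by (intro image_eqI[of _ _ "((w, q), (u, p))"]) (auto simp: supp_def)
  have "supp ?fg \<subseteq> W"
  proof (clarsimp simp: supp_def path_algebra_simps)
    fix u P assume "(\<Sum>k\<le>length P. f (path_end Q u (take k P), drop k P) * g (u, take k P)) \<noteq> 0"
    then obtain k where "f (path_end Q u (take k P), drop k P) \<noteq> 0" "g (u, take k P) \<noteq> 0"
      by (metis (no_types, lifting) mult_eq_0_iff sum.neutral)
    from term_W[OF this] show "(u, P) \<in> W" by simp
  qed
  note act_fg = rep_action[OF W this]
  show "?a ?fg v (i, r) = ?a f (?a g v) (i, r)"
  proof (cases "r < d i")
    case False
    then show ?thesis by (simp add: rep_module_def)
  next
    case r: True
    define t where "t = (\<lambda>(u, P) k. if path_end Q u P = i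
      then f (path_end Q u (take k P), drop k P) * g (u, take k P) * path_act (u, P) v r else 0)"
    define t' where "t' = (\<lambda>(w, q) (u, p). if path_end Q u p = w \<and> path_end Q w q = i
      then f (w, q) * g (u, p) * path_act (u, p @ q) v r else 0)"
    \<comment> \<open>A factorisation of a path is given by its two factors, or by the path and the length of the first one.\<close>
    define Z where "Z = {(x, y) \<in> ?F \<times> ?G. pend y = fst x}"
    define \<phi> where "\<phi> = (\<lambda>(x :: 'v \<times> 'a list, y :: 'v \<times> 'a list). ((fst y, snd y @ snd x), length (snd y)))"
    have "?a ?fg v (i, r) = (\<Sum>(x, k)\<in>Sigma W (\<lambda>(u, P). {..length P}). t x k)"
      unfolding act_fg
      by (subst sum.Sigma[symmetric])
        (use W r in \<open>auto simp: t_def path_algebra_simps sum_distrib_right intro!: sum.cong\<close>)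
    also have "\<dots> = (\<Sum>(x, k)\<in>\<phi> ` Z. t x k)"
    proof (rule sum.mono_neutral_right)
      show "finite (Sigma W (\<lambda>(u, P). {..length P}))" using W by auto
      show "\<phi> ` Z \<subseteq> Sigma W (\<lambda>(u, P). {..length P})"
        by (auto simp: \<phi>_def Z_def supp_def term_W)
      show "\<forall>z\<in>Sigma W (\<lambda>(u, P). {..length P}) - \<phi> ` Z. (case z of (x, k) \<Rightarrow> t x k) = 0"
      proof
        fix z assume z: "z \<in> Sigma W (\<lambda>(u, P). {..length P}) - \<phi> ` Z"
        obtain u P k where zk: "z = ((u, P), k)" by (metis prod.exhaust)
        then have k: "k \<le> length P" using z by auto
        have "f (path_end Q u (take k P), drop k P) * g (u, take k P) = 0"
        proof (rule ccontr)
          assume "f (path_end Q u (take k P), drop k P) * g (u, take k P) \<noteq> 0"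
          then have "((path_end Q u (take k P), drop k P), (u, take k P)) \<in> Z"
            by (auto simp: Z_def supp_def)
          then have "\<phi> ((path_end Q u (take k P), drop k P), (u, take k P)) \<in> \<phi> ` Z" by (rule imageI)
          moreover have "\<phi> ((path_end Q u (take k P), drop k P), (u, take k P)) = z"
            using k by (simp add: \<phi>_def zk)
          ultimately show False using z by simp
        qed
        then show "(case z of (x, k) \<Rightarrow> t x k) = 0" by (simp add: t_def zk)
      qed
    qed
    also have "\<dots> = (\<Sum>z\<in>Z. case \<phi> z of (x, k) \<Rightarrow> t x k)"
    proof (subst sum.reindex)
      show "inj_on \<phi> Z" by (auto simp: inj_on_def \<phi>_def Z_def)
    qed (simp add: comp_def)
    also have "\<dots> = (\<Sum>(x, y)\<in>Z. t' x y)"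
      by (rule sum.cong) (auto simp: \<phi>_def Z_def t_def t'_def path_end_append)
    also have "\<dots> = (\<Sum>(x, y)\<in>?F \<times> ?G. t' x y)"
      by (rule sum.mono_neutral_left) (use F G in \<open>auto simp: Z_def t'_def split: if_splits\<close>)
    also have "\<dots> = (\<Sum>x\<in>?F. if pend x = i then f x * path_act x (?a g v) r else 0)"
      unfolding sum.cartesian_product[symmetric]
    proof (rule sum.cong[OF refl])
      fix x assume x: "x \<in> ?F"
      obtain w q where wq: "x = (w, q)" by (cases x)
      have path: "(w, q) \<in> quiver_paths Q" using x F wq by auto
      show "(\<Sum>y\<in>?G. t' x y) = (if pend x = i then f x * path_act x (?a g v) r else 0)"
      proof (cases "path_end Q w q = i")
        case True
        have "path_act x (?a g v) r = (\<Sum>j<d w. path_mat Q d M w q $$ (r, j) *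
            (\<Sum>y\<in>?G. if pend y = w then g y * path_act y v j else 0))"
          using path r True by (simp add: wq path_act_sum rep_action[OF G(1) subset_refl])
        also have "\<dots> = (\<Sum>y\<in>?G. if pend y = w then g y *
            (\<Sum>j<d w. path_mat Q d M w q $$ (r, j) * path_act y v j) else 0)"
          unfolding sum_distrib_left
          by (subst sum.swap) (auto intro!: sum.cong simp: sum_distrib_left algebra_simps)
        also have "\<dots> = (\<Sum>y\<in>?G. if pend y = w then g y * path_act (fst y, snd y @ q) v r else 0)"
        proof (intro sum.cong refl if_cong arg_cong2[where f = "(*)"])
          fix y assume y: "y \<in> ?G" and y_end: "pend y = w"
          obtain u p where up: "y = (u, p)" by (cases y)
          have yp: "(u, p) \<in> quiver_paths Q" "path_end Q u p = w" using y G y_end up by auto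
          have upq: "(u, p @ q) \<in> quiver_paths Q" using yp path by (simp add: path_append_iff)
          have c: "path_mat Q d M w q \<in> carrier_mat (d i) (d w)" "path_mat Q d M u p \<in> carrier_mat (d w) (d u)"
            using path_mat_carrier[OF path] path_mat_carrier[OF yp(1)] True yp(2) by simp_all
          have cv: "comp_vec v u \<in> carrier_vec (d u)" by (simp add: comp_vec_def)
          have "path_act (u, p @ q) v r
              = (path_mat Q d M w q *\<^sub>v (path_mat Q d M u p *\<^sub>v comp_vec v u)) $ r"
            using path_mat_append[OF upq] assoc_mult_mat_vec[OF c cv] yp(2) by (simp add: path_act_def)
          also have "\<dots> = (\<Sum>j<d w. path_mat Q d M w q $$ (r, j) * path_act y v j)"
            using c r by (auto simp: scalar_prod_def path_act_def up atLeast0LessThan intro!: sum.cong)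
          finally show "(\<Sum>j<d w. path_mat Q d M w q $$ (r, j) * path_act y v j)
              = path_act (fst y, snd y @ q) v r" by (simp add: up)
        qed
        finally have "f x * path_act x (?a g v) r
            = (\<Sum>y\<in>?G. if pend y = w then f x * g y * path_act (fst y, snd y @ q) v r else 0)"
          by (auto simp: sum_distrib_left algebra_simps intro!: sum.cong)
        then show ?thesis using True by (auto simp: wq t'_def intro!: sum.cong)
      qed (simp add: wq t'_def case_prod_unfold)
    qed
    also have "\<dots> = ?a f (?a g v) (i, r)"
      using r by (simp add: rep_action[OF F(1) subset_refl])
    finally show ?thesis .
  qed
qed

lemma fd_module_rep: "fd_module (path_algebra Q) (rep_module Q d M)"
proof -
  let ?N = "rep_module Q d M"
  let ?D = "Sigma (verts Q) (\<lambda>i. {..<d i})"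
  define unit where "unit x = (\<lambda>y. if y = x then 1 else 0 :: 'k)" for x :: "'v \<times> nat"
  have "v \<in> fun_vs.span (unit ` ?D)" if v: "v \<in> underlying ?N" for v
  proof -
    have "v = (\<Sum>x\<in>?D. fun_scale (v x) (unit x))"
    proof
      fix y
      have "(\<Sum>x\<in>?D. fun_scale (v x) (unit x)) y = (\<Sum>x\<in>?D. if y = x then v x else 0)"
        unfolding sum_fun_apply fun_scale_def unit_def by (rule sum.cong) auto
      also have "\<dots> = v y" using v by (cases y) (auto simp: underlying_rep)
      finally show "v y = (\<Sum>x\<in>?D. fun_scale (v x) (unit x)) y" ..
    qed
    also have "\<dots> \<in> fun_vs.span (unit ` ?D)"
      by (intro fun_vs.span_sum fun_vs.span_scale fun_vs.span_base) auto
    finally show ?thesis .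
  qed
  then have span: "\<exists>S. finite S \<and> underlying ?N \<subseteq> fun_vs.span S"
    by (intro exI[of _ "unit ` ?D"]) auto
  have sub: "fun_vs.subspace (underlying ?N)"
    unfolding fun_vs.subspace_def
  proof (intro conjI ballI allI)
    show "0 \<in> underlying ?N" by (simp add: underlying_rep zero_fun_apply)
    show "fun_scale k v \<in> underlying ?N" if "v \<in> underlying ?N" for k v
      using that unfolding underlying_rep fun_scale_def by auto
    show "v + w \<in> underlying ?N" if "v \<in> underlying ?N" "w \<in> underlying ?N" for v w
      unfolding underlying_rep
    proof (intro allI impI)
      fix i r assume "(v + w) (i, r) \<noteq> 0"
      then have "v (i, r) \<noteq> 0 \<or> w (i, r) \<noteq> 0" by (auto simp: plus_fun_apply)
      with that show "i \<in> verts Q \<and> r < d i" unfolding underlying_rep by blast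
    qed
  qed
  have path_supp: "w \<in> quiver_paths Q" if "f \<in> carrier (path_algebra Q)" "w \<in> supp f" for f :: "'v \<times> 'a list \<Rightarrow> 'k" and w
    using that by (auto simp: path_algebra_simps)
  show ?thesis
    unfolding fd_module_def
  proof (intro conjI ballI allI span sub)
    fix f :: "'v \<times> 'a list \<Rightarrow> 'k" and v assume v: "v \<in> underlying ?N"
    show "action ?N \<one>\<^bsub>path_algebra Q\<^esub> v = v"
    proof (rule ext, clarify)
      fix i r
      have "supp (\<one>\<^bsub>path_algebra Q\<^esub> :: 'v \<times> 'a list \<Rightarrow> 'k) \<subseteq> (\<lambda>u. (u, [])) ` verts Q"
        by (auto simp: supp_def path_algebra_simps split: if_splits)
      note one_act = rep_action[OF _ this]
      have "action ?N \<one>\<^bsub>path_algebra Q\<^esub> v (i, r) = (if r < d i then \<Sum>w\<in>(\<lambda>u. (u, [])) ` verts Q.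
          if pend w = i then \<one>\<^bsub>path_algebra Q\<^esub> w * path_act w v r else 0 else 0)"
        by (rule one_act) simp
      also have "\<dots> = (if r < d i then \<Sum>u\<in>verts Q. if u = i then path_act (u, []) v r else 0 else 0)"
        by (subst sum.reindex)
          (auto simp: inj_on_def trivial_path path_algebra_simps intro!: sum.cong)
      also have "\<dots> = v (i, r)"
        using v by (auto simp: underlying_rep path_act_def comp_vec_def)
      finally show "action ?N \<one>\<^bsub>path_algebra Q\<^esub> v (i, r) = v (i, r)" .
    qed
    assume f: "f \<in> carrier (path_algebra Q)"
    have ff: "finite (supp f)" using f by (simp add: path_algebra_simps)
    note act = rep_action[OF ff subset_refl]
    show "action ?N f v \<in> underlying ?N"
      unfolding underlying_rep
    proof (intro allI impI)
      fix i r assume nz: "action ?N f v (i, r) \<noteq> 0"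
      then have "r < d i" by (auto simp: act split: if_splits)
      with nz have "(\<Sum>w\<in>supp f. if pend w = i then f w * path_act w v r else 0) \<noteq> 0"
        by (simp add: act)
      then obtain w where "w \<in> supp f" "(if pend w = i then f w * path_act w v r else 0) \<noteq> 0"
        by (rule sum.not_neutral_contains_not_neutral)
      then have w: "w \<in> supp f" "pend w = i" by (simp_all split: if_splits)
      have "i \<in> verts Q" using path_supp[OF f w(1)] path_ends_in_verts[of "fst w" "snd w"] w(2) by simp
      with \<open>r < d i\<close> show "i \<in> verts Q \<and> r < d i" by simp
    qed
    show "action ?N f (v + w) = action ?N f v + action ?N f w" for w
      by (rule ext, clarify)
        (auto simp: act plus_fun_apply path_act_add path_supp[OF f] algebra_simps
          simp flip: sum.distrib intro!: sum.cong)
    show "action ?N f (fun_scale k v) = fun_scale k (action ?N f v)" for k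
      by (rule ext, clarify)
        (auto simp: act fun_scale_def[of k "action ?N f v"] path_act_scale path_supp[OF f] sum_distrib_left intro!: sum.cong)
    show "action ?N (k \<odot>\<^bsub>path_algebra Q\<^esub> f) v = fun_scale k (action ?N f v)" for k
    proof (rule ext, clarify)
      fix i r
      have "supp (k \<odot>\<^bsub>path_algebra Q\<^esub> f) \<subseteq> supp f" by (auto simp: supp_def path_algebra_simps)
      from rep_action[OF ff this]
      show "action ?N (k \<odot>\<^bsub>path_algebra Q\<^esub> f) v (i, r) = fun_scale k (action ?N f v) (i, r)"
        by (auto simp: act fun_scale_def path_algebra_simps sum_distrib_left intro!: sum.cong)
    qed
    fix g :: "'v \<times> 'a list \<Rightarrow> 'k" assume g: "g \<in> carrier (path_algebra Q)"
    show "action ?N (g \<otimes>\<^bsub>path_algebra Q\<^esub> f) v = action ?N g (action ?N f v)"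
      by (rule rep_module_mult[OF g f])
    show "action ?N (g \<oplus>\<^bsub>path_algebra Q\<^esub> f) v = action ?N g v + action ?N f v"
    proof (rule ext, clarify)
      fix i r
      let ?W = "supp g \<union> supp f"
      have W: "finite ?W" using ff g by (simp add: path_algebra_simps)
      have "supp (g \<oplus>\<^bsub>path_algebra Q\<^esub> f) \<subseteq> ?W" by (auto simp: supp_def path_algebra_simps)
      from rep_action[OF W this] rep_action[OF W, of f] rep_action[OF W, of g]
      show "action ?N (g \<oplus>\<^bsub>path_algebra Q\<^esub> f) v (i, r) = (action ?N g v + action ?N f v) (i, r)"
        by (auto simp: plus_fun_apply path_algebra_simps algebra_simps simp flip: sum.distrib intro!: sum.cong)
    qed
  qed
qed

end

end

context path_algebra_quiver
begin

lemma arrow_ideal_power_mult: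
  fixes f g :: "'v \<times> 'a list \<Rightarrow> 'k::field"
  assumes "ring (path_algebra Q :: ('k, 'v \<times> 'a list \<Rightarrow> 'k) module)"
    and f: "f \<in> arrow_ideal_power Q k" and g: "g \<in> arrow_ideal_power Q l"
  shows "f \<otimes>\<^bsub>path_algebra Q\<^esub> g \<in> arrow_ideal_power Q (k + l)"
proof -
  interpret K: ring "path_algebra Q :: ('k, 'v \<times> 'a list \<Rightarrow> 'k) module" by fact
  have "k + l \<le> length p" if "(f \<otimes>\<^bsub>path_algebra Q\<^esub> g) (u, p) \<noteq> 0" for u p
  proof -
    have "(\<Sum>j\<le>length p. f (path_end Q u (take j p), drop j p) * g (u, take j p)) \<noteq> 0"
      using that by (simp add: path_algebra_simps)
    then obtain j where "j \<in> {..length p}" "f (path_end Q u (take j p), drop j p) * g (u, take j p) \<noteq> 0"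
      by (rule sum.not_neutral_contains_not_neutral)
    then have j: "j \<le> length p" "f (path_end Q u (take j p), drop j p) \<noteq> 0" "g (u, take j p) \<noteq> 0"
      by simp_all
    have "k \<le> length (drop j p)" "l \<le> length (take j p)"
      using f g j(2,3) unfolding arrow_ideal_power_def by blast+
    with j(1) show ?thesis by simp
  qed
  then show ?thesis
    using f g by (simp add: arrow_ideal_power_def)
qed

context
  fixes I :: "('v \<times> 'a list \<Rightarrow> 'k::field) set"
  assumes adm: "admissible_ideal Q I"
begin

abbreviation "KQ \<equiv> path_algebra Q :: ('k, 'v \<times> 'a list \<Rightarrow> 'k) module"

lemma ideal_I: "ideal I KQ" using adm by (simp add: admissible_ideal_def)

lemma ring_KQ: "ring KQ" using ideal_I by (simp add: ideal_def)

lemma quotient_algebra_KQ: "quotient_algebra KQ I (quot_algebra KQ I)"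
  by (intro quotient_algebra.intro quotient_algebra_axioms.intro k_algebra_path_algebra ring_KQ ideal_I refl)

text \<open>
  There are finitely many paths of length less than \<open>m\<close>, and an element of \<open>KQ\<close> whose coefficients at
  these paths vanish lies in \<open>I\<close> if \<open>I\<close> contains all paths of length at least \<open>m\<close>.
\<close>

lemma fd_algebra_KQ_quot: "\<exists>\<iota>. fd_algebra (quot_algebra KQ I) \<iota>"
proof -
  interpret q: quotient_algebra KQ I "quot_algebra KQ I" by (rule quotient_algebra_KQ)
  obtain m where m: "arrow_ideal_power Q m \<subseteq> I" using adm by (auto simp: admissible_ideal_def)
  let ?W = "{(u, p). (u, p) \<in> quiver_paths Q \<and> length p < m}"
  obtain w where w: "bij_betw w {..<card ?W} ?W"
    using ex_bij_betw_nat_finite[OF finite_short_paths[of m]] by (auto simp: atLeast0LessThan)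
  define l where "l f = (\<lambda>i. if i < card ?W then f (w i) else 0)" for f :: "'v \<times> 'a list \<Rightarrow> 'k"
  show ?thesis
  proof (rule q.fd_algebra_quot)
    show "l (f \<oplus>\<^bsub>KQ\<^esub> g) = l f + l g" for f g
      by (rule ext) (simp add: l_def path_algebra_simps plus_fun_apply)
    show "l (k \<odot>\<^bsub>KQ\<^esub> f) = fun_scale k (l f)" for k f
      by (rule ext) (simp add: l_def path_algebra_simps fun_scale_def)
    show "f \<in> I" if f: "f \<in> carrier KQ" and lf: "l f = 0" for f
    proof -
      have "m \<le> length p" if nz: "f (u, p) \<noteq> 0" for u p
      proof (rule ccontr)
        assume "\<not> m \<le> length p"
        moreover have "(u, p) \<in> quiver_paths Q" using f nz by (auto simp: path_algebra_simps supp_def)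
        ultimately have "(u, p) \<in> w ` {..<card ?W}" using w by (simp add: bij_betw_def)
        then obtain i where i: "(u, p) = w i" "i \<in> {..<card ?W}" by (rule imageE)
        then have "f (u, p) = l f i" by (simp add: l_def)
        then show False using nz by (simp add: lf zero_fun_apply)
      qed
      with f have "f \<in> arrow_ideal_power Q m" by (simp add: arrow_ideal_power_def)
      with m show ?thesis by blast
    qed
    define unit where "unit i = (\<lambda>j. if j = i then 1 else 0 :: 'k)" for i :: nat
    show "finite (unit ` {..<card ?W})" by simp
    show "l ` carrier KQ \<subseteq> fun_vs.span (unit ` {..<card ?W})"
    proof (rule image_subsetI)
      fix f :: "'v \<times> 'a list \<Rightarrow> 'k"
      have "l f = (\<Sum>i<card ?W. fun_scale (f (w i)) (unit i))"
      proof
        fix j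
        have "(\<Sum>i<card ?W. fun_scale (f (w i)) (unit i)) j = (\<Sum>i<card ?W. if j = i then f (w i) else 0)"
          unfolding sum_fun_apply fun_scale_def unit_def by (rule sum.cong) auto
        also have "\<dots> = l f j" by (simp add: l_def)
        finally show "l f j = (\<Sum>i<card ?W. fun_scale (f (w i)) (unit i)) j" ..
      qed
      also have "\<dots> \<in> fun_vs.span (unit ` {..<card ?W})"
        by (intro fun_vs.span_sum fun_vs.span_scale fun_vs.span_base) auto
      finally show "l f \<in> fun_vs.span (unit ` {..<card ?W})" .
    qed
  qed
qed

section \<open>Annihilation by an idempotent depends on the dimension vector only\<close>

definition trivial_part :: "('v \<times> 'a list \<Rightarrow> 'k) \<Rightarrow> 'v \<times> 'a list \<Rightarrow> 'k" where
  "trivial_part x = (\<lambda>(u, p). if p = [] then x (u, p) else 0)"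

definition arrow_part :: "('v \<times> 'a list \<Rightarrow> 'k) \<Rightarrow> 'v \<times> 'a list \<Rightarrow> 'k" where
  "arrow_part x = (\<lambda>(u, p). if p = [] then 0 else x (u, p))"

lemma parts:
  assumes x: "x \<in> carrier KQ"
  shows "trivial_part x \<in> carrier KQ" "arrow_part x \<in> arrow_ideal_power Q 1"
    "x = trivial_part x \<oplus>\<^bsub>KQ\<^esub> arrow_part x"
proof -
  have "supp (trivial_part x) \<subseteq> supp x" "supp (arrow_part x) \<subseteq> supp x"
    by (auto simp: supp_def trivial_part_def arrow_part_def split: if_splits)
  then show "trivial_part x \<in> carrier KQ" "arrow_part x \<in> arrow_ideal_power Q 1"
    using x by (auto simp: path_algebra_simps arrow_ideal_power_def finite_subset arrow_part_def
        Suc_le_eq split: if_splits)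
  show "x = trivial_part x \<oplus>\<^bsub>KQ\<^esub> arrow_part x"
    by (rule ext, clarify) (simp add: path_algebra_simps trivial_part_def arrow_part_def)
qed

context
  fixes d :: "'v \<Rightarrow> nat" and M :: "'a \<Rightarrow> 'k mat"
  assumes M: "M \<in> mod_var Q I d"
begin

lemma M_rep: "M \<in> rep Q d" using M by (simp add: mod_var_def)

lemma I_annihilates: "f \<in> I \<Longrightarrow> annihilates f (rep_module Q d M)"
  using M by (simp add: mod_var_def)

lemma trivial_part_action:
  assumes x: "x \<in> carrier KQ" and v: "v \<in> underlying (rep_module Q d M)"
  shows "action (rep_module Q d M) (trivial_part x) v (i, r) = x (i, []) * v (i, r)"
proof (cases "i \<in> verts Q \<and> r < d i")
  case True
  have "supp (trivial_part x) \<subseteq> (\<lambda>u. (u, [])) ` verts Q"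
  proof
    fix w assume w: "w \<in> supp (trivial_part x)"
    then have "w \<in> quiver_paths Q" using parts(1)[OF x] by (auto simp: path_algebra_simps)
    moreover have "w = (fst w, [])"
      using w by (cases w) (simp add: supp_def trivial_part_def split: if_splits)
    ultimately show "w \<in> (\<lambda>u. (u, [])) ` verts Q" by (metis imageI trivial_path(1))
  qed
  note act = rep_action[OF M_rep _ this]
  have "action (rep_module Q d M) (trivial_part x) v (i, r) = (if r < d i then
      \<Sum>w\<in>(\<lambda>u. (u, [])) ` verts Q. if path_end Q (fst w) (snd w) = i then trivial_part x w * path_act d M w v r else 0 else 0)"
    by (rule act) simp
  also have "\<dots> = (\<Sum>u\<in>verts Q. if u = i then x (u, []) * path_act d M (u, []) v r else 0)"
    using True
    by (subst sum.reindex) (auto simp: inj_on_def trivial_path trivial_part_def intro!: sum.cong)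
  also have "\<dots> = x (i, []) * v (i, r)"
    using True by (simp add: path_act_def[OF M_rep] comp_vec_def[OF M_rep])
  finally show ?thesis .
next
  case False
  then have "v (i, r) = 0" using v by (auto simp: underlying_rep[OF M_rep])
  moreover have "action (rep_module Q d M) (trivial_part x) v \<in> underlying (rep_module Q d M)"
    by (rule fdm_closed[OF fd_module_rep[OF M_rep] parts(1)[OF x] v])
  then have "action (rep_module Q d M) (trivial_part x) v (i, r) = 0"
    using False by (auto simp: underlying_rep[OF M_rep])
  ultimately show ?thesis by simp
qed

text \<open>The part of an element without trivial paths acts nilpotently, because \<open>I\<close> contains all long paths.\<close>

lemma arrow_part_nilpotent:
  assumes r: "r \<in> arrow_ideal_power Q 1" and m: "arrow_ideal_power Q m \<subseteq> I"
    and v: "v \<in> underlying (rep_module Q d M)"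
  shows "(action (rep_module Q d M) r ^^ m) v = 0"
proof -
  note N = fd_module_rep[OF M_rep]
  interpret K: ring KQ by (rule ring_KQ)
  have rC: "r \<in> carrier KQ" using r by (simp add: arrow_ideal_power_def)
  have "\<exists>f\<in>arrow_ideal_power Q n. \<forall>v\<in>underlying (rep_module Q d M).
      (action (rep_module Q d M) r ^^ n) v = action (rep_module Q d M) f v" for n
  proof (induction n)
    case 0
    have "\<one>\<^bsub>KQ\<^esub> \<in> arrow_ideal_power Q 0" by (simp add: arrow_ideal_power_def)
    then show ?case using fdm_one[OF N] by force
  next
    case (Suc n)
    then obtain f where f: "f \<in> arrow_ideal_power Q n"
      "\<forall>v\<in>underlying (rep_module Q d M). (action (rep_module Q d M) r ^^ n) v = action (rep_module Q d M) f v"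
      by blast
    have fC: "f \<in> carrier KQ" using f(1) by (simp add: arrow_ideal_power_def)
    have "(action (rep_module Q d M) r ^^ Suc n) v = action (rep_module Q d M) (r \<otimes>\<^bsub>KQ\<^esub> f) v"
      if "v \<in> underlying (rep_module Q d M)" for v
      using f(2) that by (simp add: fdm_mult[OF N rC fC])
    moreover have "r \<otimes>\<^bsub>KQ\<^esub> f \<in> arrow_ideal_power Q (Suc n)"
      using arrow_ideal_power_mult[OF ring_KQ r f(1)] by simp
    ultimately show ?case by blast
  qed
  then obtain f where "f \<in> arrow_ideal_power Q m"
    "(action (rep_module Q d M) r ^^ m) v = action (rep_module Q d M) f v"
    using v by metis
  moreover from this(1) m have "f \<in> I" by blast
  ultimately show ?thesis using I_annihilates[of f] v by (simp add: annihilates_def)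
qed

text \<open>
  Otherwise \<open>arrow_part x\<close>, which acts nilpotently, would multiply a basis vector at the vertex \<open>i\<close>
  by the non-zero scalar \<open>- x (i, [])\<close>.
\<close>

lemma annihilator_trivial_coefficient:
  assumes x: "x \<in> carrier KQ" and xN: "annihilates x (rep_module Q d M)"
    and i: "i \<in> verts Q" "0 < d i"
  shows "x (i, []) = 0"
proof (rule ccontr)
  let ?N = "rep_module Q d M" and ?c = "x (i, [])" and ?r = "arrow_part x"
  note N = fd_module_rep[OF M_rep]
  assume c: "?c \<noteq> 0"
  obtain m where m: "arrow_ideal_power Q m \<subseteq> I" using adm by (auto simp: admissible_ideal_def)
  have rC: "?r \<in> carrier KQ" using parts(2)[OF x] by (simp add: arrow_ideal_power_def)
  define v where "v = (\<lambda>y. if y = (i, 0 :: nat) then 1 else 0 :: 'k)"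
  have v: "v \<in> underlying ?N" using i by (auto simp: underlying_rep[OF M_rep] v_def)
  have "action ?N (trivial_part x) v = fun_scale ?c v"
    by (rule ext, clarify) (simp only: trivial_part_action[OF x v] fun_scale_def, simp add: v_def)
  moreover have "action ?N x v = action ?N (trivial_part x) v + action ?N ?r v"
    using arg_cong[OF parts(3)[OF x], of "\<lambda>y. action ?N y v"] fdm_add_left[OF N parts(1)[OF x] rC v] by (rule trans)
  moreover have "action ?N x v = 0" using xN v by (simp add: annihilates_def)
  ultimately have "0 = fun_scale ?c v + action ?N ?r v" by simp
  then have rv: "action ?N ?r v = fun_scale (- ?c) v"
    by (metis add.commute add_implies_diff diff_0 fun_vs.scale_minus_left)
  have "(action ?N ?r ^^ n) v = fun_scale ((- ?c) ^ n) v" for n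
  proof (induction n)
    case (Suc n)
    have "action ?N ?r (fun_scale ((- ?c) ^ n) v) = fun_scale ((- ?c) ^ n) (fun_scale (- ?c) v)"
      using fdm_scale[OF N rC v] rv by metis
    then show ?case using Suc by (simp add: mult.commute)
  qed simp
  then have "fun_scale ((- ?c) ^ m) v = 0"
    using arrow_part_nilpotent[OF parts(2)[OF x] m v] by simp
  then have "(fun_scale ((- ?c) ^ m) v) (i, 0) = 0" by (simp only: zero_fun_apply)
  then show False using c by (simp add: fun_scale_def v_def)
qed

text \<open>
  By the assumption on the coefficients, \<open>x\<close> acts like \<open>arrow_part x\<close>, hence nilpotently, and a
  nilpotent idempotent endomorphism is zero.
\<close>

lemma idempotent_without_trivial_part:
  assumes x: "x \<in> carrier KQ"
    and idem: "\<And>v. v \<in> underlying (rep_module Q d M) \<Longrightarrow>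
      action (rep_module Q d M) x (action (rep_module Q d M) x v) = action (rep_module Q d M) x v"
    and coeff: "\<And>i. i \<in> verts Q \<Longrightarrow> 0 < d i \<Longrightarrow> x (i, []) = 0"
  shows "annihilates x (rep_module Q d M)"
  unfolding annihilates_def
proof
  let ?N = "rep_module Q d M" and ?r = "arrow_part x"
  note N = fd_module_rep[OF M_rep]
  obtain m where m: "m \<ge> 2" "arrow_ideal_power Q m \<subseteq> I" using adm by (auto simp: admissible_ideal_def)
  have rC: "?r \<in> carrier KQ" using parts(2)[OF x] by (simp add: arrow_ideal_power_def)
  have xr: "action ?N x v = action ?N ?r v" if v: "v \<in> underlying ?N" for v
  proof -
    have "action ?N (trivial_part x) v = 0"
    proof (rule ext, clarify)
      fix i r
      have "x (i, []) = 0" if "v (i, r) \<noteq> 0"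
      proof -
        have "i \<in> verts Q" "r < d i" using v that unfolding underlying_rep[OF M_rep] by blast+
        then show ?thesis by (intro coeff) simp_all
      qed
      then show "action ?N (trivial_part x) v (i, r) = 0 (i, r)"
        by (auto simp: trivial_part_action[OF x v] zero_fun_apply)
    qed
    moreover have "action ?N x v = action ?N (trivial_part x) v + action ?N ?r v"
      using arg_cong[OF parts(3)[OF x], of "\<lambda>y. action ?N y v"] fdm_add_left[OF N parts(1)[OF x] rC v] by (rule trans)
    ultimately show ?thesis by simp
  qed
  fix v assume v: "v \<in> underlying ?N"
  have "(action ?N ?r ^^ Suc n) v = action ?N x v" for n
  proof (induction n)
    case (Suc n)
    then have "(action ?N ?r ^^ Suc (Suc n)) v = action ?N ?r (action ?N x v)" by simp
    also have "\<dots> = action ?N x (action ?N x v)" using xr[OF fdm_closed[OF N x v]] ..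
    finally show ?case using idem[OF v] by simp
  qed (simp add: xr[OF v])
  from this[of "m - 1"] show "action ?N x v = 0"
    using arrow_part_nilpotent[OF parts(2)[OF x] m(2) v] m(1) by simp
qed

end

text \<open>
  Modulo \<open>I\<close>, write \<open>e = c + r\<close> with \<open>c\<close> a combination of trivial paths and \<open>r\<close> one of non-trivial paths. Both
  \<open>eM = 0\<close> and \<open>eM' = 0\<close> are equivalent to the vanishing of the coefficients of \<open>c\<close> at the vertices
  in the support of the common dimension vector.
\<close>

lemma idempotent_annihilates_by_dimension:
  assumes e: "e \<in> carrier (quot_algebra KQ I)" and idem: "e \<otimes>\<^bsub>quot_algebra KQ I\<^esub> e = e"
    and M: "M \<in> mod_var Q I d" and eM: "annihilates e (A_module Q d M)"
    and M': "M' \<in> mod_var Q I d"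
  shows "annihilates e (A_module Q d M')"
proof -
  interpret q: quotient_algebra KQ I "quot_algebra KQ I" by (rule quotient_algebra_KQ)
  obtain x where x: "x \<in> carrier KQ" "e = I +>\<^bsub>KQ\<^esub> x" using q.quot_carrierD[OF e] by blast
  have act: "action (A_module Q d L) e v = action (rep_module Q d L) x v"
    if L: "L \<in> mod_var Q I d" and v: "v \<in> underlying (rep_module Q d L)" for L v
    unfolding A_module_def x(2)
    by (rule q.quot_module_action[OF fd_module_rep[OF M_rep[OF L]] I_annihilates[OF L] x(1) v])
  have ann: "annihilates e (A_module Q d L) \<longleftrightarrow> annihilates x (rep_module Q d L)"
    if L: "L \<in> mod_var Q I d" for L
    using act[OF L] by (simp add: annihilates_def A_module_def)
  have "x (i, []) = 0" if "i \<in> verts Q" "0 < d i" for i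
    using annihilator_trivial_coefficient[OF M x(1) _ that] eM ann[OF M] by blast
  moreover have "action (rep_module Q d M') x (action (rep_module Q d M') x v) = action (rep_module Q d M') x v"
    if v: "v \<in> underlying (rep_module Q d M')" for v
  proof -
    note N = fd_module_rep[OF M_rep[OF M']]
    have B: "fd_module (quot_algebra KQ I) (A_module Q d M')"
      unfolding A_module_def by (rule q.fd_module_quot_module[OF N I_annihilates[OF M']])
    have vA: "v \<in> underlying (A_module Q d M')" using v by (simp add: A_module_def)
    have "action (A_module Q d M') e (action (A_module Q d M') e v) = action (A_module Q d M') e v"
      using fdm_mult[OF B e e vA] by (simp add: idem)
    then show ?thesis using act[OF M' v] act[OF M' fdm_closed[OF N x(1) v]] by simp
  qed
  ultimately have "annihilates x (rep_module Q d M')"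
    by (intro idempotent_without_trivial_part[OF M' x(1)])
  then show ?thesis by (simp add: ann[OF M'])
qed

lemma idempotent_quotient_KQ:
  assumes "fd_algebra (quot_algebra KQ I) \<iota>"
    and "e \<in> carrier (quot_algebra KQ I)" "e \<otimes>\<^bsub>quot_algebra KQ I\<^esub> e = e"
    and "AeA = Idl\<^bsub>quot_algebra KQ I\<^esub> {e}"
  shows "idempotent_quotient (quot_algebra KQ I) \<iota> AeA (quot_algebra (quot_algebra KQ I) AeA) e"
proof -
  interpret A: fd_algebra "quot_algebra KQ I" \<iota> by fact
  have "ideal AeA (quot_algebra KQ I)" unfolding assms(4) using assms(2) by (intro A.genideal_ideal) simp
  then show ?thesis
    using assms
    by (intro idempotent_quotient.intro quotient_algebra.intro quotient_algebra_axioms.intro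
        idempotent_quotient_axioms.intro A.k_algebra_axioms refl)
qed

end

end

section \<open>Generically tau-regular components\<close>

theorem corollary1p3:
  fixes Q :: "(nat, 'a) pre_digraph"
    and n :: nat
    and I :: "(nat \<times> 'a list \<Rightarrow> 'k::alg_closed_field) set"
    and A :: "('k, (nat \<times> 'a list \<Rightarrow> 'k) set) module"
    and e :: "(nat \<times> 'a list \<Rightarrow> 'k) set"
    and AeA :: "(nat \<times> 'a list \<Rightarrow> 'k) set set"
    and B :: "('k, (nat \<times> 'a list \<Rightarrow> 'k) set set) module"
  assumes "fin_digraph Q" and "verts Q = {1..n}"
    and "admissible_ideal Q I"
    and "A = quot_algebra (path_algebra Q) I"
    and "e \<in> carrier A" and "e \<otimes>\<^bsub>A\<^esub> e = e"
    and "AeA = Idl\<^bsub>A\<^esub> {e}"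
    and "B = quot_algebra A AeA"
  shows "Irr Q (quot_mod_var Q I AeA) \<inter> Irr_tau Q A (mod_var Q I) (A_module Q) =
    Irr_tau Q B (quot_mod_var Q I AeA) (B_module Q)"
proof -
  interpret path_algebra_quiver Q by (rule path_algebra_quiver.intro) fact
  note adm = assms(3)
  obtain \<iota> where "fd_algebra A \<iota>" using fd_algebra_KQ_quot[OF adm] unfolding assms(4) by blast
  then have "idempotent_quotient A \<iota> AeA B e"
    using idempotent_quotient_KQ[OF adm] assms(4-8) by blast
  then interpret q: idempotent_quotient A \<iota> AeA B e .
  interpret K: quotient_algebra "path_algebra Q" I A
    unfolding assms(4) by (rule quotient_algebra_KQ[OF adm])
  let ?XA = "mod_var Q I" and ?XB = "quot_mod_var Q I AeA"
  have fA: "fd_module A (A_module Q d M)" if M: "M \<in> ?XA d" for d M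
    unfolding A_module_def
    by (rule K.fd_module_quot_module[OF fd_module_rep[OF M_rep[OF adm M]] I_annihilates[OF adm M]])
  have XB: "M \<in> ?XB d \<longleftrightarrow> M \<in> ?XA d \<and> annihilates e (A_module Q d M)" for d M
    using q.annihilated_by_J_iff[OF fA, of M d] by (auto simp: quot_mod_var_def)
  have same: "?XB d = ?XA d" if ne: "?XB d \<noteq> {}" for d
  proof -
    obtain M where "M \<in> ?XB d" using ne by blast
    then have M: "M \<in> ?XA d" "annihilates e (A_module Q d M)" unfolding XB by blast+
    have "M' \<in> ?XB d" if "M' \<in> ?XA d" for M'
      unfolding XB
      using idempotent_annihilates_by_dimension[OF adm, folded assms(4), OF assms(5,6) M that] that by blast
    then show ?thesis unfolding set_eq_iff using XB by blast
  qed
  have E: "E_inv A (A_module Q d M) = E_inv B (B_module Q d M)" if "M \<in> ?XB d" for d M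
    unfolding B_module_def using that by (intro q.E_inv_quot_module fA) (simp_all add: XB)
  have Z: "Z \<noteq> {} \<and> Z \<subseteq> ?XB d" if "Z \<in> variety_components Q ?XB d" for d Z
    using that
    by (auto simp: variety_components_def irreducible_components_def irreducible_in_def topspace_subtopology)
  have comp: "variety_components Q ?XA d = variety_components Q ?XB d"
    and c: "c_inv Q ?XA d M = c_inv Q ?XB d M"
    if "Z \<in> variety_components Q ?XB d" for d Z M
  proof -
    have "?XB d \<noteq> {}" using Z[OF that] by auto
    from same[OF this] show "variety_components Q ?XA d = variety_components Q ?XB d"
      by (simp add: variety_components_def)
    then show "c_inv Q ?XA d M = c_inv Q ?XB d M" by (simp add: c_inv_def)
  qed
  have reg: "(\<forall>M\<in>U. c_inv Q ?XA d M = int (E_inv A (A_module Q d M))) \<longleftrightarrow>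
      (\<forall>M\<in>U. c_inv Q ?XB d M = int (E_inv B (B_module Q d M)))"
    if "Z \<in> variety_components Q ?XB d" and U: "openin (subtopology (zariski Q d) Z) U" for d Z U
  proof (rule ball_cong[OF refl])
    fix M assume "M \<in> U"
    moreover have "U \<subseteq> Z" using openin_subset[OF U] by (simp add: topspace_subtopology)
    ultimately have "M \<in> ?XB d" using Z[OF that(1)] by blast
    then show "c_inv Q ?XA d M = int (E_inv A (A_module Q d M)) \<longleftrightarrow>
        c_inv Q ?XB d M = int (E_inv B (B_module Q d M))"
      by (simp add: c[OF that(1)] E)
  qed
  have "(d, Z) \<in> Irr Q ?XB \<inter> Irr_tau Q A ?XA (A_module Q) \<longleftrightarrow> (d, Z) \<in> Irr_tau Q B ?XB (B_module Q)" for d Z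
  proof (cases "Z \<in> variety_components Q ?XB d")
    case True
    then have "Z \<in> variety_components Q ?XA d" by (simp add: comp[OF True])
    with True show ?thesis unfolding Irr_tau_def by (simp add: Irr_def reg[OF True] cong: conj_cong)
  qed (simp add: Irr_tau_def Irr_def)
  then show ?thesis by (simp add: set_eq_iff split_paired_all)
qed

end
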